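(* Let $(X,d)$ be a complete metric space, $u^\ast\in X$, and let $\phi_\varepsilon\colon X\to(-\infty,+\infty]$ ($\varepsilon>0$) and $\phi\colon X\to(-\infty,+\infty]$ be such that the following three conditions hold for the family $(\phi_\varepsilon)_{\varepsilon>0}$, and also with $\phi$ in place of $\phi_\varepsilon$: (i) for all $\varepsilon>0$, $\phi_\varepsilon$ is lower semicontinuous; (ii) there exist $C^\ast\in\mathbb R$ and $\tau^\ast>0$ such that $\inf\bigl\{\phi_\varepsilon(v)+\frac{1}{2\tau^\ast}d^2(v,u^\ast): v\in X\bigr\}\geq C^\ast$ for all $\varepsilon>0$; (iii) for all $C>0$ there exists a compact set $K\subset X$ (independent of $\varepsilon$) such that $\{u\in X: d^2(u,u^\ast)\leq C,\ |\phi_\varepsilon(u)|\leq C\}\subset K$ for all $\varepsilon>0$. Assume moreover that for every sequence $\varepsilon_n\to 0$ of positive numbers and every sequence $v_n\to v$ in $X$ with $\sup_n\{|\phi_{\varepsilon_n}(v_n)|+|\partial\phi_{\varepsilon_n}|(v_n)\}<+\infty$ we have $$\lim_{n\to+\infty}\phi_{\varepsilon_n}(v_n)=\phi(v)\quad\text{and}\quad \liminf_{n\to+\infty}|\partial\phi_{\varepsilon_n}|(v_n)\geq|\partial\phi|(v).$$ Let $u^0_{\varepsilon,\tau}\in X$ be initial data for which there exist constants $S',S<+\infty$ such that $d^2(u^0_{\varepsilon,\tau},u^\ast)\leq S'$ and $|\phi_\varepsilon(u^0_{\varepsilon,\tau})|\leq S$ for all $\varepsilon,\tau$. Then, for every family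 $\tau_\varepsilon>0$ with $\lim_{\varepsilon\to0}\tau_\varepsilon=0$, any minimizing movement $u\colon[0,+\infty)\to X$ along $\phi_\varepsilon$ at scale $\tau_\varepsilon$ with initial data $u^0_{\varepsilon,\tau_\varepsilon}$ is a curve of maximal slope for $\phi$ in $[0,T]$ for every $T>0$.
   Context: Minimizing movements. Given $\phi_\varepsilon$, $\tau>0$ and an initial datum $u^0_{\varepsilon,\tau}$, a discrete solution is a sequence $\{u^i_{\varepsilon,\tau}\}_{i\ge0}$ starting at $u^0_{\varepsilon,\tau}$ such that, for each $i\ge 0$, $u^{i+1}_{\varepsilon,\tau}$ is a solution of $$\min\Bigl\{\phi_\varepsilon(v)+\frac1{2\tau}d^2(v,u^i_{\varepsilon,\tau}): v\in X\Bigr\}.$$ (Only $\tau<\tau^\ast$ is considered, with $\tau^\ast$ as in (ii); since $\tau_\varepsilon\to0$ this is the case for $\tau=\tau_\varepsilon$ with $\varepsilon$ small.) Given $\tau_\varepsilon\to0$ and such discrete solutions with $\tau=\tau_\varepsilon$, define the piecewise-constant functions $\overline u_\varepsilon\colon[0,+\infty)\to X$ by $\overline u_\varepsilon(t)=u^{i+1}_{\varepsilon,\tau_\varepsilon}$ for $t\in(i\tau_\varepsilon,(i+1)\tau_\varepsilon]$, and $\overline u_\varepsilon(0)=u^0_{\varepsilon,\tau_\varepsilon}$. A minimizing movement along $\phi_\varepsilon$ at scale $\tau_\varepsilon$ is any pointwise limit on $[0,+\infty)$ of a subsequence $\overline u_{\varepsilon_n}$, $\varepsilon_n\to0$. Descending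 slope. For $\phi\colon X\to(-\infty,+\infty]$, $|\partial\phi|(x)=\limsup_{y\to x}\frac{(\phi(x)-\phi(y))^+}{d(x,y)}$ if $\phi(x)<+\infty$ and $x$ is not isolated; $|\partial\phi|(x)=0$ if $\phi(x)<+\infty$ and $x$ is isolated; $|\partial\phi|(x)=+\infty$ if $\phi(x)=+\infty$. $AC^2$ curves. $v\colon[0,T]\to X$ belongs to $AC^2([0,T];X)$ if there exists $A\in L^2(0,T)$ with $d(v(s),v(t))\leq\int_s^tA(r)\,dr$ for all $0\leq s\leq t\leq T$. The (a.e.) smallest such $A$ is the metric derivative $|v'|$. Curve of maximal slope. A curve of maximal slope for $\phi$ in $[0,T]$ is a $u\in AC^2([0,T];X)$ such that there exist a non-increasing function $\varphi\colon[0,T]\to\mathbb R$ with $$\varphi(s)-\varphi(t)\geq\frac12\int_s^t|u'|^2(r)\,dr+\frac12\int_s^t|\partial\phi|^2(u(r))\,dr\quad\text{for all }0\leq s\leq t\leq T,$$ and a Lebesgue-negligible set $E$ such that $\phi(u(t))=\varphi(t)$ for all $t\in[0,T]\setminus E$. *)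

theory Defs
  imports "HOL-Analysis.Analysis"
begin

text \<open>
  A functional with values in \<open>(-\<infinity>, +\<infinity>]\<close> is an \<open>ereal\<close>-valued function; the exclusion of
  \<open>-\<infinity>\<close> is not part of the definitions below and has to be assumed separately.
\<close>

definition lower_semicontinuous :: "('a::topological_space \<Rightarrow> ereal) \<Rightarrow> bool" where
  "lower_semicontinuous f \<longleftrightarrow> (\<forall>x. f x \<le> Liminf (at x) f)"

text \<open>
  \<open>e2ennreal\<close> sends negative numbers to \<open>0\<close>, so it is the positive part. Isolated points need
  no special treatment in \<open>lower_semicontinuous\<close>, where the \<open>Liminf\<close> over the trivial filter
  is \<open>\<infinity>\<close>.
\<close>

definition descending_slope :: "('a::metric_space \<Rightarrow> ereal) \<Rightarrow> 'a \<Rightarrow> ennreal" where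
  "descending_slope f x =
     (if f x = \<infinity> then \<infinity>
      else if x isolated_in UNIV then 0
      else Limsup (at x) (\<lambda>y. e2ennreal (f x - f y) / ennreal (dist x y)))"

definition AC2_bound :: "real \<Rightarrow> (real \<Rightarrow> 'a::metric_space) \<Rightarrow> (real \<Rightarrow> real) \<Rightarrow> bool" where
  "AC2_bound T v A \<longleftrightarrow>
     A \<in> borel_measurable (lebesgue_on {0..T}) \<and>
     integrable (lebesgue_on {0..T}) (\<lambda>r. (A r)\<^sup>2) \<and>
     (\<forall>s t. 0 \<le> s \<and> s \<le> t \<and> t \<le> T \<longrightarrow> dist (v s) (v t) \<le> integral\<^sup>L (lebesgue_on {s..t}) A)"

definition AC2 :: "real \<Rightarrow> (real \<Rightarrow> 'a::metric_space) \<Rightarrow> bool" where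
  "AC2 T v \<longleftrightarrow> (\<exists>A. AC2_bound T v A)"

text \<open>The metric derivative is unique only up to null sets, hence a predicate.\<close>

definition is_metric_derivative :: "real \<Rightarrow> (real \<Rightarrow> 'a::metric_space) \<Rightarrow> (real \<Rightarrow> real) \<Rightarrow> bool" where
  "is_metric_derivative T v m \<longleftrightarrow>
     AC2_bound T v m \<and>
     (\<forall>A. AC2_bound T v A \<longrightarrow> (AE r in lebesgue_on {0..T}. m r \<le> A r))"

text \<open>
  The measurability clause makes the integral of the squared slope meaningful: on a
  non-measurable function, \<open>nn_integral\<close> would be a lower integral. The difference
  \<open>\<psi> s - \<psi> t\<close> is nonnegative because \<open>\<psi>\<close> is non-increasing, so nothing is lost in \<open>ennreal\<close>.
\<close>

definition curve_of_maximal_slope ::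
    "('a::metric_space \<Rightarrow> ereal) \<Rightarrow> real \<Rightarrow> (real \<Rightarrow> 'a) \<Rightarrow> bool" where
  "curve_of_maximal_slope f T u \<longleftrightarrow>
     AC2 T u \<and>
     (\<lambda>r. descending_slope f (u r)) \<in> borel_measurable (lebesgue_on {0..T}) \<and>
     (\<exists>m \<psi> E. is_metric_derivative T u m \<and>
        antimono_on {0..T} \<psi> \<and>
        (\<forall>s t. 0 \<le> s \<and> s \<le> t \<and> t \<le> T \<longrightarrow>
           ennreal (\<psi> s - \<psi> t) \<ge>
             (\<integral>\<^sup>+r. ennreal ((m r)\<^sup>2) \<partial>lebesgue_on {s..t}) / 2
           + (\<integral>\<^sup>+r. (descending_slope f (u r))\<^sup>2 \<partial>lebesgue_on {s..t}) / 2) \<and>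
        negligible E \<and>
        (\<forall>t\<in>{0..T} - E. f (u t) = ereal (\<psi> t)))"

definition discrete_solution ::
    "('a::metric_space \<Rightarrow> ereal) \<Rightarrow> real \<Rightarrow> 'a \<Rightarrow> (nat \<Rightarrow> 'a) \<Rightarrow> bool" where
  "discrete_solution f \<tau> x0 w \<longleftrightarrow>
     w 0 = x0 \<and>
     (\<forall>i. is_arg_min (\<lambda>v. f v + ereal ((dist v (w i))\<^sup>2 / (2 * \<tau>))) (\<lambda>_. True) (w (Suc i)))"

text \<open>For \<open>\<tau> > 0\<close> the value is \<open>w (i + 1)\<close> on \<open>(i \<tau>, (i + 1) \<tau>]\<close>, and \<open>w 0\<close> at \<open>0\<close>.\<close>

definition piecewise_constant :: "real \<Rightarrow> (nat \<Rightarrow> 'a) \<Rightarrow> real \<Rightarrow> 'a" where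
  "piecewise_constant \<tau> w t = w (nat \<lceil>t / \<tau>\<rceil>)"

text \<open>
  \<open>w \<epsilon>\<close> is the chosen discrete solution at scale \<open>\<tau> \<epsilon>\<close>. It is unconstrained when
  \<open>\<tau> \<epsilon> \<ge> \<tau>star\<close>; as \<open>\<tau> \<epsilon> \<longlongrightarrow> 0\<close>, this concerns only finitely many terms of the sequence
  \<open>\<delta>\<close> and does not affect the limit.
\<close>

definition minimizing_movement ::
    "real \<Rightarrow> (real \<Rightarrow> 'a::metric_space \<Rightarrow> ereal) \<Rightarrow> (real \<Rightarrow> real) \<Rightarrow> (real \<Rightarrow> 'a) \<Rightarrow> (real \<Rightarrow> 'a) \<Rightarrow> bool"
  where
  "minimizing_movement \<tau>star \<phi> \<tau> x0 u \<longleftrightarrow>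
     (\<exists>w \<delta>. (\<forall>\<epsilon>>0. \<tau> \<epsilon> < \<tau>star \<longrightarrow> discrete_solution (\<phi> \<epsilon>) (\<tau> \<epsilon>) (x0 \<epsilon>) (w \<epsilon>)) \<and>
        (\<forall>n::nat. \<delta> n > 0) \<and> \<delta> \<longlonglongrightarrow> 0 \<and>
        (\<forall>t\<ge>0. (\<lambda>n. piecewise_constant (\<tau> (\<delta> n)) (w (\<delta> n)) t) \<longlonglongrightarrow> u t))"

end

theory Submission
  imports Defs "HOL-Library.Diagonal_Subsequence"
begin

text \<open>
  Between two grid points the discrete solution is joined by De Giorgi's variational interpolation:
  the minimal value of \<open>f v + d\<^sup>2(v, w\<^sub>i) / (2 \<sigma>)\<close> is non-increasing in \<open>\<sigma>\<close>, and its difference quotients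
  control the squared slope at the minimizer. Passing to the limit \<open>n \<rightarrow> \<infinity>\<close> in the resulting discrete
  energy-dissipation inequality uses three compactness arguments: the energies are monotone, so a
  subsequence converges at all rational times; the discrete velocities are bounded in \<open>L\<^sup>2\<close>, so they
  have a weak limit, which dominates the metric derivative; the slopes are handled by Fatou's lemma,
  since wherever their lower limit is finite the closure assumption applies to a subsequence that
  depends on the time. It also identifies the limit energy at almost every time.

  Differentiability of monotone functions is not needed: Fatou's lemma for difference quotients yields
  the integral inequalities, and the metric derivative is taken to be the upper limit of the difference
  quotients along the steps \<open>1 / (k + 1)\<close>.
\<close>

section \<open>Monotone functions\<close>

text \<open>Comparing \<open>w (Suc i)\<close> with \<open>w i\<close> accounts only for the
  velocity half of the dissipation; the slope half is invisible at the grid values. It is gained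
  from the minimizers at every intermediate \<open>\<sigma>\<close>, whose existence rests on the
  lower bound (ii) and the compactness (iii) once the step is small compared with
  \<open>\<tau>star\<close>. As (ii) bounds the energy from below only up to a squared distance,
  energies are not bounded a priori: a Gronwall argument for the distances to \<open>ustar\<close>
  comes first. The curve \<open>u\<close> is the limit of the whole sequence, so further
  subsequences are free. One, the same for all times, makes the energies converge at rational times.
  A second one, chosen at each time, makes the slopes at the interpolating points bounded, as the
  closure assumption requires. The two are reconciled by monotonicity: the energy at an
  interpolating point lies between the energies at slightly earlier and slightly later rational
  times, so at continuity points of the limit \<open>\<psi>\<close> it can only tend to
  \<open>\<psi> t\<close>.\<close>

lemma nn_integral_difference_quotient_le:
  fixes F :: "real \<Rightarrow> real"
  assumes ab: "a \<le> b" and F: "antimono_on {a..b} F"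
    and g: "AE r in lebesgue_on {a..b}. a < r \<longrightarrow> r < b \<longrightarrow>
      g r \<le> liminf (\<lambda>k. ennreal (real (Suc k) * (F r - F (r + 1 / real (Suc k)))))"
  shows "(\<integral>\<^sup>+r. g r \<partial>lebesgue_on {a..b}) \<le> ennreal (F a - F b)"
proof -
  \<comment> \<open>Continuation by the boundary values keeps \<open>H\<close> monotone and bounded
    on the whole line, so it is Borel and the shift by \<open>h\<close> may run past
    \<open>b\<close>.\<close>
  define H where "H r = F (max a (min b r))" for r
  have Hanti: "H y \<le> H x" if "x \<le> y" for x y
    using F that ab unfolding H_def monotone_on_def by auto
  have Hm: "H \<in> borel_measurable borel"
  proof -
    have "(\<lambda>x. - H x) \<in> borel_measurable borel"
      using Hanti by (intro borel_measurable_mono monoI) auto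
    from borel_measurable_uminus[OF this] show ?thesis by simp
  qed
  have Hbd: "F b \<le> H x" "H x \<le> F a" for x
    using F ab unfolding H_def monotone_on_def by auto
  define c where "c = F a - F b"
  have c0: "0 \<le> c" using Hbd[of a] unfolding c_def by linarith
  \<comment> \<open>Subtracting \<open>F b\<close> makes the integrand nonnegative, so that
    subtraction in \<open>ennreal\<close> is not truncated.\<close>
  define G where "G x = ennreal (H x - F b)" for x
  have Gm[measurable]: "G \<in> borel_measurable borel"
    unfolding G_def using Hm by measurable
  define Q where "Q k r = ennreal (real (Suc k) * (H r - H (r + 1 / real (Suc k))))" for k r
  have Qm[measurable]: "Q k \<in> borel_measurable borel" for k
    unfolding Q_def using Hm by measurable
  have conv: "(\<integral>\<^sup>+r. f r \<partial>lebesgue_on {a..b}) = (\<integral>\<^sup>+r. f r * indicator {a..b} r \<partial>lborel)"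
    if "f \<in> borel_measurable borel" for f :: "real \<Rightarrow> ennreal"
    using that by (simp add: nn_integral_restrict_space nn_integral_completion)
  have bound: "(\<integral>\<^sup>+r. Q k r \<partial>lebesgue_on {a..b}) \<le> ennreal c" for k
  proof -
    define h where "h = 1 / real (Suc k)"
    have h: "h > 0" unfolding h_def by simp
    define I where "I = (\<integral>\<^sup>+r. G (r + h) * indicator {a..b} r \<partial>lborel)"
    have "I \<le> (\<integral>\<^sup>+r. ennreal c * indicator {a..b} r \<partial>lborel)"
      unfolding I_def by (intro nn_integral_mono mult_right_mono)
        (use Hbd in \<open>auto simp: G_def c_def intro!: ennreal_leI\<close>)
    also have "\<dots> < \<infinity>"
      using ab by (simp add: nn_integral_cmult ennreal_mult_less_top)
    finally have Ifin: "I < \<infinity>" .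
    have I_shift: "I = (\<integral>\<^sup>+r. G r * indicator {a+h..b+h} r \<partial>lborel)"
      unfolding I_def
      by (subst (2) nn_integral_real_affine[of _ 1 h]) (auto simp: ac_simps indicator_def intro!: nn_integral_cong)
    \<comment> \<open>The strip \<open>{a..a+h}\<close> and the shifted interval cover
      \<open>{a..b}\<close>. The shifted integral \<open>I\<close> cancels below, and the strip
      contributes at most \<open>c * h\<close>, which the factor \<open>1 / h\<close> of the
      quotient turns into \<open>c\<close>.\<close>
    have "(\<integral>\<^sup>+r. G r * indicator {a..b} r \<partial>lborel)
        \<le> (\<integral>\<^sup>+r. ennreal c * indicator {a..a+h} r + G r * indicator {a+h..b+h} r \<partial>lborel)"
      by (intro nn_integral_mono)
        (use Hbd h in \<open>auto simp: indicator_def G_def c_def intro!: ennreal_leI\<close>)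
    also have "\<dots> = ennreal c * ennreal h + I"
      using h by (simp add: nn_integral_add nn_integral_cmult I_shift)
    finally have le: "(\<integral>\<^sup>+r. G r * indicator {a..b} r \<partial>lborel) \<le> ennreal c * ennreal h + I" .
    have "(\<integral>\<^sup>+r. Q k r \<partial>lebesgue_on {a..b}) = (\<integral>\<^sup>+r. Q k r * indicator {a..b} r \<partial>lborel)"
      by (rule conv) simp
    also have "\<dots> = (\<integral>\<^sup>+r. ennreal (real (Suc k)) *
        (G r * indicator {a..b} r - G (r + h) * indicator {a..b} r) \<partial>lborel)"
    proof (intro nn_integral_cong)
      fix r
      have "ennreal (H r - H (r+h)) = G r - G (r+h)"
        unfolding G_def using Hbd by (subst ennreal_minus) auto
      then show "Q k r * indicator {a..b} r = ennreal (real (Suc k)) *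
        (G r * indicator {a..b} r - G (r + h) * indicator {a..b} r)"
        unfolding Q_def h_def by (auto simp: indicator_def ennreal_mult')
    qed
    also have "\<dots> = ennreal (real (Suc k)) *
        ((\<integral>\<^sup>+r. G r * indicator {a..b} r \<partial>lborel) - I)"
      unfolding I_def
    proof (subst nn_integral_cmult, simp, subst nn_integral_diff)
      show "(\<integral>\<^sup>+ r. G (r + h) * indicator {a..b} r \<partial>lborel) \<noteq> \<infinity>"
        using Ifin unfolding I_def by auto
      show "AE r in lborel. G (r + h) * indicator {a..b} r \<le> G r * indicator {a..b} r"
        unfolding G_def using h by (auto simp: indicator_def intro!: AE_I2 ennreal_leI Hanti)
    qed auto
    also have "\<dots> \<le> ennreal (real (Suc k)) * (ennreal c * ennreal h)"
    proof (intro mult_left_mono)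
      have "(\<integral>\<^sup>+r. G r * indicator {a..b} r \<partial>lborel) - I \<le> (ennreal c * ennreal h + I) - I"
        using le by (rule ennreal_minus_mono) simp
      also have "\<dots> = ennreal c * ennreal h" using Ifin by simp
      finally show "(\<integral>\<^sup>+r. G r * indicator {a..b} r \<partial>lborel) - I \<le> ennreal c * ennreal h" .
    qed simp
    also have "\<dots> = ennreal c"
      using c0 h by (simp only: ennreal_mult[symmetric] mult_nonneg_nonneg of_nat_0_le_iff less_imp_le)
        (simp add: h_def)
    finally show ?thesis .
  qed
  have "(\<integral>\<^sup>+r. g r \<partial>lebesgue_on {a..b}) \<le> (\<integral>\<^sup>+r. liminf (\<lambda>k. Q k r) \<partial>lebesgue_on {a..b})"
  proof (rule nn_integral_mono_AE)
    have "AE r in lebesgue. r \<notin> {a, b}"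
      by (rule AE_not_in) (simp add: negligible_iff_null_sets[symmetric])
    then have "AE r in lebesgue_on {a..b}. r \<notin> {a, b}"
      by (auto simp: AE_restrict_space_iff)
    moreover have "AE r in lebesgue_on {a..b}. r \<in> {a..b}"
      using AE_space[of "lebesgue_on {a..b}"] by simp
    ultimately show "AE r in lebesgue_on {a..b}. g r \<le> liminf (\<lambda>k. Q k r)"
      using g
    proof eventually_elim
      case (elim r)
      then have r: "a < r" "r < b" by auto
      have "(\<lambda>k. r + 1 / real (Suc k)) \<longlonglongrightarrow> r + 0"
        by (intro tendsto_intros LIMSEQ_Suc lim_1_over_n)
      then have "\<forall>\<^sub>F k in sequentially. r + 1 / real (Suc k) < b"
        using r(2) by (simp add: order_tendstoD(2))
      then have "\<forall>\<^sub>F k in sequentially. ennreal (real (Suc k) * (F r - F (r + 1 / real (Suc k)))) = Q k r"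
      proof eventually_elim
        case (elim k)
        have "0 < 1 / real (Suc k)" by simp
        with elim r have "max a (min b r) = r" "max a (min b (r + 1 / real (Suc k))) = r + 1 / real (Suc k)"
          by linarith+
        then show ?case unfolding Q_def H_def by simp
      qed
      from Liminf_eq[OF this] elim r show ?case by simp
    qed
  qed
  also have "\<dots> \<le> liminf (\<lambda>k. \<integral>\<^sup>+r. Q k r \<partial>lebesgue_on {a..b})"
  proof (rule nn_integral_liminf)
    fix k show "Q k \<in> borel_measurable (lebesgue_on {a..b})"
      using Qm[of k] by (intro measurable_restrict_space1 measurable_completion) auto
  qed
  also have "\<dots> \<le> liminf (\<lambda>k. ennreal c)"
    by (intro Liminf_mono always_eventually allI bound)
  finally show ?thesis unfolding c_def by (simp add: Liminf_const)
qed

text \<open>Helly selection at rational points only: a diagonal argument over a countable set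
  suffices, and monotonicity carries the limit over to a function on the whole line.\<close>

lemma antimono_bounded_subsequence:
  fixes f :: "nat \<Rightarrow> real \<Rightarrow> real"
  assumes anti: "\<And>n. antimono (f n)" and bd: "\<And>n x. \<bar>f n x\<bar> \<le> M"
  obtains s :: "nat \<Rightarrow> nat" and \<psi> where "strict_mono s" "antimono \<psi>"
    "\<And>q. q \<in> \<rat> \<Longrightarrow> (\<lambda>n. f (s n) q) \<longlonglongrightarrow> \<psi> q"
proof -
  define r where "r = from_nat_into (\<rat> :: real set)"
  have r: "range r = \<rat>"
    unfolding r_def by (rule range_from_nat_into) (use countable_rat Rats_0 in auto)
  interpret subseqs "\<lambda>n s. convergent (\<lambda>k. f (s k) (r n))"
  proof
    fix n :: nat and s :: "nat \<Rightarrow> nat" assume s: "strict_mono s"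
    have "\<exists>l s'. strict_mono s' \<and> ((\<lambda>k. f (s k) (r n)) \<circ> s') \<longlonglongrightarrow> l"
    proof (rule bounded_imp_convergent_subsequence)
      show "bounded (range (\<lambda>k. f (s k) (r n)))"
        using bd by (auto simp: bounded_iff)
    qed
    then show "\<exists>r'. strict_mono r' \<and> convergent (\<lambda>k. f ((s \<circ> r') k) (r n))"
      by (auto simp: comp_def convergent_def)
  qed
  have cnv: "convergent (\<lambda>k. f (diagseq k) (r n))" for n
  proof -
    \<comment> \<open>The diagonal sequence is a subsequence of the one selected for
      \<open>r n\<close> only from index \<open>Suc n\<close> on; the initial segment is dropped
      afterwards.\<close>
    have "convergent (\<lambda>k. f ((diagseq \<circ> ((+) (Suc n))) k) (r n))"
    proof (rule diagseq_holds)
      fix s' s :: "nat \<Rightarrow> nat" and m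
      assume "strict_mono s'" "convergent (\<lambda>k. f (s k) (r m))"
      then show "convergent (\<lambda>k. f ((s \<circ> s') k) (r m))"
        using convergent_subseq_convergent[of "\<lambda>k. f (s k) (r m)" s'] by (simp add: comp_def)
    qed
    then show ?thesis
      using convergent_ignore_initial_segment[of "\<lambda>k. f (diagseq k) (r n)" "Suc n"]
      by (simp add: comp_def add.commute)
  qed
  define L where "L q = lim (\<lambda>k. f (diagseq k) q)" for q
  have L: "(\<lambda>k. f (diagseq k) q) \<longlonglongrightarrow> L q" if "q \<in> \<rat>" for q
    using that cnv unfolding L_def r[symmetric] by (auto simp: convergent_LIMSEQ_iff)
  have Lanti: "L q' \<le> L q" if "q \<in> \<rat>" "q' \<in> \<rat>" "q \<le> q'" for q q'
    by (rule LIMSEQ_le[OF L[OF that(2)] L[OF that(1)]]) (use antimonoD[OF anti that(3)] in auto)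
  have Lbd: "- M \<le> L q" if "q \<in> \<rat>" for q
    by (rule LIMSEQ_le_const[OF L[OF that]]) (use bd in \<open>auto simp: abs_le_iff minus_le_iff\<close>)
  \<comment> \<open>At a rational \<open>t\<close> the infimum includes \<open>L t\<close> itself
    and is attained there, as \<open>L\<close> is non-increasing.\<close>
  define \<psi> where "\<psi> t = (INF q\<in>{q\<in>\<rat>. q \<le> t}. L q)" for t
  have bdd: "bdd_below (L ` {q\<in>\<rat>. q \<le> t})" for t
    by (rule bdd_belowI2[of _ "-M"]) (use Lbd in auto)
  have ne: "{q\<in>\<rat>. q \<le> t} \<noteq> {}" for t :: real
    using Rats_dense_in_real[of "t - 1" t] by (auto intro: less_imp_le)
  have "antimono \<psi>"
  proof (rule antimonoI)
    fix x y :: real assume "x \<le> y"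
    then show "\<psi> y \<le> \<psi> x" unfolding \<psi>_def
      by (intro cINF_superset_mono ne bdd) auto
  qed
  moreover have "\<psi> q = L q" if "q \<in> \<rat>" for q
  proof (rule antisym)
    show "\<psi> q \<le> L q" unfolding \<psi>_def by (rule cINF_lower[OF bdd]) (use that in auto)
    show "L q \<le> \<psi> q" unfolding \<psi>_def by (rule cINF_greatest[OF ne]) (use that Lanti in auto)
  qed
  ultimately show thesis using that[of diagseq \<psi>] subseq_diagseq L by simp
qed

section \<open>Weak limits in \<open>L\<^sup>2\<close>\<close>

text \<open>The sets \<open>B k\<close> below are convex and contain the tails of the sequence. By the parallelogram law,
  nearly minimal elements of \<open>B k\<close> form a Cauchy sequence; its limit is the required function.\<close>

lemma (in finite_measure) L2_bounded_weak_limit: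
  fixes a :: "nat \<Rightarrow> 'a \<Rightarrow> real"
  assumes am: "\<And>n. a n \<in> borel_measurable M" and a0: "\<And>n x. 0 \<le> a n x"
    and a2: "\<And>n. integrable M (\<lambda>x. (a n x)\<^sup>2)" and aC: "\<And>n. (\<integral>x. (a n x)\<^sup>2 \<partial>M) \<le> C"
  obtains A where "A \<in> borel_measurable M" "\<And>x. 0 \<le> A x" "integrable M (\<lambda>x. (A x)\<^sup>2)"
    "(\<integral>\<^sup>+x. ennreal ((A x)\<^sup>2) \<partial>M) \<le> liminf (\<lambda>n. \<integral>\<^sup>+x. ennreal ((a n x)\<^sup>2) \<partial>M)"
    "\<And>E c. E \<in> sets M \<Longrightarrow> (\<forall>\<^sub>F n in sequentially. c \<le> (\<integral>x. indicator E x * a n x \<partial>M)) \<Longrightarrow>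
       c \<le> (\<integral>x. indicator E x * A x \<partial>M)"
proof -
  \<comment> \<open>Each \<open>B k\<close> is cut out by linear inequalities: it keeps the lower
    bounds for integrals over sets that all \<open>a n\<close> with \<open>n \<ge> k\<close> share.
    The sets shrink with \<open>k\<close>, so their minimal squared norms \<open>N k\<close>
    increase, and \<open>N k \<le> I (a k)\<close> ties the limit \<open>L\<close> to the lower
    limit of the norms.\<close>
  define B where "B k = {b. b \<in> borel_measurable M \<and> (\<forall>x. 0 \<le> b x) \<and> integrable M (\<lambda>x. (b x)\<^sup>2) \<and>
    (\<forall>E\<in>sets M. \<forall>c. (\<forall>n\<ge>k. c \<le> (\<integral>x. indicator E x * a n x \<partial>M)) \<longrightarrow>
       c \<le> (\<integral>x. indicator E x * b x \<partial>M))}" for k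
  have BD: "c \<le> (\<integral>x. indicator E x * b x \<partial>M)"
    if "b \<in> B k" "E \<in> sets M" "\<forall>n\<ge>k. c \<le> (\<integral>x. indicator E x * a n x \<partial>M)" for b k E c
    using that unfolding B_def by blast
  have BDm: "b \<in> borel_measurable M" and BD0: "0 \<le> b x" and BD2: "integrable M (\<lambda>x. (b x)\<^sup>2)"
    if "b \<in> B k" for b k x
    using that unfolding B_def by simp_all
  define I where "I b = (\<integral>x. (b x)\<^sup>2 \<partial>M)" for b :: "'a \<Rightarrow> real"
  define N where "N k = Inf (I ` B k)" for k
  have aB: "a n \<in> B k" if "k \<le> n" for n k
    using that am a0 a2 unfolding B_def by auto
  have Banti: "B l \<subseteq> B k" if "k \<le> l" for k l
    unfolding B_def using that by auto
  have I0: "0 \<le> I b" for b unfolding I_def by simp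
  have bdd: "bdd_below (I ` B k)" for k by (rule bdd_belowI2[of _ 0]) (rule I0)
  have NI: "N k \<le> I b" if "b \<in> B k" for b k
    unfolding N_def by (rule cINF_lower[OF bdd that])
  have Nmono: "incseq N"
  proof (rule incseq_SucI)
    fix k
    have "B (Suc k) \<noteq> {}" using aB[of "Suc k" "Suc k"] by auto
    then show "N k \<le> N (Suc k)"
      unfolding N_def by (intro cINF_superset_mono bdd Banti) auto
  qed
  have NC: "N k \<le> C" for k using NI[OF aB[of k k]] aC[of k] unfolding I_def by simp
  define L where "L = (SUP k. N k)"
  have bddN: "bdd_above (range N)" by (rule bdd_aboveI2[of _ _ C]) (rule NC)
  have NL: "N k \<le> L" for k unfolding L_def by (rule cSUP_upper[OF _ bddN]) simp
  have Nlim: "N \<longlonglongrightarrow> L" unfolding L_def by (rule LIMSEQ_incseq_SUP[OF bddN Nmono])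
  have int: "integrable M b" if "b \<in> B k" for b k
    by (rule square_integrable_imp_integrable) (use BDm[OF that] BD2[OF that] in simp_all)
  have mid: "(\<lambda>x. (b x + b' x) / 2) \<in> B k" if b: "b \<in> B k" "b' \<in> B k" for b b' k
  proof -
    have i: "integrable M b" "integrable M b'" using int that by auto
    have "integrable M (\<lambda>x. ((b x + b' x) / 2)\<^sup>2)"
    proof (rule Bochner_Integration.integrable_bound)
      show "integrable M (\<lambda>x. (b x)\<^sup>2 + (b' x)\<^sup>2)" using BD2[OF b(1)] BD2[OF b(2)] by simp
      have *: "((p + q) / 2)\<^sup>2 \<le> p\<^sup>2 + q\<^sup>2" for p q :: real
      proof -
        have e: "((p + q) / 2)\<^sup>2 = (p\<^sup>2 + q\<^sup>2 + 2 * p * q) / 4"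
          by (simp add: power2_eq_square field_simps)
        have g: "(P + Q + R) / 4 \<le> P + Q" if "R \<le> P + Q" "0 \<le> P" "0 \<le> Q" for P Q R :: real
          using that by simp
        show ?thesis
          unfolding e by (rule g) (use sum_squares_bound[of p q] in auto)
      qed
      show "AE x in M. norm (((b x + b' x) / 2)\<^sup>2) \<le> norm ((b x)\<^sup>2 + (b' x)\<^sup>2)"
        using * by auto
      show "(\<lambda>x. ((b x + b' x) / 2)\<^sup>2) \<in> borel_measurable M"
        using BDm[OF b(1)] BDm[OF b(2)] by measurable
    qed
    moreover have "c \<le> (\<integral>x. indicator E x * ((b x + b' x) / 2) \<partial>M)"
      if E: "E \<in> sets M" and c: "\<forall>n\<ge>k. c \<le> (\<integral>x. indicator E x * a n x \<partial>M)" for E c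
    proof -
      have j: "integrable M (\<lambda>x. indicator E x * b x)" "integrable M (\<lambda>x. indicator E x * b' x)"
        using integrable_real_mult_indicator[OF E i(1)] integrable_real_mult_indicator[OF E i(2)]
        by (simp_all add: mult.commute)
      have "(\<integral>x. indicator E x * ((b x + b' x) / 2) \<partial>M)
          = (\<integral>x. (indicator E x * b x + indicator E x * b' x) / 2 \<partial>M)"
        by (simp add: distrib_left)
      also have "\<dots> = ((\<integral>x. indicator E x * b x \<partial>M) + (\<integral>x. indicator E x * b' x \<partial>M)) / 2"
        using j by simp
      finally show ?thesis using BD[OF b(1) E c] BD[OF b(2) E c] by argo
    qed
    moreover have "(\<lambda>x. (b x + b' x) / 2) \<in> borel_measurable M"
      using BDm[OF b(1)] BDm[OF b(2)] by measurable
    moreover have "0 \<le> (b x + b' x) / 2" for x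
      using BD0[OF b(1), of x] BD0[OF b(2), of x] by simp
    ultimately show ?thesis unfolding B_def by blast
  qed
  have par: "I (\<lambda>x. b x - b' x) = 2 * I b + 2 * I b' - 4 * I (\<lambda>x. (b x + b' x) / 2) \<and>
      integrable M (\<lambda>x. (b x - b' x)\<^sup>2)"
    if "b \<in> B k" "b' \<in> B k" for b b' k
  proof -
    have i: "integrable M (\<lambda>x. (b x)\<^sup>2)" "integrable M (\<lambda>x. (b' x)\<^sup>2)"
      "integrable M (\<lambda>x. ((b x + b' x) / 2)\<^sup>2)"
      using BD2[OF that(1)] BD2[OF that(2)] BD2[OF mid[OF that]] by simp_all
    have eq: "(b x - b' x)\<^sup>2 = 2 * (b x)\<^sup>2 + 2 * (b' x)\<^sup>2 - 4 * ((b x + b' x) / 2)\<^sup>2" for x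
      by (simp add: power2_eq_square field_simps)
    show ?thesis unfolding I_def eq using i by simp
  qed
  \<comment> \<open>Indices so large that \<open>N (K j)\<close> is within \<open>(1/4)^j\<close> of
    \<open>L\<close>: the midpoint of two elements of \<open>B (K j)\<close> then has squared norm
    above \<open>L - (1/4)^j\<close>, which the parallelogram law turns into a bound for their
    difference.\<close>
  have "\<exists>K. strict_mono K \<and> (\<forall>j. L - (1/4)^j < N (K j))"
  proof -
    have ev: "\<exists>k\<ge>m. L - (1/4)^j < N k" for j m :: nat
    proof -
      have "\<forall>\<^sub>F k in sequentially. L - (1/4)^j < N k"
        using Nlim by (rule order_tendstoD) simp
      then obtain k0 where "\<forall>k\<ge>k0. L - (1/4)^j < N k" by (auto simp: eventually_sequentially)
      then show ?thesis by (intro exI[of _ "max k0 m"]) auto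
    qed
    have "\<exists>K. \<forall>j. L - (1/4)^j < N (K j) \<and> K j < K (Suc j)"
    proof (rule dependent_nat_choice)
      show "\<exists>k. L - (1/4)^0 < N k" using ev[of 0 0] by auto
      show "\<exists>l. L - (1/4)^Suc j < N l \<and> k < l" for k j
        using ev[of "Suc k" "Suc j"] by (auto simp: Suc_le_eq)
    qed
    then show ?thesis by (auto simp: strict_mono_Suc_iff)
  qed
  then obtain K where K: "strict_mono K" and KL: "\<And>j. L - (1/4)^j < N (K j)" by blast
  have "\<exists>b. b \<in> B (K j) \<and> I b < L + (1/4)^j" for j
  proof -
    have "Inf (I ` B (K j)) < L + (1/4)^j" using NL[of "K j"] unfolding N_def
      by (rule le_less_trans) simp
    moreover have "I ` B (K j) \<noteq> {}" using aB[of "K j" "K j"] by auto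
    ultimately show ?thesis using cInf_less_iff[OF _ bdd[of "K j"]] by auto
  qed
  then obtain b where bB: "\<And>j. b j \<in> B (K j)" and bI: "\<And>j. I (b j) < L + (1/4)^j" by metis
  define d where "d j x = b (Suc j) x - b j x" for j x
  have bm: "b j \<in> borel_measurable M" for j by (rule BDm[OF bB])
  have dm: "d j \<in> borel_measurable M" for j unfolding d_def using bm by measurable
  have bB': "b (Suc j) \<in> B (K j)" for j
    using bB[of "Suc j"] Banti[of "K j" "K (Suc j)"] K by (auto simp: strict_mono_Suc_iff less_imp_le)
  \<comment> \<open>The 8 collects the errors of the parallelogram law: 2 and 2 from the
    near-minimal elements, 4 from the midpoint.\<close>
  have dI: "I (d j) \<le> 8 * (1/4)^j" for j
  proof -
    have "I (d j) = 2 * I (b (Suc j)) + 2 * I (b j) - 4 * I (\<lambda>x. (b (Suc j) x + b j x) / 2)"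
      unfolding d_def using par[OF bB' bB] by blast
    moreover have "L - (1/4)^j < I (\<lambda>x. (b (Suc j) x + b j x) / 2)"
      using KL[of j] NI[OF mid[OF bB'[of j] bB[of j]]] by argo
    moreover have "(1/4::real)^Suc j \<le> (1/4)^j" by simp
    ultimately show ?thesis using bI[of j] bI[of "Suc j"] by argo
  qed
  have d2: "integrable M (\<lambda>x. (d j x)\<^sup>2)" for j
    unfolding d_def using par[OF bB' bB] by blast
  have di: "integrable M (d j)" for j unfolding d_def using int[OF bB] int[OF bB'] by auto
  define \<mu> where "\<mu> = measure M (space M)"
  have d1: "(\<integral>x. \<bar>d j x\<bar> \<partial>M) \<le> (\<mu> + 8) * (1/2)^j" for j
  proof -
    \<comment> \<open>Young's inequality with weights \<open>(1/2)^j\<close> and \<open>2^j\<close>,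
      chosen so that the bound \<open>8 * (1/4)^j\<close> on the squares yields a summable bound on
      the absolute values.\<close>
    have "(\<integral>x. \<bar>d j x\<bar> \<partial>M) \<le> (\<integral>x. (1/2)^j + 2^j * (d j x)\<^sup>2 \<partial>M)"
    proof (rule integral_mono)
      fix x
      have "0 \<le> (1/2)^j * (1 - 2^j * \<bar>d j x\<bar> )\<^sup>2" by simp
      also have "\<dots> = (1/2)^j + 2^j * (d j x)\<^sup>2 - 2 * \<bar>d j x\<bar>"
      proof -
        have "1 / p * (1 - p * \<bar>y\<bar>)\<^sup>2 = 1 / p + p * y\<^sup>2 - 2 * \<bar>y\<bar>" if "p > 0" for p y :: real
          using that by (simp add: power2_eq_square field_simps)
        from this[of "2^j" "d j x"] show ?thesis by (simp add: power_one_over)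
      qed
      finally show "\<bar>d j x\<bar> \<le> (1/2)^j + 2^j * (d j x)\<^sup>2" by linarith
    qed (use di d2 in auto)
    also have "\<dots> = \<mu> * (1/2)^j + 2^j * I (d j)" using d2 by (simp add: I_def \<mu>_def)
    also have "\<dots> \<le> \<mu> * (1/2)^j + 2^j * (8 * (1/4)^j)" using dI[of j] by simp
    also have "2^j * (8 * (1/4)^j) = 8 * (1/2::real)^j"
    proof -
      have "(2::real)^j * (1/4)^j = (1/2)^j" by (simp flip: power_mult_distrib)
      then show ?thesis by simp
    qed
    finally show ?thesis by (simp add: algebra_simps)
  qed
  have sum1: "summable (\<lambda>j. \<integral>x. \<bar>d j x\<bar> \<partial>M)"
    by (rule summable_comparison_test'[of "\<lambda>j. (\<mu> + 8) * (1/2)^j" 0])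
      (use d1 in \<open>auto intro!: summable_mult summable_geometric\<close>)
  have AEsum: "AE x in M. summable (\<lambda>j. \<bar>d j x\<bar>)"
  proof -
    have "(\<integral>\<^sup>+x. (\<Sum>j. ennreal \<bar>d j x\<bar>) \<partial>M) = (\<Sum>j. \<integral>\<^sup>+x. ennreal \<bar>d j x\<bar> \<partial>M)"
      using dm by (intro nn_integral_suminf) auto
    also have "\<dots> = (\<Sum>j. ennreal (\<integral>x. \<bar>d j x\<bar> \<partial>M))"
      using di by (intro suminf_cong nn_integral_eq_integral) auto
    also have "\<dots> = ennreal (\<Sum>j. \<integral>x. \<bar>d j x\<bar> \<partial>M)"
      using sum1 by (intro suminf_ennreal2) auto
    finally have "(\<integral>\<^sup>+x. (\<Sum>j. ennreal \<bar>d j x\<bar>) \<partial>M) \<noteq> \<infinity>" by simp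
    then have "AE x in M. (\<Sum>j. ennreal \<bar>d j x\<bar>) \<noteq> \<infinity>"
      using dm by (intro nn_integral_PInf_AE) auto
    then show ?thesis
      by eventually_elim (auto intro: summable_suminf_not_top)
  qed
  have b_sum: "b j x = b 0 x + (\<Sum>i<j. d i x)" for j x
    unfolding d_def by (simp add: sum_lessThan_telescope[of "\<lambda>j. b j x"])
  \<comment> \<open>The maximum with 0 makes \<open>A\<close> nonnegative everywhere, including the
    null set where \<open>b j x\<close> does not converge.\<close>
  define A where "A x = max 0 (lim (\<lambda>j. b j x))" for x
  have Am: "A \<in> borel_measurable M" unfolding A_def
    using bm by (intro borel_measurable_max borel_measurable_lim_metric) auto
  have bA: "AE x in M. (\<lambda>j. b j x) \<longlonglongrightarrow> A x"
    using AEsum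
  proof eventually_elim
    case (elim x)
    then have "summable (\<lambda>j. d j x)" by (rule summable_rabs_cancel)
    then have "(\<lambda>j. b 0 x + (\<Sum>i<j. d i x)) \<longlonglongrightarrow> b 0 x + (\<Sum>i. d i x)"
      by (intro tendsto_intros summable_LIMSEQ)
    then have c: "convergent (\<lambda>j. b j x)" unfolding b_sum[symmetric] by (auto simp: convergent_def)
    then have "(\<lambda>j. b j x) \<longlonglongrightarrow> lim (\<lambda>j. b j x)" by (simp add: convergent_LIMSEQ_iff)
    moreover from this have "0 \<le> lim (\<lambda>j. b j x)"
      by (rule LIMSEQ_le_const) (use BD0[OF bB] in auto)
    ultimately show ?case unfolding A_def by simp
  qed
  \<comment> \<open>The \<open>b j\<close> are partial sums of a telescoping series, so this is an
    integrable majorant for all of them; it lets the lower bounds on integrals over sets pass to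
    \<open>A\<close>.\<close>
  define H where "H x = \<bar>b 0 x\<bar> + (\<Sum>i. \<bar>d i x\<bar>)" for x
  have Hi: "integrable M H" unfolding H_def
  proof (intro Bochner_Integration.integrable_add integrable_suminf)
    show "integrable M (\<lambda>x. \<bar>b 0 x\<bar>)" using int[OF bB] by auto
    show "integrable M (\<lambda>x. \<bar>d i x\<bar>)" for i using di by auto
  qed (use AEsum sum1 in auto)
  have bH: "AE x in M. \<bar>b j x\<bar> \<le> H x" for j
    using AEsum
  proof eventually_elim
    case (elim x)
    have "\<bar>b j x\<bar> \<le> \<bar>b 0 x\<bar> + (\<Sum>i<j. \<bar>d i x\<bar>)"
      unfolding b_sum[of j x] using sum_abs[of "\<lambda>i. d i x" "{..<j}"] by linarith
    also have "(\<Sum>i<j. \<bar>d i x\<bar>) \<le> (\<Sum>i. \<bar>d i x\<bar>)" using elim by (intro sum_le_suminf) auto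
    finally show ?case unfolding H_def by simp
  qed
  have fat: "(\<integral>\<^sup>+x. ennreal ((A x)\<^sup>2) \<partial>M) \<le> ennreal L"
  proof -
    have "(\<integral>\<^sup>+x. ennreal ((A x)\<^sup>2) \<partial>M) = (\<integral>\<^sup>+x. liminf (\<lambda>j. ennreal ((b j x)\<^sup>2)) \<partial>M)"
    proof (rule nn_integral_cong_AE)
      show "AE x in M. ennreal ((A x)\<^sup>2) = liminf (\<lambda>j. ennreal ((b j x)\<^sup>2))"
        using bA
      proof eventually_elim
        case (elim x)
        have "(\<lambda>j. ennreal ((b j x)\<^sup>2)) \<longlonglongrightarrow> ennreal ((A x)\<^sup>2)"
          by (intro tendsto_ennrealI tendsto_intros elim)
        then show ?case by (rule lim_imp_Liminf[OF trivial_limit_sequentially, symmetric])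
      qed
    qed
    also have "\<dots> \<le> liminf (\<lambda>j. \<integral>\<^sup>+x. ennreal ((b j x)\<^sup>2) \<partial>M)"
      using bm by (intro nn_integral_liminf) auto
    also have "\<dots> \<le> liminf (\<lambda>j. ennreal (L + (1/4)^j))"
    proof (intro Liminf_mono always_eventually allI)
      fix j
      have "(\<integral>\<^sup>+x. ennreal ((b j x)\<^sup>2) \<partial>M) = ennreal (I (b j))"
        unfolding I_def using BD2[OF bB] by (intro nn_integral_eq_integral) auto
      then show "(\<integral>\<^sup>+x. ennreal ((b j x)\<^sup>2) \<partial>M) \<le> ennreal (L + (1/4)^j)"
        using bI[of j] by (simp add: ennreal_leI)
    qed
    also have "\<dots> = ennreal L"
    proof -
      have "(\<lambda>j. ennreal (L + (1/4)^j)) \<longlonglongrightarrow> ennreal (L + 0)"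
        by (intro tendsto_ennrealI tendsto_intros LIMSEQ_realpow_zero) auto
      from lim_imp_Liminf[OF trivial_limit_sequentially this] show ?thesis by simp
    qed
    finally show ?thesis .
  qed
  show thesis
  proof (rule that[OF Am])
    show "0 \<le> A x" for x unfolding A_def by simp
    show "integrable M (\<lambda>x. (A x)\<^sup>2)"
      using Am fat by (intro integrableI_nonneg) (auto intro: le_less_trans)
    have "ennreal L \<le> liminf (\<lambda>n. \<integral>\<^sup>+x. ennreal ((a n x)\<^sup>2) \<partial>M)"
    proof -
      have "(\<lambda>k. ennreal (N k)) \<longlonglongrightarrow> ennreal L" by (intro tendsto_ennrealI Nlim)
      then have "ennreal L = liminf (\<lambda>k. ennreal (N k))" by (rule lim_imp_Liminf[OF trivial_limit_sequentially, symmetric])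
      also have "\<dots> \<le> liminf (\<lambda>n. \<integral>\<^sup>+x. ennreal ((a n x)\<^sup>2) \<partial>M)"
      proof (intro Liminf_mono always_eventually allI)
        fix k
        have "(\<integral>\<^sup>+x. ennreal ((a k x)\<^sup>2) \<partial>M) = ennreal (I (a k))"
          unfolding I_def using a2 by (intro nn_integral_eq_integral) auto
        then show "ennreal (N k) \<le> (\<integral>\<^sup>+x. ennreal ((a k x)\<^sup>2) \<partial>M)"
          using NI[OF aB[of k k]] by (simp add: ennreal_leI)
      qed
      finally show ?thesis .
    qed
    with fat show "(\<integral>\<^sup>+x. ennreal ((A x)\<^sup>2) \<partial>M) \<le> liminf (\<lambda>n. \<integral>\<^sup>+x. ennreal ((a n x)\<^sup>2) \<partial>M)"
      by (rule order_trans)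
    fix E c assume E: "E \<in> sets M" and ev: "\<forall>\<^sub>F n in sequentially. c \<le> (\<integral>x. indicator E x * a n x \<partial>M)"
    then obtain n0 where n0: "\<And>n. n \<ge> n0 \<Longrightarrow> c \<le> (\<integral>x. indicator E x * a n x \<partial>M)"
      by (auto simp: eventually_sequentially)
    have "(\<lambda>j. \<integral>x. indicator E x * b j x \<partial>M) \<longlonglongrightarrow> (\<integral>x. indicator E x * A x \<partial>M)"
    proof (rule integral_dominated_convergence[where w = H])
      show "AE x in M. (\<lambda>j. indicator E x * b j x) \<longlonglongrightarrow> indicator E x * A x"
        using bA by eventually_elim (intro tendsto_intros)
      show "AE x in M. norm (indicator E x * b j x) \<le> H x" for j
        using bH[of j] by eventually_elim (auto simp: indicator_def)
    qed (use Am bm E Hi in auto)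
    then show "c \<le> (\<integral>x. indicator E x * A x \<partial>M)"
    proof (rule LIMSEQ_le_const)
      have "c \<le> (\<integral>x. indicator E x * b j x \<partial>M)" if "j \<ge> n0" for j
      proof -
        have "\<forall>n\<ge>K j. c \<le> (\<integral>x. indicator E x * a n x \<partial>M)"
          using n0 that seq_suble[OF K, of j] by auto
        then show ?thesis by (rule BD[OF bB E])
      qed
      then show "\<exists>n0. \<forall>j\<ge>n0. c \<le> (\<integral>x. indicator E x * b j x \<partial>M)" by blast
    qed
  qed
qed

section \<open>The metric derivative\<close>

lemma integrable_lebesgue_on_subinterval:
  fixes f :: "real \<Rightarrow> real"
  assumes "integrable (lebesgue_on {a..b}) f" "{c..d} \<subseteq> {a..b}"
  shows "integrable (lebesgue_on {c..d}) f"
proof -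
  have "set_integrable lebesgue {a..b} f"
    using assms(1) by (simp add: set_integrable_def integrable_restrict_space)
  then have "set_integrable lebesgue {c..d} f"
    by (rule set_integrable_subset) (use assms(2) in auto)
  then show ?thesis by (simp add: set_integrable_def integrable_restrict_space)
qed

lemma lebesgue_on_integral_combine:
  fixes f :: "real \<Rightarrow> real"
  assumes f: "integrable (lebesgue_on {a..b}) f" and "a \<le> c" "c \<le> b"
  shows "integral\<^sup>L (lebesgue_on {a..b}) f
    = integral\<^sup>L (lebesgue_on {a..c}) f + integral\<^sup>L (lebesgue_on {c..b}) f"
proof -
  have i: "integrable (lebesgue_on {a..c}) f" "integrable (lebesgue_on {c..b}) f"
    using assms by (auto intro!: integrable_lebesgue_on_subinterval[OF f])
  have "f integrable_on {a..b}" using f by (intro integrable_on_lebesgue_on) auto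
  from Henstock_Kurzweil_Integration.integral_combine[OF assms(2,3) this] f i show ?thesis
    by (simp add: lebesgue_integral_eq_integral)
qed

lemma continuous_on_of_dist_le_integral:
  fixes u :: "real \<Rightarrow> 'a::metric_space"
  assumes A: "integrable (lebesgue_on {a..b}) A"
    and d: "\<forall>s t. a \<le> s \<and> s \<le> t \<and> t \<le> b \<longrightarrow> dist (u s) (u t) \<le> integral\<^sup>L (lebesgue_on {s..t}) A"
  shows "continuous_on {a..b} u"
proof -
  define \<A> where "\<A> t = integral {a..t} A" for t
  have Ai: "A integrable_on {a..b}" using A by (intro integrable_on_lebesgue_on) auto
  have le: "dist (u s) (u t) \<le> \<A> t - \<A> s" if st: "a \<le> s" "s \<le> t" "t \<le> b" for s t
  proof -
    have "A integrable_on {a..t}" by (rule integrable_subinterval_real[OF Ai]) (use st in auto)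
    from Henstock_Kurzweil_Integration.integral_combine[OF st(1,2) this]
    have "integral {s..t} A = \<A> t - \<A> s" unfolding \<A>_def by simp
    moreover have "integrable (lebesgue_on {s..t}) A"
      by (rule integrable_lebesgue_on_subinterval[OF A]) (use st in auto)
    ultimately show ?thesis using d[rule_format, of s t] st by (simp add: lebesgue_integral_eq_integral)
  qed
  have c: "continuous_on {a..b} \<A>" unfolding \<A>_def by (rule indefinite_integral_continuous_1[OF Ai])
  show ?thesis
    unfolding continuous_on_iff
  proof (intro ballI allI impI)
    fix x e :: real assume x: "x \<in> {a..b}" and e: "e > 0"
    with c obtain \<delta> where \<delta>: "\<delta> > 0" "\<And>y. y \<in> {a..b} \<Longrightarrow> dist y x < \<delta> \<Longrightarrow> dist (\<A> y) (\<A> x) < e"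
      unfolding continuous_on_iff by blast
    have "dist (u y) (u x) < e" if y: "y \<in> {a..b}" "dist y x < \<delta>" for y
    proof (cases "y \<le> x")
      case True
      then show ?thesis using le[of y x] \<delta>(2)[OF y] x y by (auto simp: dist_real_def)
    next
      case False
      then show ?thesis using le[of x y] \<delta>(2)[OF y] x y by (auto simp: dist_real_def dist_commute)
    qed
    with \<delta>(1) show "\<exists>\<delta>>0. \<forall>y\<in>{a..b}. dist y x < \<delta> \<longrightarrow> dist (u y) (u x) < e" by blast
  qed
qed

text \<open>Lebesgue's differentiation theorem for right-sided averages. The end point
  \<open>b\<close> is left out because the averaging interval has to stay inside
  \<open>{a..b}\<close>.\<close>

lemma AE_averages_tendsto:
  fixes A :: "real \<Rightarrow> real"
  assumes A: "integrable (lebesgue_on {a..b}) A"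
  shows "AE r in lebesgue_on {a..b}. r < b \<longrightarrow>
    (\<lambda>k. real (Suc k) * integral\<^sup>L (lebesgue_on {r..r + 1 / real (Suc k)}) A) \<longlonglongrightarrow> A r"
proof -
  \<comment> \<open>Extension by zero provides a function integrable on every box; for small steps
    it agrees with \<open>A\<close> on the averaging interval.\<close>
  define B where "B r = (if r \<in> {a..b} then A r else 0)" for r
  have "A integrable_on {a..b}" using A by (intro integrable_on_lebesgue_on) auto
  then have "B integrable_on UNIV" unfolding B_def by (rule integrable_restrict_UNIV[THEN iffD2])
  then have B: "B integrable_on cbox c d" for c d by (rule integrable_on_subcbox) simp
  obtain N where N: "negligible N" and lim: "\<And>x e. x \<notin> N \<Longrightarrow> 0 < e \<Longrightarrow>
      \<exists>d>0. \<forall>h. 0 < h \<and> h < d \<longrightarrow> norm (integral (cbox x (x + h *\<^sub>R One)) B /\<^sub>R h ^ DIM(real) - B x) < e"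
    using integrable_ccontinuous_explicit[of B, OF B] by metis
  have "AE r in lebesgue. r \<notin> N"
    using N by (intro AE_not_in) (simp add: negligible_iff_null_sets)
  then have "AE r in lebesgue_on {a..b}. r \<notin> N"
    by (subst AE_restrict_space_iff) (auto elim!: eventually_mono)
  moreover have "AE r in lebesgue_on {a..b}. r \<in> {a..b}"
    using AE_space[of "lebesgue_on {a..b}"] by simp
  ultimately show ?thesis
  proof eventually_elim
    case (elim r)
    show ?case
    proof (intro impI tendstoI)
      fix e :: real assume rb: "r < b" and e: "e > 0"
      have h0: "(\<lambda>k. 1 / real (Suc k)) \<longlonglongrightarrow> 0" by (intro LIMSEQ_Suc lim_1_over_n)
      obtain d where d: "d > 0" "\<And>h. 0 < h \<Longrightarrow> h < d \<Longrightarrow> \<bar>integral {r..r+h} B / h - B r\<bar> < e"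
        using lim[OF elim(1) e] by (auto simp: divide_inverse mult.commute)
      have "\<forall>\<^sub>F k in sequentially. 1 / real (Suc k) < min d (b - r)"
        using order_tendstoD(2)[OF h0, of "min d (b - r)"] d rb by simp
      then show "\<forall>\<^sub>F k in sequentially.
          dist (real (Suc k) * integral\<^sup>L (lebesgue_on {r..r + 1 / real (Suc k)}) A) (A r) < e"
      proof eventually_elim
        case (elim k)
        define h where "h = 1 / real (Suc k)"
        have h: "0 < h" "h < d" "r + h < b" using elim unfolding h_def by auto
        have "integrable (lebesgue_on {r..r+h}) A"
          by (rule integrable_lebesgue_on_subinterval[OF A]) (use h \<open>r \<in> {a..b}\<close> in auto)
        then have "integral\<^sup>L (lebesgue_on {r..r+h}) A = integral {r..r+h} A"
          by (simp add: lebesgue_integral_eq_integral)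
        also have "\<dots> = integral {r..r+h} B"
          by (rule integral_cong) (use h \<open>r \<in> {a..b}\<close> in \<open>auto simp: B_def\<close>)
        finally have "integral {r..r+h} B / h = real (Suc k) * integral\<^sup>L (lebesgue_on {r..r+h}) A"
          unfolding h_def by simp
        moreover have "B r = A r" using \<open>r \<in> {a..b}\<close> unfolding B_def by simp
        ultimately show ?case using d(2)[OF h(1,2)] unfolding h_def[symmetric] by (simp add: dist_real_def)
      qed
    qed
  qed
qed

text \<open>Countably many forward steps keep the upper limit measurable. \<open>enn2real\<close>
  sends an infinite upper limit to 0; for the curves considered this concerns a null set only, by
  the second part of \<open>AE_speed_le\<close>.\<close>

definition speed :: "(real \<Rightarrow> 'a::metric_space) \<Rightarrow> real \<Rightarrow> real" where
  "speed u r = enn2real (limsup (\<lambda>k. ennreal (real (Suc k) * dist (u r) (u (r + 1 / real (Suc k))))))"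

lemma speed_nonneg: "0 \<le> speed u r"
  unfolding speed_def by simp

text \<open>The forward steps have length at most 1, hence continuity is required up to
  \<open>b + 1\<close>.\<close>

lemma speed_measurable:
  fixes u :: "real \<Rightarrow> 'a::metric_space"
  assumes u: "continuous_on {a..b + 1} u"
  shows "speed u \<in> borel_measurable (lebesgue_on {a..b})"
proof -
  have "(\<lambda>r. real (Suc k) * dist (u r) (u (r + 1 / real (Suc k)))) \<in> borel_measurable (lebesgue_on {a..b})" for k
  proof (rule continuous_imp_measurable_on_sets_lebesgue)
    show "continuous_on {a..b} (\<lambda>r. real (Suc k) * dist (u r) (u (r + 1 / real (Suc k))))"
      by (intro continuous_intros continuous_on_subset[OF u] continuous_on_compose2[OF u])
        (auto intro!: add_mono intro: add_increasing2)
  qed simp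
  then show ?thesis unfolding speed_def[abs_def] by measurable
qed

text \<open>The difference quotients of \<open>u\<close> are dominated by the averages of
  \<open>A\<close>, which converge to \<open>A r\<close> almost everywhere. In particular their
  upper limit is finite there, so \<open>enn2real\<close> loses nothing.\<close>

lemma AE_speed_le:
  fixes u :: "real \<Rightarrow> 'a::metric_space"
  assumes A: "integrable (lebesgue_on {a..b}) A"
    and d: "\<forall>s t. a \<le> s \<and> s \<le> t \<and> t \<le> b \<longrightarrow> dist (u s) (u t) \<le> integral\<^sup>L (lebesgue_on {s..t}) A"
  shows "AE r in lebesgue_on {a..b}. speed u r \<le> A r \<and>
    limsup (\<lambda>k. ennreal (real (Suc k) * dist (u r) (u (r + 1 / real (Suc k))))) = ennreal (speed u r)"
proof -
  have "AE r in lebesgue. r \<notin> {b}"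
    by (rule AE_not_in) (simp add: negligible_iff_null_sets[symmetric])
  then have "AE r in lebesgue_on {a..b}. r \<noteq> b"
    by (subst AE_restrict_space_iff) (auto elim!: eventually_mono)
  moreover have "AE r in lebesgue_on {a..b}. r \<in> {a..b}"
    using AE_space[of "lebesgue_on {a..b}"] by simp
  ultimately show ?thesis using AE_averages_tendsto[OF A]
  proof eventually_elim
    case (elim r)
    define q where "q k = real (Suc k) * dist (u r) (u (r + 1 / real (Suc k)))" for k
    define p where "p k = real (Suc k) * integral\<^sup>L (lebesgue_on {r..r + 1 / real (Suc k)}) A" for k
    have r: "a \<le> r" "r < b" and p: "p \<longlonglongrightarrow> A r" using elim unfolding p_def by auto
    have h0: "(\<lambda>k. 1 / real (Suc k)) \<longlonglongrightarrow> 0" by (intro LIMSEQ_Suc lim_1_over_n)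
    have "\<forall>\<^sub>F k in sequentially. 1 / real (Suc k) < b - r"
      using order_tendstoD(2)[OF h0, of "b - r"] r by simp
    then have qp: "\<forall>\<^sub>F k in sequentially. q k \<le> p k"
    proof eventually_elim
      case (elim k)
      show ?case unfolding q_def p_def
        by (intro mult_left_mono d[rule_format]) (use elim r in auto)
    qed
    then have "\<forall>\<^sub>F k in sequentially. 0 \<le> p k"
      by eventually_elim (simp add: q_def order_trans[rotated])
    with p have A0: "0 \<le> A r" by (intro tendsto_lowerbound[OF p]) auto
    have "limsup (\<lambda>k. ennreal (q k)) \<le> limsup (\<lambda>k. ennreal (p k))"
      using qp by (intro Limsup_mono) (auto elim!: eventually_mono intro: ennreal_leI)
    also have "\<dots> = ennreal (A r)"
      by (intro lim_imp_Limsup tendsto_ennrealI p) simp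
    finally have l: "limsup (\<lambda>k. ennreal (q k)) \<le> ennreal (A r)" .
    then have "limsup (\<lambda>k. ennreal (q k)) < top" using ennreal_less_top le_less_trans by blast
    then have "limsup (\<lambda>k. ennreal (q k)) = ennreal (speed u r)"
      unfolding speed_def q_def[symmetric] by simp
    with l A0 show ?case unfolding q_def by simp
  qed
qed

text \<open>With \<open>q\<^sub>k\<close> the difference quotients of \<open>u\<close> and \<open>p\<^sub>k \<ge> q\<^sub>k\<close> the averages of \<open>A\<close>, which converge
  to \<open>A\<close>, Fatou's lemma for \<open>p\<^sub>k - q\<^sub>k\<close> bounds the integrals of \<open>q\<^sub>k\<close> from above by that of their
  upper limit.\<close>

lemma dist_le_integral_speed:
  fixes u :: "real \<Rightarrow> 'a::metric_space"
  assumes ab: "a \<le> b" and A: "integrable (lebesgue_on {a..b}) A"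
    and d: "\<forall>s t. a \<le> s \<and> s \<le> t \<and> t \<le> b \<longrightarrow> dist (u s) (u t) \<le> integral\<^sup>L (lebesgue_on {s..t}) A"
    and m: "integrable (lebesgue_on {a..b}) (speed u)"
  shows "dist (u a) (u b) \<le> integral\<^sup>L (lebesgue_on {a..b}) (speed u)"
proof -
  define \<A> where "\<A> t = integral\<^sup>L (lebesgue_on {a..t}) A" for t
  have \<A>: "\<A> t - \<A> s = integral\<^sup>L (lebesgue_on {s..t}) A" if "a \<le> s" "s \<le> t" "t \<le> b" for s t
  proof -
    have "integrable (lebesgue_on {a..t}) A"
      by (rule integrable_lebesgue_on_subinterval[OF A]) (use that in auto)
    from lebesgue_on_integral_combine[OF this that(1,2)] show ?thesis unfolding \<A>_def by simp
  qed
  \<comment> \<open>By the triangle inequality \<open>dist (u a) (u t)\<close> grows no faster than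
    the integral of \<open>A\<close>. So \<open>F\<close> is non-increasing, and its difference
    quotients are at least \<open>p k - q k\<close>.\<close>
  define F where "F t = dist (u a) (u t) - \<A> t" for t
  have Fdiff: "integral\<^sup>L (lebesgue_on {s..t}) A - dist (u s) (u t) \<le> F s - F t"
    if "a \<le> s" "s \<le> t" "t \<le> b" for s t
    using dist_triangle[of "u a" "u t" "u s"] \<A>[OF that] unfolding F_def by simp
  have anti: "antimono_on {a..b} F"
  proof (rule monotone_onI)
    fix s t assume "s \<in> {a..b}" "t \<in> {a..b}" "s \<le> t"
    then show "F t \<le> F s" using Fdiff[of s t] d[rule_format, of s t] by auto
  qed
  have "(\<integral>\<^sup>+r. ennreal (A r - speed u r) \<partial>lebesgue_on {a..b}) \<le> ennreal (F a - F b)"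
  proof (rule nn_integral_difference_quotient_le[OF ab anti])
    show "AE r in lebesgue_on {a..b}. a < r \<longrightarrow> r < b \<longrightarrow> ennreal (A r - speed u r)
        \<le> liminf (\<lambda>k. ennreal (real (Suc k) * (F r - F (r + 1 / real (Suc k)))))"
      using AE_averages_tendsto[OF A] AE_speed_le[OF A d]
    proof eventually_elim
      case (elim r)
      define q where "q k = real (Suc k) * dist (u r) (u (r + 1 / real (Suc k)))" for k
      define p where "p k = real (Suc k) * integral\<^sup>L (lebesgue_on {r..r + 1 / real (Suc k)}) A" for k
      show ?case
      proof (intro impI)
        assume r: "a < r" "r < b"
        have p: "p \<longlonglongrightarrow> A r" and q: "limsup (\<lambda>k. ennreal (q k)) = ennreal (speed u r)"
          using elim r unfolding p_def q_def by auto
        have h0: "(\<lambda>k. 1 / real (Suc k)) \<longlonglongrightarrow> 0" by (intro LIMSEQ_Suc lim_1_over_n)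
        have evh: "\<forall>\<^sub>F k in sequentially. 1 / real (Suc k) < b - r"
          using order_tendstoD(2)[OF h0, of "b - r"] r by simp
        show "ennreal (A r - speed u r) \<le> liminf (\<lambda>k. ennreal (real (Suc k) * (F r - F (r + 1 / real (Suc k)))))"
          unfolding le_Liminf_iff
        proof (intro allI impI)
          fix y assume y: "y < ennreal (A r - speed u r)"
          then obtain y' where y': "y = ennreal y'" "0 \<le> y'" "y' < A r - speed u r"
            by (cases y) (auto simp: ennreal_less_iff)
          \<comment> \<open>Half of the gap: one \<open>e\<close> is spent on the upper limit of
            \<open>q\<close>, the other on the convergence of \<open>p\<close>.\<close>
          define e where "e = (A r - speed u r - y') / 2"
          have e: "e > 0" using y' unfolding e_def by simp
          have "limsup (\<lambda>k. ennreal (q k)) < ennreal (speed u r + e)"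
            unfolding q using e speed_nonneg[of u r] by (simp add: ennreal_less_iff)
          then have "\<forall>\<^sub>F k in sequentially. ennreal (q k) < ennreal (speed u r + e)" by (rule Limsup_lessD)
          moreover have "\<forall>\<^sub>F k in sequentially. A r - e < p k" using p e by (intro order_tendstoD(1)[OF p]) simp
          ultimately show "\<forall>\<^sub>F k in sequentially. y < ennreal (real (Suc k) * (F r - F (r + 1 / real (Suc k))))"
            using evh
          proof eventually_elim
            case (elim k)
            have "q k < speed u r + e" using elim(1) by (simp add: ennreal_less_iff q_def)
            then have "y' < p k - q k" using elim(2) unfolding e_def by argo
            also have "p k - q k \<le> real (Suc k) * (F r - F (r + 1 / real (Suc k)))"
            proof -
              have "real (Suc k) * (integral\<^sup>L (lebesgue_on {r..r + 1 / real (Suc k)}) A - dist (u r) (u (r + 1 / real (Suc k))))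
                \<le> real (Suc k) * (F r - F (r + 1 / real (Suc k)))"
                by (intro mult_left_mono Fdiff) (use r elim(3) in auto)
              then show ?thesis unfolding p_def q_def by (simp only: right_diff_distrib)
            qed
            finally show ?case unfolding y'(1) using y'(2) by (simp add: ennreal_less_iff)
          qed
        qed
      qed
    qed
  qed
  \<comment> \<open>The finite integral of \<open>A\<close> now stands on both sides; cancelling it
    leaves the claim.\<close>
  moreover have "(\<integral>\<^sup>+r. ennreal (A r - speed u r) \<partial>lebesgue_on {a..b})
      = ennreal (integral\<^sup>L (lebesgue_on {a..b}) A - integral\<^sup>L (lebesgue_on {a..b}) (speed u))"
  proof (subst nn_integral_eq_integral)
    show "AE r in lebesgue_on {a..b}. 0 \<le> A r - speed u r"
      using AE_speed_le[OF A d] by eventually_elim simp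
  qed (use A m in simp_all)
  moreover have "F a - F b = integral\<^sup>L (lebesgue_on {a..b}) A - dist (u a) (u b)"
    using \<A>[of a b] ab unfolding F_def by simp
  moreover have "0 \<le> integral\<^sup>L (lebesgue_on {a..b}) A - dist (u a) (u b)"
    using d[rule_format, of a b] ab by simp
  ultimately show ?thesis by (simp add: ennreal_le_iff)
qed

lemma AC2_bound_integrable:
  assumes "AC2_bound T v A" shows "integrable (lebesgue_on {0..T}) A"
proof -
  interpret finite_measure "lebesgue_on {0..T}"
    by (rule finite_measure_lebesgue_on) (auto simp: lmeasurable_interval)
  show ?thesis
    by (rule square_integrable_imp_integrable) (use assms in \<open>simp_all add: AC2_bound_def\<close>)
qed

text \<open>Minimality is \<open>AE_speed_le\<close> for an arbitrary admissible function; the given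
  \<open>A\<close> supplies square integrability and allows \<open>dist_le_integral_speed\<close> on
  each subinterval.\<close>

lemma speed_is_metric_derivative:
  fixes u :: "real \<Rightarrow> 'a::metric_space"
  assumes u: "continuous_on {0..T + 1} u" and A: "AC2_bound T u A"
  shows "is_metric_derivative T u (speed u)"
proof -
  have le: "AE r in lebesgue_on {0..T}. speed u r \<le> B r" if B: "AC2_bound T u B" for B
  proof -
    have "AE r in lebesgue_on {0..T}. speed u r \<le> B r \<and>
      limsup (\<lambda>k. ennreal (real (Suc k) * dist (u r) (u (r + 1 / real (Suc k))))) = ennreal (speed u r)"
      by (rule AE_speed_le[OF AC2_bound_integrable[OF B]]) (use B in \<open>auto simp: AC2_bound_def\<close>)
    then show ?thesis by eventually_elim simp
  qed
  have meas: "speed u \<in> borel_measurable (lebesgue_on {0..T})" by (rule speed_measurable[OF u])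
  have Ai: "integrable (lebesgue_on {0..T}) A" by (rule AC2_bound_integrable[OF A])
  have mi: "integrable (lebesgue_on {0..T}) (speed u)"
    by (rule Bochner_Integration.integrable_bound[OF Ai meas])
      (use le[OF A] speed_nonneg[of u] in \<open>auto elim!: eventually_mono simp: abs_le_iff intro: order_trans\<close>)
  have "integrable (lebesgue_on {0..T}) (\<lambda>r. (speed u r)\<^sup>2)"
  proof (rule Bochner_Integration.integrable_bound)
    show "integrable (lebesgue_on {0..T}) (\<lambda>r. (A r)\<^sup>2)" using A by (simp add: AC2_bound_def)
    show "AE r in lebesgue_on {0..T}. norm ((speed u r)\<^sup>2) \<le> norm ((A r)\<^sup>2)"
      using le[OF A] by eventually_elim (simp add: power_mono speed_nonneg)
  qed (use meas in measurable)
  moreover have "dist (u s) (u t) \<le> integral\<^sup>L (lebesgue_on {s..t}) (speed u)"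
    if st: "0 \<le> s" "s \<le> t" "t \<le> T" for s t
  proof (rule dist_le_integral_speed[OF st(2)])
    show "integrable (lebesgue_on {s..t}) A" "integrable (lebesgue_on {s..t}) (speed u)"
      using st by (auto intro!: integrable_lebesgue_on_subinterval[OF Ai] integrable_lebesgue_on_subinterval[OF mi])
  qed (use A st in \<open>auto simp: AC2_bound_def\<close>)
  ultimately show ?thesis unfolding is_metric_derivative_def AC2_bound_def[of T u "speed u"]
    using meas le by blast
qed

section \<open>The descending slope\<close>

lemma lower_semicontinuous_open_superlevel:
  assumes "lower_semicontinuous f" shows "open {x. c < f x}"
proof (subst open_subopen, intro ballI)
  fix x assume "x \<in> {x. c < f x}"
  then have c: "c < f x" by simp
  then have "\<forall>\<^sub>F y in at x. c < f y"
    using assms unfolding lower_semicontinuous_def by (intro less_LiminfD) (rule less_le_trans, auto)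
  with c have "\<forall>\<^sub>F y in nhds x. c < f y" by (simp add: eventually_nhds_conv_at)
  then show "\<exists>T. open T \<and> x \<in> T \<and> T \<subseteq> {x. c < f x}" unfolding eventually_nhds by blast
qed

text \<open>Radii \<open>1 / (n + 1)\<close> suffice in the upper limit, which makes the infimum
  countable, as measurability requires. At an isolated point the filter \<open>at x\<close> is
  trivial and the value 0 comes out by itself.\<close>

lemma descending_slope_alt:
  "descending_slope f x = (INF n. if f x = \<infinity> then \<infinity> else
     (SUP y\<in>ball x (1 / real (Suc n)) - {x}. e2ennreal (f x - f y) / ennreal (dist x y)))"
proof (cases "f x = \<infinity>")
  case True
  then show ?thesis by (simp add: descending_slope_def)
next
  case False
  define g where "g y = e2ennreal (f x - f y) / ennreal (dist x y)" for y
  have "descending_slope f x = Limsup (at x) g"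
  proof (cases "x isolated_in UNIV")
    case True
    then have "at x = bot"
      by (auto simp: isolated_in_islimpt_iff trivial_limit_within)
    then show ?thesis using False True by (simp add: descending_slope_def bot_ennreal)
  qed (use False in \<open>simp add: descending_slope_def g_def[abs_def]\<close>)
  also have "\<dots> = (INF n. SUP y\<in>ball x (1 / real (Suc n)) - {x}. g y)"
    unfolding Limsup_at
  proof (rule antisym)
    show "(INF e\<in>{0<..}. SUP y\<in>ball x e - {x}. g y) \<le> (INF n. SUP y\<in>ball x (1 / real (Suc n)) - {x}. g y)"
      by (intro INF_greatest INF_lower) simp
    show "(INF n. SUP y\<in>ball x (1 / real (Suc n)) - {x}. g y) \<le> (INF e\<in>{0<..}. SUP y\<in>ball x e - {x}. g y)"
    proof (rule INF_greatest)
      fix e :: real assume "e \<in> {0<..}"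
      then obtain n where "1 / real (Suc n) < e" using nat_approx_posE by auto
      then show "(INF n. SUP y\<in>ball x (1 / real (Suc n)) - {x}. g y) \<le> (SUP y\<in>ball x e - {x}. g y)"
        by (intro INF_lower2[of n] SUP_subset_mono) auto
    qed
  qed
  finally show ?thesis using False by (simp add: g_def)
qed

text \<open>For \<open>c \<ge> 0\<close> the positive part is irrelevant to a strict lower bound.
  The form without division also covers \<open>b = \<infinity>\<close>, where both sides
  fail.\<close>

lemma e2ennreal_diff_divide_gt_iff:
  assumes "d > 0" "c \<ge> 0" "a \<noteq> \<infinity>" "a \<noteq> -\<infinity>" "b \<noteq> -\<infinity>"
  shows "ennreal c < e2ennreal (a - b) / ennreal d \<longleftrightarrow> b + ereal (c * d) < a"
proof -
  obtain a' where a: "a = ereal a'" using assms by (cases a) auto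
  show ?thesis
  proof (cases b)
    case (real b')
    have "ennreal c < ennreal (a' - b') / ennreal d \<longleftrightarrow> c * d < a' - b'"
    proof (cases "a' - b' \<ge> 0")
      case True
      then show ?thesis using assms by (simp add: divide_ennreal ennreal_less_iff pos_less_divide_eq)
    next
      case False
      then have "ennreal (a' - b') = 0" by (simp add: ennreal_neg)
      moreover have "\<not> c * d < a' - b'" using False assms
        by (meson mult_nonneg_nonneg less_eq_real_def less_trans not_le order_trans)
      ultimately show ?thesis by simp
    qed
    then show ?thesis using a real by auto
  next
    case PInf
    then show ?thesis using a by (simp add: e2ennreal_neg)
  qed (use assms in simp)
qed

text \<open>Lower semicontinuity makes each of the suprema in \<open>descending_slope_alt\<close> lower semicontinuous where \<open>f\<close> is finite, as
  \<open>f x > f y + c d(x, y)\<close> is an open condition on \<open>x\<close>.\<close>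

lemma descending_slope_measurable:
  fixes f :: "'a::metric_space \<Rightarrow> ereal"
  assumes lsc: "lower_semicontinuous f" and fin: "\<And>x. f x \<noteq> -\<infinity>"
  shows "descending_slope f \<in> borel_measurable borel"
proof -
  have inf_meas: "{x. f x = \<infinity>} \<in> sets borel"
  proof -
    have "{x. f x = \<infinity>} = (\<Inter>n. {x. ereal (real n) < f x})"
    proof safe
      fix x assume "x \<in> (\<Inter>n. {x. ereal (real n) < f x})"
      then have *: "ereal (real n) < f x" for n by auto
      show "f x = \<infinity>"
      proof (cases "f x")
        case (real c)
        obtain n where "c < real n" using reals_Archimedean2 by blast
        with *[of n] real show ?thesis by simp
      qed (use fin in auto)
    qed simp
    also have "\<dots> \<in> sets borel"
      using lower_semicontinuous_open_superlevel[OF lsc] by (intro sets.countable_INT) auto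
    finally show ?thesis .
  qed
  define g where "g n x = (if f x = \<infinity> then \<infinity> else
     (SUP y\<in>ball x (1 / real (Suc n)) - {x}. e2ennreal (f x - f y) / ennreal (dist x y)))" for n x
  have "g n \<in> borel_measurable borel" for n
  proof (rule borel_measurableI_greater)
    fix c :: ennreal
    \<comment> \<open>The real number \<open>z\<close> separates \<open>f x\<close> from
      \<open>f y + c * dist x y\<close>: the first comparison is open by lower semicontinuity, the
      second by continuity of the distance. The uncountable union over \<open>y\<close> is harmless
      since all sets are open.\<close>
    define U where "U = (\<Union>z\<in>UNIV. \<Union>y\<in>{y. f y \<noteq> \<infinity>}. {x. ereal z < f x} \<inter>
      {x. real_of_ereal (f y) + enn2real c * dist x y < z} \<inter> {x. 0 < dist x y \<and> dist x y < 1 / real (Suc n)})"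
    have "open U" unfolding U_def
      by (intro open_UN ballI open_Int lower_semicontinuous_open_superlevel[OF lsc] open_Collect_less open_Collect_conj
        continuous_intros)
    have *: "c < g n x \<longleftrightarrow> x \<in> U" if fx: "f x \<noteq> \<infinity>" and c: "c < top" for x
    proof -
      have c': "c = ennreal (enn2real c)" using c by simp
      have "c < g n x \<longleftrightarrow> (\<exists>y\<in>ball x (1 / real (Suc n)) - {x}. c < e2ennreal (f x - f y) / ennreal (dist x y))"
        unfolding g_def using fx by (simp add: less_SUP_iff)
      also have "\<dots> \<longleftrightarrow> (\<exists>y\<in>ball x (1 / real (Suc n)) - {x}. f y + ereal (enn2real c * dist x y) < f x)"
        by (subst c', intro bex_cong refl e2ennreal_diff_divide_gt_iff) (use fx fin in auto)
      also have "\<dots> \<longleftrightarrow> x \<in> U"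
      proof
        assume "\<exists>y\<in>ball x (1 / real (Suc n)) - {x}. f y + ereal (enn2real c * dist x y) < f x"
        then obtain y where y: "y \<in> ball x (1 / real (Suc n)) - {x}" "f y + ereal (enn2real c * dist x y) < f x" by blast
        then have "f y \<noteq> \<infinity>" by auto
        then obtain b where b: "f y = ereal b" using fin[of y] by (cases "f y") auto
        obtain z where "ereal (b + enn2real c * dist x y) < ereal z" "ereal z < f x"
          using y(2) b ereal_dense2[of "ereal (b + enn2real c * dist x y)" "f x"] by auto
        then show "x \<in> U" unfolding U_def using y(1) b \<open>f y \<noteq> \<infinity>\<close>
          by (auto intro!: exI[of _ z] exI[of _ y])
      next
        assume "x \<in> U"
        then obtain z y where y: "f y \<noteq> \<infinity>" "ereal z < f x" "real_of_ereal (f y) + enn2real c * dist x y < z"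
          "0 < dist x y" "dist x y < 1 / real (Suc n)" unfolding U_def by blast
        then obtain b where b: "f y = ereal b" using fin[of y] by (cases "f y") auto
        have "f y + ereal (enn2real c * dist x y) < ereal z" using y(3) b by simp
        then have "f y + ereal (enn2real c * dist x y) < f x" using y(2) by (rule less_trans)
        with y b show "\<exists>y\<in>ball x (1 / real (Suc n)) - {x}. f y + ereal (enn2real c * dist x y) < f x"
          by (intro bexI[of _ y]) auto
      qed
      finally show ?thesis .
    qed
    have "{x. c < g n x} = (if c < top then {x. f x = \<infinity>} \<union> U else {})"
    proof (cases "c < top")
      case True
      then show ?thesis using * by (auto simp: g_def)
    next
      case False
      then have "c = top" using top.not_eq_extremum[of c] by blast
      then show ?thesis by simp
    qed
    with \<open>open U\<close> inf_meas show "{x \<in> space borel. c < g n x} \<in> sets borel" by auto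
  qed
  then have "(\<lambda>x. INF n. g n x) \<in> borel_measurable borel" by measurable
  then show ?thesis by (simp add: g_def descending_slope_alt[abs_def])
qed

section \<open>Proximal points\<close>

text \<open>The graph of the (multivalued) resolvent of \<open>f\<close> with step
  \<open>\<sigma>\<close>.\<close>

definition proximal :: "('a::metric_space \<Rightarrow> ereal) \<Rightarrow> real \<Rightarrow> 'a \<Rightarrow> 'a \<Rightarrow> bool" where
  "proximal f \<sigma> x v \<longleftrightarrow> (\<forall>y. f v + ereal ((dist v x)\<^sup>2 / (2 * \<sigma>)) \<le> f y + ereal ((dist y x)\<^sup>2 / (2 * \<sigma>)))"

lemma discrete_solution_iff_proximal:
  "discrete_solution f \<tau> x0 w \<longleftrightarrow> w 0 = x0 \<and> (\<forall>i. proximal f \<tau> (w i) (w (Suc i)))"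
  unfolding discrete_solution_def proximal_def is_arg_min_linorder by simp

lemma proximal_finite:
  assumes "proximal f \<sigma> x v" "\<bar>f x\<bar> \<noteq> \<infinity>" "f v \<noteq> -\<infinity>"
  shows "\<bar>f v\<bar> \<noteq> \<infinity>"
proof -
  have "f v + ereal ((dist v x)\<^sup>2 / (2 * \<sigma>)) \<le> f x + ereal ((dist x x)\<^sup>2 / (2 * \<sigma>))"
    using assms(1) unfolding proximal_def by blast
  then show ?thesis using assms(2,3) by (cases "f v"; cases "f x") auto
qed

lemma proximal_le:
  assumes "proximal f \<sigma> x v" "\<bar>f v\<bar> \<noteq> \<infinity>" "\<bar>f y\<bar> \<noteq> \<infinity>"
  shows "real_of_ereal (f v) + (dist v x)\<^sup>2 / (2 * \<sigma>) \<le> real_of_ereal (f y) + (dist y x)\<^sup>2 / (2 * \<sigma>)"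
proof -
  have "f v + ereal ((dist v x)\<^sup>2 / (2 * \<sigma>)) \<le> f y + ereal ((dist y x)\<^sup>2 / (2 * \<sigma>))"
    using assms(1) unfolding proximal_def by blast
  then show ?thesis using assms(2,3) by (cases "f v"; cases "f y") auto
qed

text \<open>Test each minimizer against the other. Adding the two inequalities cancels the energies
  and leaves \<open>(a - b) * (X - Y) \<le> 0\<close> with \<open>b < a\<close>; the inequality for
  the larger step \<open>\<rho>\<close> then compares the energies.\<close>

lemma proximal_mono:
  assumes v: "proximal f \<sigma> x v" "\<bar>f v\<bar> \<noteq> \<infinity>" and v': "proximal f \<rho> x v'" "\<bar>f v'\<bar> \<noteq> \<infinity>"
    and \<sigma>: "0 < \<sigma>" "\<sigma> < \<rho>"
  shows "dist v x \<le> dist v' x" "real_of_ereal (f v') \<le> real_of_ereal (f v)"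
proof -
  define a b where "a = 1 / (2 * \<sigma>)" and "b = 1 / (2 * \<rho>)"
  define X Y where "X = (dist v x)\<^sup>2" and "Y = (dist v' x)\<^sup>2"
  have ab: "b < a" "0 < b" using \<sigma> unfolding a_def b_def by (simp_all add: frac_less2)
  have 1: "real_of_ereal (f v) + X * a \<le> real_of_ereal (f v') + Y * a"
    using proximal_le[OF v v'(2)] unfolding X_def Y_def a_def by simp
  have 2: "real_of_ereal (f v') + Y * b \<le> real_of_ereal (f v) + X * b"
    using proximal_le[OF v' v(2)] unfolding X_def Y_def b_def by simp
  have "(a - b) * (X - Y) \<le> 0" using 1 2 by (simp add: algebra_simps)
  then have XY: "X \<le> Y" using ab by (simp add: mult_le_0_iff)
  then show "dist v x \<le> dist v' x" unfolding X_def Y_def by (simp add: power2_le_iff_abs_le)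
  have "X * b \<le> Y * b" using XY ab by simp
  with 2 show "real_of_ereal (f v') \<le> real_of_ereal (f v)" by argo
qed

text \<open>Minimality bounds \<open>f v - f y\<close> by a difference of squared distances to
  \<open>x\<close>. This factors as \<open>dist v y\<close> times a quantity that tends to
  \<open>2 * dist v x\<close> as \<open>y\<close> approaches \<open>v\<close>.\<close>

lemma descending_slope_proximal_le:
  assumes v: "proximal f \<sigma> x v" and fv: "\<bar>f v\<bar> \<noteq> \<infinity>" and fin: "\<And>y. f y \<noteq> -\<infinity>" and \<sigma>: "0 < \<sigma>"
  shows "descending_slope f v \<le> ennreal (dist v x / \<sigma>)"
proof (cases "v isolated_in UNIV")
  case True
  then show ?thesis using fv by (auto simp: descending_slope_def)
next
  case False
  have quot: "e2ennreal (f v - f y) / ennreal (dist v y) \<le> ennreal ((2 * dist v x + dist v y) / (2 * \<sigma>))"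
    if y: "y \<noteq> v" for y
  proof (cases "f y = \<infinity>")
    case True
    then show ?thesis using fv by (cases "f v") (auto simp: e2ennreal_neg)
  next
    case False
    define c where "c = real_of_ereal (f v) - real_of_ereal (f y)"
    have fy: "\<bar>f y\<bar> \<noteq> \<infinity>" using False fin[of y] by auto
    have eq: "f v - f y = ereal c" using fv fy unfolding c_def by (cases "f v"; cases "f y") auto
    have d: "0 < dist v y" using y by simp
    have "c \<le> ((dist y x)\<^sup>2 - (dist v x)\<^sup>2) / (2 * \<sigma>)"
      using proximal_le[OF v fv fy] unfolding c_def by (simp add: diff_divide_distrib)
    also have "\<dots> \<le> (dist v y * (2 * dist v x + dist v y)) / (2 * \<sigma>)"
    proof (rule divide_right_mono)
      have "dist y x \<le> dist v y + dist v x" by (metis dist_commute dist_triangle)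
      then have "(dist y x)\<^sup>2 \<le> (dist v y + dist v x)\<^sup>2" by (rule power_mono) simp
      then show "(dist y x)\<^sup>2 - (dist v x)\<^sup>2 \<le> dist v y * (2 * dist v x + dist v y)"
        by (simp add: power2_eq_square algebra_simps)
    qed (use \<sigma> in simp)
    finally have le: "c / dist v y \<le> (2 * dist v x + dist v y) / (2 * \<sigma>)"
      using d by (simp add: pos_divide_le_eq mult.commute)
    have "e2ennreal (f v - f y) / ennreal (dist v y) = ennreal (c / dist v y)"
    proof (cases "0 \<le> c")
      case True
      then show ?thesis using d unfolding eq by (simp add: divide_ennreal)
    next
      case False
      then have "c / dist v y \<le> 0" using d by (simp add: divide_le_0_iff)
      then show ?thesis using False unfolding eq by (simp add: ennreal_neg)
    qed
    then show ?thesis using le by (simp add: ennreal_leI)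
  qed
  have "((\<lambda>y. ennreal ((2 * dist v x + dist v y) / (2 * \<sigma>))) \<longlongrightarrow> ennreal ((2 * dist v x + dist v v) / (2 * \<sigma>))) (at v)"
    by (intro tendsto_ennrealI tendsto_intros) (use \<sigma> in simp)
  moreover have "at v \<noteq> bot" using False by (simp add: isolated_in_islimpt_iff trivial_limit_within)
  ultimately have "Limsup (at v) (\<lambda>y. ennreal ((2 * dist v x + dist v y) / (2 * \<sigma>))) = ennreal (dist v x / \<sigma>)"
    by (subst lim_imp_Limsup) auto
  moreover have "Limsup (at v) (\<lambda>y. e2ennreal (f v - f y) / ennreal (dist v y))
      \<le> Limsup (at v) (\<lambda>y. ennreal ((2 * dist v x + dist v y) / (2 * \<sigma>)))"
    by (rule Limsup_mono) (use quot in \<open>auto simp: eventually_at_filter\<close>)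
  ultimately show ?thesis using False fv unfolding descending_slope_def by auto
qed

text \<open>The direct method by open covers: if the infimum \<open>I\<close> over \<open>K\<close>
  were not attained, the open sets \<open>{x. c < h x}\<close> with \<open>I < c\<close> would cover
  \<open>K\<close>, and a finite subcover would push the infimum above \<open>I\<close>. The point
  \<open>x0\<close> keeps \<open>K\<close> nonempty and makes values outside \<open>K\<close>
  irrelevant.\<close>

lemma lower_semicontinuous_attains_min:
  fixes f :: "'a::metric_space \<Rightarrow> ereal"
  assumes lsc: "lower_semicontinuous f" and g: "continuous_on UNIV g"
    and K: "compact K" "x0 \<in> K" and out: "\<And>v. f v + ereal (g v) \<le> f x0 + ereal (g x0) \<Longrightarrow> v \<in> K"
  shows "\<exists>v. \<forall>y. f v + ereal (g v) \<le> f y + ereal (g y)"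
proof -
  define h where "h v = f v + ereal (g v)" for v
  define I where "I = (INF v\<in>K. h v)"
  have op: "open {x. c < h x}" for c
  proof (subst open_subopen, intro ballI)
    fix x assume "x \<in> {x. c < h x}"
    then have c: "c - ereal (g x) < f x"
      unfolding h_def by (cases c; cases "f x") auto
    obtain z where z: "c - ereal (g x) < ereal z" "ereal z < f x" using ereal_dense2[OF c] by blast
    \<comment> \<open>The number \<open>z\<close> splits the condition on the sum \<open>h\<close>
      into one on \<open>f\<close> and one on \<open>g\<close>, each open by itself.\<close>
    have "open ({y. ereal z < f y} \<inter> {y. c - ereal z < ereal (g y)})"
      using z(1) by (cases c) (auto intro!: open_Int lower_semicontinuous_open_superlevel[OF lsc] open_Collect_less continuous_intros g)
    moreover have "x \<in> {y. ereal z < f y} \<inter> {y. c - ereal z < ereal (g y)}"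
      using z by (cases c) auto
    moreover have "{y. ereal z < f y} \<inter> {y. c - ereal z < ereal (g y)} \<subseteq> {x. c < h x}"
    proof
      fix y assume "y \<in> {y. ereal z < f y} \<inter> {y. c - ereal z < ereal (g y)}"
      then show "y \<in> {x. c < h x}" unfolding h_def by (cases c; cases "f y") auto
    qed
    ultimately show "\<exists>T. open T \<and> x \<in> T \<and> T \<subseteq> {x. c < h x}" by blast
  qed
  have "\<exists>v\<in>K. h v \<le> I"
  proof (rule ccontr)
    assume "\<not> (\<exists>v\<in>K. h v \<le> I)"
    then have "\<forall>v\<in>K. I < h v" by auto
    have "K \<subseteq> (\<Union>c\<in>{c. I < c}. {x. c < h x})"
    proof
      fix v assume "v \<in> K"
      with \<open>\<forall>v\<in>K. I < h v\<close> obtain c where "I < c" "c < h v" using dense by blast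
      then show "v \<in> (\<Union>c\<in>{c. I < c}. {x. c < h x})" by blast
    qed
    from compactE_image[OF K(1) _ this] op obtain C
      where C: "C \<subseteq> {c. I < c}" "finite C" "K \<subseteq> (\<Union>c\<in>C. {x. c < h x})" by blast
    have "C \<noteq> {}" using C(3) K(2) by auto
    have "Min C \<le> h v" if v: "v \<in> K" for v
    proof -
      obtain c where "c \<in> C" "c < h v" using v C(3) by blast
      then show ?thesis using Min_le[OF C(2), of c] by simp
    qed
    then have "Min C \<le> I" unfolding I_def by (intro INF_greatest)
    moreover have "I < Min C" using C \<open>C \<noteq> {}\<close> by auto
    ultimately show False by simp
  qed
  then obtain v where v: "v \<in> K" "h v \<le> I" by blast
  have "h v \<le> h y" for y
  proof (cases "y \<in> K")
    case True
    then show ?thesis using v(2) unfolding I_def by (meson INF_lower order_trans)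
  next
    case False
    then have "h x0 \<le> h y" using out[of y] unfolding h_def by (meson linear)
    moreover have "h v \<le> h x0" using v(2) K(2) unfolding I_def by (meson INF_lower order_trans)
    ultimately show ?thesis by simp
  qed
  then show ?thesis unfolding h_def by blast
qed

text \<open>The lower bound is centred at \<open>z\<close> with step \<open>\<rho>\<close>, the
  minimization at \<open>x\<close> with step \<open>\<sigma>\<close>; for small
  \<open>\<sigma>\<close> the penalty controls the former, so competitors no worse than
  \<open>x\<close> lie in one of the compact sets.\<close>

lemma proximal_exists:
  fixes f :: "'a::metric_space \<Rightarrow> ereal"
  assumes lsc: "lower_semicontinuous f" and fin: "\<And>y. f y \<noteq> -\<infinity>"
    and lower: "\<And>v. ereal C \<le> f v + ereal ((dist v z)\<^sup>2 / (2 * \<rho>))" and \<rho>: "0 < \<rho>"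
    and cpt: "\<And>c. c > 0 \<Longrightarrow> \<exists>K. compact K \<and> {x. (dist x z)\<^sup>2 \<le> c \<and> \<bar>f x\<bar> \<le> ereal c} \<subseteq> K"
    and x: "\<bar>f x\<bar> \<noteq> \<infinity>" and \<sigma>: "0 < \<sigma>" "\<sigma> \<le> \<rho> / 4"
  shows "\<exists>v. proximal f \<sigma> x v"
proof -
  define c where "c = real_of_ereal (f x)"
  define Q where "Q = (dist x z)\<^sup>2"
  \<comment> \<open>The bound for \<open>(dist v z)\<^sup>2\<close> obtained below from
    \<open>D \<le> \<rho> * (c - C) + Q\<close> and \<open>Z \<le> 2 * D + 2 * Q\<close>.\<close>
  define R where "R = 2 * (\<rho> * (c - C) + Q) + 2 * Q"
  \<comment> \<open>Large enough for the distances and the energies of both \<open>x\<close> and its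
    competitors.\<close>
  define b where "b = 1 + \<bar>R\<bar> + \<bar>c\<bar> + \<bar>C\<bar> + \<bar>R\<bar> / (2 * \<rho>) + Q"
  have c: "f x = ereal c" using x unfolding c_def by auto
  have b0: "0 < b" unfolding b_def Q_def using \<rho> by (simp add: add_pos_nonneg)
  obtain K where K: "compact K" "{x. (dist x z)\<^sup>2 \<le> b \<and> \<bar>f x\<bar> \<le> ereal b} \<subseteq> K" using cpt[OF b0] by blast
  have "\<exists>v. \<forall>y. f v + ereal ((dist v x)\<^sup>2 / (2 * \<sigma>)) \<le> f y + ereal ((dist y x)\<^sup>2 / (2 * \<sigma>))"
  proof (rule lower_semicontinuous_attains_min[OF lsc _ K(1)])
    show "continuous_on UNIV (\<lambda>v. (dist v x)\<^sup>2 / (2 * \<sigma>))"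
      by (intro continuous_intros) (use \<sigma> in auto)
    have "0 \<le> \<bar>R\<bar> / (2 * \<rho>)" using \<rho> by simp
    then show "x \<in> K"
      using c by (intro subsetD[OF K(2)]) (auto simp: b_def Q_def)
    fix v assume "f v + ereal ((dist v x)\<^sup>2 / (2 * \<sigma>)) \<le> f x + ereal ((dist x x)\<^sup>2 / (2 * \<sigma>))"
    then have le: "f v + ereal ((dist v x)\<^sup>2 / (2 * \<sigma>)) \<le> ereal c" using c by simp
    then obtain r where r: "f v = ereal r" using fin[of v] by (cases "f v") auto
    define D where "D = (dist v x)\<^sup>2"
    define Z where "Z = (dist v z)\<^sup>2"
    have D0: "0 \<le> D" "0 \<le> Z" "0 \<le> Q" unfolding D_def Z_def Q_def by simp_all
    have 1: "r + D / (2 * \<sigma>) \<le> c" using le r unfolding D_def by simp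
    have 2: "C \<le> r + Z / (2 * \<rho>)" using lower[of v] r unfolding Z_def by simp
    have 3: "Z \<le> 2 * D + 2 * Q"
    proof -
      have "Z \<le> (dist v x + dist x z)\<^sup>2" unfolding Z_def by (intro power_mono dist_triangle) simp
      also have "\<dots> \<le> 2 * D + 2 * Q" unfolding D_def Q_def
        using sum_squares_bound[of "dist v x" "dist x z"] by (simp add: power2_sum)
      finally show ?thesis .
    qed
    \<comment> \<open>Here \<open>\<sigma> \<le> \<rho> / 4\<close> enters: the penalty is at least
      \<open>2 * D / \<rho>\<close>, of which the lower bound can consume only one
      \<open>D / \<rho>\<close>, so \<open>D\<close> is bounded.\<close>
    have 4: "2 * D / \<rho> \<le> D / (2 * \<sigma>)"
      using D0 \<sigma> \<rho> mult_left_mono[OF \<sigma>(2), of D] by (simp add: field_simps)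
    have "Z / (2 * \<rho>) \<le> (D + Q) / \<rho>"
      using 3 \<rho> by (simp add: field_simps)
    then have "2 * D / \<rho> \<le> c - C + (D + Q) / \<rho>" using 1 2 4 by argo
    then have "D / \<rho> \<le> c - C + Q / \<rho>" by (simp add: add_divide_distrib)
    then have "D \<le> \<rho> * (c - C) + Q" using \<rho> by (simp add: field_simps)
    then have ZR: "Z \<le> R" using 3 unfolding R_def by argo
    have "Z / (2 * \<rho>) \<le> \<bar>R\<bar> / (2 * \<rho>)" using ZR \<rho> by (intro divide_right_mono) auto
    moreover have "0 \<le> D / (2 * \<sigma>)" using D0 \<sigma> by simp
    moreover have "0 \<le> \<bar>R\<bar> / (2 * \<rho>)" using \<rho> by simp
    ultimately have "r \<le> c" "C - \<bar>R\<bar> / (2 * \<rho>) \<le> r" "r \<le> b" "- b \<le> r" "Z \<le> b"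
      using 1 2 ZR D0 unfolding b_def by linarith+
    then have "\<bar>r\<bar> \<le> b" "Z \<le> b" by linarith+
    then show "v \<in> K" using r by (intro subsetD[OF K(2)]) (auto simp: Z_def)
  qed
  then show ?thesis unfolding proximal_def .
qed

text \<open>The hypothesis is implicit, as its sum ends with \<open>y k\<close> itself. Since
  \<open>c \<le> 1 / 2\<close> that term is absorbed on the left, which doubles both constants; the
  explicit sums \<open>s k\<close> then grow by at most the factor \<open>1 + 2 * c\<close> per
  step.\<close>

lemma discrete_Gronwall:
  fixes y :: "nat \<Rightarrow> real"
  assumes y0: "\<And>k. 0 \<le> y k" and P: "0 \<le> P" and c: "0 \<le> c" "c \<le> 1 / 2"
    and le: "\<And>k. y k \<le> P + c * (\<Sum>j<k. y (Suc j))"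
  shows "y k \<le> 2 * P * exp (2 * c * real k)"
proof -
  define s where "s k = 2 * P + 2 * c * (\<Sum>j<k. y j)" for k
  have ys: "y k \<le> s k" for k
  proof -
    have "(\<Sum>j<k. y (Suc j)) + y 0 = (\<Sum>j<k. y j) + y k"
      using sum.lessThan_Suc_shift[of y k] sum.lessThan_Suc[of y k] by simp
    then have "(\<Sum>j<k. y (Suc j)) \<le> (\<Sum>j<k. y j) + y k" using y0[of 0] by linarith
    then have "c * (\<Sum>j<k. y (Suc j)) \<le> c * (\<Sum>j<k. y j) + c * y k"
      using c(1) by (metis distrib_left mult_left_mono)
    moreover have "c * y k \<le> y k / 2" using mult_right_mono[OF c(2) y0[of k]] by simp
    ultimately have "y k \<le> P + c * (\<Sum>j<k. y j) + y k / 2" using le[of k] by argo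
    then show ?thesis unfolding s_def by argo
  qed
  have "s k \<le> 2 * P * (1 + 2 * c) ^ k" for k
  proof (induction k)
    case (Suc k)
    have "s (Suc k) = s k + 2 * c * y k" unfolding s_def by (simp add: algebra_simps)
    also have "\<dots> \<le> s k + 2 * c * s k" using ys[of k] c(1) by (intro add_left_mono mult_left_mono) auto
    also have "\<dots> = s k * (1 + 2 * c)" by (simp add: algebra_simps)
    also have "\<dots> \<le> 2 * P * (1 + 2 * c) ^ k * (1 + 2 * c)" using Suc c(1) by (intro mult_right_mono) auto
    finally show ?case by (simp add: ac_simps)
  qed (simp add: s_def)
  also have "2 * P * (1 + 2 * c) ^ k \<le> 2 * P * exp (2 * c) ^ k"
    using P c(1) by (intro mult_left_mono power_mono) (auto simp: exp_ge_add_one_self)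
  also have "exp (2 * c) ^ k = exp (2 * c * real k)" by (simp add: exp_of_nat_mult[symmetric] mult.commute)
  finally show ?thesis using ys[of k] by linarith
qed

section \<open>Discrete solutions\<close>

text \<open>\<open>step\<close> concerns the grid values only, while \<open>exists\<close> supplies
  the interpolating points. It is conditional on a finite energy at \<open>w i\<close> because that
  finiteness follows only by induction along the steps.\<close>

locale discrete_scheme =
  fixes f :: "'a::metric_space \<Rightarrow> ereal" and \<tau> :: real and w :: "nat \<Rightarrow> 'a"
  assumes not_MInf: "\<And>x. f x \<noteq> -\<infinity>" and \<tau>: "0 < \<tau>"
    and initial: "\<bar>f (w 0)\<bar> \<noteq> \<infinity>"
    and step: "\<And>i. proximal f \<tau> (w i) (w (Suc i))"
    and exists: "\<And>i \<sigma>. 0 < \<sigma> \<Longrightarrow> \<sigma> \<le> \<tau> \<Longrightarrow> \<bar>f (w i)\<bar> \<noteq> \<infinity> \<Longrightarrow> \<exists>v. proximal f \<sigma> (w i) v"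
begin

abbreviation F :: "'a \<Rightarrow> real" where "F v \<equiv> real_of_ereal (f v)"

abbreviation incr :: "nat \<Rightarrow> real" where "incr i \<equiv> dist (w (Suc i)) (w i)"

text \<open>Steps are open on the left: \<open>idx t = i\<close> on
  \<open>(i \<tau>, (i + 1) \<tau>]\<close>, where the piecewise constant interpolation already has
  the value \<open>w (Suc i)\<close>.\<close>

definition idx :: "real \<Rightarrow> nat" where "idx t = nat (\<lceil>t / \<tau>\<rceil> - 1)"

text \<open>The Moreau-Yosida envelope of \<open>f\<close> at \<open>w i\<close>, as a function of
  the step size.\<close>

definition moreau :: "nat \<Rightarrow> real \<Rightarrow> real" where
  "moreau i \<sigma> = real_of_ereal (INF v. f v + ereal ((dist v (w i))\<^sup>2 / (2 * \<sigma>)))"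

text \<open>The subtracted term is affine on each step and makes \<open>energy\<close> non-increasing with value
  \<open>F (w i)\<close> at \<open>i \<tau>\<close>, so that both terms of the energy-dissipation inequality appear in its
  difference quotients.\<close>

definition energy :: "real \<Rightarrow> real" where
  "energy t = (if t \<le> 0 then F (w 0) else
     moreau (idx t) (t - real (idx t) * \<tau>) - (t - real (idx t) * \<tau>) * (incr (idx t))\<^sup>2 / (2 * \<tau>\<^sup>2))"

definition velocity :: "real \<Rightarrow> real" where "velocity t = incr (idx t) / \<tau>"

section \<open>Energy decrease along the steps\<close>

lemma finite_values: "\<bar>f (w i)\<bar> \<noteq> \<infinity>"
proof (induction i)
  case (Suc i)
  then show ?case using proximal_finite[OF step Suc not_MInf] by blast
qed (rule initial)

lemma step_le: "F (w (Suc i)) + (incr i)\<^sup>2 / (2 * \<tau>) \<le> F (w i)"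
  using proximal_le[OF step finite_values finite_values, of i i] by simp

lemma F_antimono: "i \<le> j \<Longrightarrow> F (w j) \<le> F (w i)"
proof (rule lift_Suc_antimono_le)
  show "F (w (Suc n)) \<le> F (w n)" for n
    using step_le[of n] \<tau> zero_le_power2[of "incr n"] by (smt (verit) divide_nonneg_pos)
qed

lemma sum_incr_le: "(\<Sum>i<k. (incr i)\<^sup>2) \<le> 2 * \<tau> * (F (w 0) - F (w k))"
proof (induction k)
  case (Suc k)
  have "(incr k)\<^sup>2 \<le> 2 * \<tau> * (F (w k) - F (w (Suc k)))"
    using step_le[of k] \<tau> by (simp add: field_simps)
  with Suc show ?case by (simp add: algebra_simps)
qed simp

section \<open>The time grid\<close>

lemma idx_eq: "real i * \<tau> < t \<Longrightarrow> t \<le> real (Suc i) * \<tau> \<Longrightarrow> idx t = i"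
proof -
  assume "real i * \<tau> < t" "t \<le> real (Suc i) * \<tau>"
  then have "real i < t / \<tau>" "t / \<tau> \<le> real i + 1" using \<tau> by (simp_all add: field_simps)
  then have "\<lceil>t / \<tau>\<rceil> = int i + 1" by (intro ceiling_unique) auto
  then show ?thesis unfolding idx_def by simp
qed

lemma idx_bounds:
  assumes "0 < t" shows "real (idx t) * \<tau> < t" "t \<le> real (Suc (idx t)) * \<tau>"
    "nat \<lceil>t / \<tau>\<rceil> = Suc (idx t)"
proof -
  have pos: "0 < t / \<tau>" using assms \<tau> by simp
  then have c: "1 \<le> \<lceil>t / \<tau>\<rceil>" by (simp add: one_le_ceiling)
  then show "nat \<lceil>t / \<tau>\<rceil> = Suc (idx t)" unfolding idx_def by (simp add: nat_diff_distrib)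
  have e: "real (idx t) = of_int \<lceil>t / \<tau>\<rceil> - 1" using c unfolding idx_def by simp
  have "real (idx t) < t / \<tau>" "t / \<tau> \<le> real (idx t) + 1"
    unfolding e using ceiling_correct[of "t / \<tau>"] by auto
  then show "real (idx t) * \<tau> < t" "t \<le> real (Suc (idx t)) * \<tau>"
    using \<tau> by (simp_all add: field_simps)
qed

lemma idx_mono: "s \<le> t \<Longrightarrow> idx s \<le> idx t"
  unfolding idx_def using \<tau> by (intro nat_mono diff_mono ceiling_mono divide_right_mono) auto

lemma moreau_eq:
  assumes v: "proximal f \<sigma> (w i) v" "\<bar>f v\<bar> \<noteq> \<infinity>"
  shows "moreau i \<sigma> = F v + (dist v (w i))\<^sup>2 / (2 * \<sigma>)"
proof -
  have "(INF v. f v + ereal ((dist v (w i))\<^sup>2 / (2 * \<sigma>))) = f v + ereal ((dist v (w i))\<^sup>2 / (2 * \<sigma>))"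
    using v(1) unfolding proximal_def by (intro antisym INF_lower INF_greatest) auto
  then show ?thesis using v(2) unfolding moreau_def by (cases "f v") auto
qed

lemma proximal_obtain:
  assumes "0 < \<sigma>" "\<sigma> \<le> \<tau>"
  obtains v where "proximal f \<sigma> (w i) v" "\<bar>f v\<bar> \<noteq> \<infinity>"
proof -
  obtain v where v: "proximal f \<sigma> (w i) v" using exists[OF assms finite_values] by blast
  show thesis by (rule that[OF v proximal_finite[OF v finite_values not_MInf]])
qed

text \<open>The minimizer for \<open>\<sigma>\<close> is a competitor for \<open>\<rho>\<close>.
  Divided by \<open>\<rho> - \<sigma>\<close>, the gain tends to half the square of
  \<open>dist v (w i) / \<sigma>\<close>, the bound for the slope at \<open>v\<close>.\<close>

lemma moreau_diff:
  assumes \<sigma>: "0 < \<sigma>" "\<sigma> \<le> \<rho>" "\<rho> \<le> \<tau>" and v: "proximal f \<sigma> (w i) v" "\<bar>f v\<bar> \<noteq> \<infinity>"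
  shows "(dist v (w i))\<^sup>2 * (\<rho> - \<sigma>) / (2 * \<sigma> * \<rho>) \<le> moreau i \<sigma> - moreau i \<rho>"
proof -
  have \<rho>: "0 < \<rho>" using \<sigma> by simp
  obtain v' where v': "proximal f \<rho> (w i) v'" "\<bar>f v'\<bar> \<noteq> \<infinity>" using proximal_obtain[OF \<rho> \<sigma>(3)] .
  have "moreau i \<rho> \<le> F v + (dist v (w i))\<^sup>2 / (2 * \<rho>)"
    unfolding moreau_eq[OF v'] by (rule proximal_le[OF v' v(2)])
  moreover have "(dist v (w i))\<^sup>2 / (2 * \<sigma>) - (dist v (w i))\<^sup>2 / (2 * \<rho>) = (dist v (w i))\<^sup>2 * (\<rho> - \<sigma>) / (2 * \<sigma> * \<rho>)"
    using \<sigma> \<rho> by (simp add: field_simps)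
  ultimately show ?thesis unfolding moreau_eq[OF v] by linarith
qed

lemma moreau_antimono:
  assumes "0 < \<sigma>" "\<sigma> \<le> \<rho>" "\<rho> \<le> \<tau>" shows "moreau i \<rho> \<le> moreau i \<sigma>"
proof -
  obtain v where v: "proximal f \<sigma> (w i) v" "\<bar>f v\<bar> \<noteq> \<infinity>" using proximal_obtain[of \<sigma>] assms by auto
  have "0 \<le> (dist v (w i))\<^sup>2 * (\<rho> - \<sigma>) / (2 * \<sigma> * \<rho>)" using assms by simp
  with moreau_diff[OF assms v] show ?thesis by linarith
qed

lemma moreau_le: assumes "0 < \<sigma>" "\<sigma> \<le> \<tau>" shows "moreau i \<sigma> \<le> F (w i)"
proof -
  obtain v where v: "proximal f \<sigma> (w i) v" "\<bar>f v\<bar> \<noteq> \<infinity>" using proximal_obtain[OF assms] .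
  show ?thesis using proximal_le[OF v finite_values[of i]] unfolding moreau_eq[OF v] by simp
qed

lemma energy_on_step:
  assumes "real i * \<tau> < t" "t \<le> real (Suc i) * \<tau>"
  shows "energy t = moreau i (t - real i * \<tau>) - (t - real i * \<tau>) * (incr i)\<^sup>2 / (2 * \<tau>\<^sup>2)"
proof -
  have "0 \<le> real i * \<tau>" using \<tau> by simp
  then have "\<not> t \<le> 0" using assms by linarith
  then show ?thesis unfolding energy_def idx_eq[OF assms] by simp
qed

text \<open>At the end of a step the subtracted term equals the penalty contained in
  \<open>moreau i \<tau>\<close>, so only \<open>F (w (Suc i))\<close> remains; earlier in the step
  the envelope is larger and less is subtracted.\<close>

lemma energy_bounds:
  assumes "0 < t" shows "F (w (Suc (idx t))) \<le> energy t" "energy t \<le> F (w (idx t))"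
proof -
  define i where "i = idx t"
  define \<sigma> where "\<sigma> = t - real i * \<tau>"
  have \<sigma>: "0 < \<sigma>" "\<sigma> \<le> \<tau>" using idx_bounds[OF assms] unfolding \<sigma>_def i_def by (auto simp: algebra_simps)
  have E: "energy t = moreau i \<sigma> - \<sigma> * (incr i)\<^sup>2 / (2 * \<tau>\<^sup>2)"
    unfolding \<sigma>_def by (rule energy_on_step) (use idx_bounds[OF assms] in \<open>auto simp: i_def\<close>)
  have "0 \<le> \<sigma> * (incr i)\<^sup>2 / (2 * \<tau>\<^sup>2)" using \<sigma> by simp
  then show "energy t \<le> F (w (idx t))" using moreau_le[OF \<sigma>, of i] E unfolding i_def by linarith
  have "\<sigma> * (incr i)\<^sup>2 / (2 * \<tau>\<^sup>2) \<le> \<tau> * (incr i)\<^sup>2 / (2 * \<tau>\<^sup>2)"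
    using \<sigma> by (intro divide_right_mono mult_right_mono) auto
  also have "\<dots> = (incr i)\<^sup>2 / (2 * \<tau>)" using \<tau> by (simp add: power2_eq_square)
  finally have "\<sigma> * (incr i)\<^sup>2 / (2 * \<tau>\<^sup>2) \<le> (incr i)\<^sup>2 / (2 * \<tau>)" .
  moreover have "moreau i \<tau> = F (w (Suc i)) + (incr i)\<^sup>2 / (2 * \<tau>)"
    by (rule moreau_eq[OF step finite_values])
  moreover have "moreau i \<tau> \<le> moreau i \<sigma>" using \<sigma> by (intro moreau_antimono) auto
  ultimately show "F (w (Suc (idx t))) \<le> energy t" unfolding E i_def[symmetric] by linarith
qed

lemma energy_antimono: "antimono energy"
proof (rule antimonoI)
  fix s t :: real assume st: "s \<le> t"
  show "energy t \<le> energy s"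
  proof (cases "s \<le> 0")
    case True
    show ?thesis
    proof (cases "t \<le> 0")
      case False
      then have "energy t \<le> F (w (idx t))" by (intro energy_bounds) simp
      also have "\<dots> \<le> F (w 0)" by (rule F_antimono) simp
      finally show ?thesis using True by (simp add: energy_def)
    qed (use True in \<open>simp add: energy_def\<close>)
  next
    case False
    then have s: "0 < s" and t: "0 < t" using st by auto
    show ?thesis
    proof (cases "idx s = idx t")
      case True
      define i where "i = idx s"
      have b: "real i * \<tau> < s" "s \<le> real (Suc i) * \<tau>" "real i * \<tau> < t" "t \<le> real (Suc i) * \<tau>"
        using idx_bounds[OF s] idx_bounds[OF t] True unfolding i_def by auto
      have "moreau i (t - real i * \<tau>) \<le> moreau i (s - real i * \<tau>)"
        by (rule moreau_antimono) (use b st in \<open>auto simp: algebra_simps\<close>)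
      moreover have "(s - real i * \<tau>) * (incr i)\<^sup>2 / (2 * \<tau>\<^sup>2) \<le> (t - real i * \<tau>) * (incr i)\<^sup>2 / (2 * \<tau>\<^sup>2)"
        using st by (intro divide_right_mono mult_right_mono) auto
      ultimately show ?thesis using energy_on_step b by simp
    next
      case False
      then have "Suc (idx s) \<le> idx t" using idx_mono[OF st] by simp
      then have "F (w (idx t)) \<le> F (w (Suc (idx s)))" by (rule F_antimono)
      then show ?thesis using energy_bounds[OF s] energy_bounds[OF t] by linarith
    qed
  qed
qed

text \<open>The minimizer at \<open>\<sigma> = t - i \<tau>\<close> serves all quotients at once:
  the envelope contributes its slope bound, the affine term the velocity. The right end of the step
  is excluded since a forward quotient there would look into the next step.\<close>

lemma energy_quotient:
  assumes t: "0 < t" and grid: "t \<noteq> real (Suc (idx t)) * \<tau>"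
  obtains v where "dist v (w (Suc (idx t))) \<le> 2 * incr (idx t)" "\<bar>f v\<bar> \<noteq> \<infinity>"
    "F (w (Suc (idx t))) \<le> F v" "F v \<le> F (w (idx t))"
    "ennreal ((velocity t)\<^sup>2 / 2) + (descending_slope f v)\<^sup>2 / 2
      \<le> liminf (\<lambda>k. ennreal (real (Suc k) * (energy t - energy (t + 1 / real (Suc k)))))"
proof -
  define i where "i = idx t"
  define \<sigma> where "\<sigma> = t - real i * \<tau>"
  have b: "real i * \<tau> < t" "t < real (Suc i) * \<tau>"
    using idx_bounds[OF t] grid unfolding i_def by auto
  have \<sigma>: "0 < \<sigma>" "\<sigma> < \<tau>" using b unfolding \<sigma>_def by (auto simp: algebra_simps)
  obtain v where v: "proximal f \<sigma> (w i) v" "\<bar>f v\<bar> \<noteq> \<infinity>"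
    using proximal_obtain[of \<sigma>] \<sigma> by auto
  have mono: "dist v (w i) \<le> incr i" "F (w (Suc i)) \<le> F v"
    using proximal_mono[OF v step finite_values \<sigma>] by auto
  define D where "D = (dist v (w i))\<^sup>2"
  define X where "X k = D / (2 * \<sigma> * (\<sigma> + 1 / real (Suc k))) + (velocity t)\<^sup>2 / 2" for k
  have h0: "(\<lambda>k. 1 / real (Suc k)) \<longlonglongrightarrow> 0" by (intro LIMSEQ_Suc lim_1_over_n)
  have "D / (2 * \<sigma> * (\<sigma> + 0)) = (dist v (w i) / \<sigma>)\<^sup>2 / 2"
    using \<sigma> by (simp add: D_def power2_eq_square)
  moreover have "X \<longlonglongrightarrow> D / (2 * \<sigma> * (\<sigma> + 0)) + (velocity t)\<^sup>2 / 2"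
    unfolding X_def by (intro tendsto_intros h0) (use \<sigma> in auto)
  ultimately have X: "X \<longlonglongrightarrow> (dist v (w i) / \<sigma>)\<^sup>2 / 2 + (velocity t)\<^sup>2 / 2"
    by metis
  have "\<forall>\<^sub>F k in sequentially. 1 / real (Suc k) < real (Suc i) * \<tau> - t"
    using order_tendstoD(2)[OF h0, of "real (Suc i) * \<tau> - t"] b by simp
  then have ev: "\<forall>\<^sub>F k in sequentially. X k \<le> real (Suc k) * (energy t - energy (t + 1 / real (Suc k)))"
  proof eventually_elim
    case (elim k)
    define h where "h = 1 / real (Suc k)"
    have h: "0 < h" "real (Suc k) * h = 1" unfolding h_def by auto
    have e1: "energy t = moreau i \<sigma> - \<sigma> * (incr i)\<^sup>2 / (2 * \<tau>\<^sup>2)"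
      unfolding \<sigma>_def using b by (intro energy_on_step) auto
    have e2: "energy (t + h) = moreau i (\<sigma> + h) - (\<sigma> + h) * (incr i)\<^sup>2 / (2 * \<tau>\<^sup>2)"
    proof -
      have "t + h \<le> real (Suc i) * \<tau>" "real i * \<tau> < t + h"
        using elim b h(1) unfolding h_def by linarith+
      from energy_on_step[OF this(2,1)] have "energy (t + h)
        = moreau i (t + h - real i * \<tau>) - (t + h - real i * \<tau>) * (incr i)\<^sup>2 / (2 * \<tau>\<^sup>2)" .
      moreover have "t + h - real i * \<tau> = \<sigma> + h" unfolding \<sigma>_def by simp
      ultimately show ?thesis by simp
    qed
    have h\<tau>: "\<sigma> + h \<le> \<tau>"
      using elim unfolding h_def \<sigma>_def by (simp add: algebra_simps)
    have m1: "D * (\<sigma> + h - \<sigma>) / (2 * \<sigma> * (\<sigma> + h)) \<le> moreau i \<sigma> - moreau i (\<sigma> + h)"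
      unfolding D_def
      by (rule moreau_diff[OF _ _ _ v]) (use \<sigma> h h\<tau> in auto)
    have m2: "(\<sigma> + h) * (incr i)\<^sup>2 / (2 * \<tau>\<^sup>2) - \<sigma> * (incr i)\<^sup>2 / (2 * \<tau>\<^sup>2) = h * ((velocity t)\<^sup>2 / 2)"
      unfolding velocity_def i_def[symmetric] by (simp add: power_divide algebra_simps add_divide_distrib)
    have "h * X k \<le> energy t - energy (t + h)"
    proof -
      have "h * X k = D * (\<sigma> + h - \<sigma>) / (2 * \<sigma> * (\<sigma> + h)) + h * ((velocity t)\<^sup>2 / 2)"
        unfolding X_def h_def[symmetric] by (simp add: distrib_left)
      then show ?thesis
        using m1 m2 unfolding e1 e2 by linarith
    qed
    from mult_left_mono[OF this, of "real (Suc k)"]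
    have "real (Suc k) * (h * X k) \<le> real (Suc k) * (energy t - energy (t + h))" by simp
    moreover have "real (Suc k) * (h * X k) = X k" using h(2) by (metis mult.assoc mult_1)
    ultimately show ?case unfolding h_def by simp
  qed
  show thesis
  proof (rule that)
    show "\<bar>f v\<bar> \<noteq> \<infinity>" by (rule v(2))
    show "F (w (Suc (idx t))) \<le> F v" using mono(2) unfolding i_def .
    have "0 \<le> (dist v (w i))\<^sup>2 / (2 * \<sigma>)" using \<sigma> by simp
    then show "F v \<le> F (w (idx t))"
      using proximal_le[OF v finite_values[of i]] unfolding i_def[symmetric] by simp
    show "dist v (w (Suc (idx t))) \<le> 2 * incr (idx t)"
      using mono(1) dist_triangle[of v "w (Suc i)" "w i"] unfolding i_def[symmetric] by (simp add: dist_commute)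
    have "descending_slope f v \<le> ennreal (dist v (w i) / \<sigma>)"
      by (rule descending_slope_proximal_le[OF v not_MInf \<sigma>(1)])
    then have "(descending_slope f v)\<^sup>2 / 2 \<le> (ennreal (dist v (w i) / \<sigma>))\<^sup>2 / 2"
      by (intro divide_right_mono_ennreal power_mono) auto
    also have "\<dots> = ennreal ((dist v (w i) / \<sigma>)\<^sup>2 / 2)"
    proof -
      have "(ennreal x)\<^sup>2 / 2 = ennreal (x\<^sup>2 / 2)" if "0 \<le> x" for x
        using that divide_ennreal[of "x\<^sup>2" 2] by (simp add: ennreal_power)
      then show ?thesis using \<sigma> by simp
    qed
    finally have "ennreal ((velocity t)\<^sup>2 / 2) + (descending_slope f v)\<^sup>2 / 2
        \<le> ennreal ((velocity t)\<^sup>2 / 2) + ennreal ((dist v (w i) / \<sigma>)\<^sup>2 / 2)" by (rule add_left_mono)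
    also have "\<dots> = ennreal ((dist v (w i) / \<sigma>)\<^sup>2 / 2 + (velocity t)\<^sup>2 / 2)"
      by (subst ennreal_plus[symmetric]) (auto simp: add.commute)
    also have "\<dots> = liminf (\<lambda>k. ennreal (X k))"
      by (rule lim_imp_Liminf[OF _ tendsto_ennrealI[OF X], symmetric]) simp
    also have "\<dots> \<le> liminf (\<lambda>k. ennreal (real (Suc k) * (energy t - energy (t + 1 / real (Suc k)))))"
      by (intro Liminf_mono eventually_mono[OF ev]) (rule ennreal_leI)
    finally show "ennreal ((velocity t)\<^sup>2 / 2) + (descending_slope f v)\<^sup>2 / 2
      \<le> liminf (\<lambda>k. ennreal (real (Suc k) * (energy t - energy (t + 1 / real (Suc k)))))" .
  qed
qed

section \<open>The discrete velocity\<close>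

lemma velocity_nonneg: "0 \<le> velocity t"
  unfolding velocity_def using \<tau> by simp

lemma velocity_measurable: "velocity \<in> borel_measurable borel"
proof -
  have "(\<lambda>t::real. \<lceil>t / \<tau>\<rceil>) \<in> measurable borel (count_space UNIV)" by measurable
  then have "(\<lambda>t::real. (\<lambda>z. incr (nat (z - 1)) / \<tau>) \<lceil>t / \<tau>\<rceil>) \<in> borel_measurable borel"
    by (rule measurable_compose) simp
  then show ?thesis unfolding velocity_def[abs_def] idx_def by simp
qed

lemma velocity_integral:
  assumes "j \<le> k"
  shows "(velocity has_integral (\<Sum>i=j..<k. incr i)) {real j * \<tau>..real k * \<tau>}"
  using assms
proof (induction k rule: dec_induct)
  case base
  show ?case by (simp add: has_integral_refl)
next
  case (step k)
  have "((\<lambda>_. incr k / \<tau>) has_integral (incr k / \<tau> * (real (Suc k) * \<tau> - real k * \<tau>))) {real k * \<tau>..real (Suc k) * \<tau>}"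
    using has_integral_const_real[of "incr k / \<tau>" "real k * \<tau>" "real (Suc k) * \<tau>"] \<tau> by (simp add: mult.commute)
  then have "((\<lambda>_. incr k / \<tau>) has_integral incr k) {real k * \<tau>..real (Suc k) * \<tau>}"
    using \<tau> by (simp add: algebra_simps)
  \<comment> \<open>The left end point belongs to the preceding step and may carry another value; a
    single point does not affect the integral.\<close>
  then have "(velocity has_integral incr k) {real k * \<tau>..real (Suc k) * \<tau>}"
  proof (rule has_integral_spike_finite[rotated 2])
    show "finite {real k * \<tau>}" by simp
    fix t assume "t \<in> {real k * \<tau>..real (Suc k) * \<tau>} - {real k * \<tau>}"
    then show "velocity t = incr k / \<tau>" unfolding velocity_def using idx_eq[of k t] by auto
  qed
  moreover have "real j * \<tau> \<le> real k * \<tau>" "real k * \<tau> \<le> real (Suc k) * \<tau>" using \<tau> step by (auto intro: mult_right_mono)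
  ultimately have "(velocity has_integral ((\<Sum>i=j..<k. incr i) + incr k)) {real j * \<tau>..real (Suc k) * \<tau>}"
    using has_integral_combine[OF _ _ step.IH] by blast
  then show ?case using step by simp
qed

text \<open>At time \<open>t\<close> the jump of the current step has been made in full, whereas the
  velocity has been integrated over part of the step only; hence the extra
  \<open>incr (idx t)\<close>. Nothing is lost at \<open>s\<close>, as the grid point reached there
  lies to its right.\<close>

lemma dist_le_velocity_integral:
  assumes st: "0 \<le> s" "s \<le> t"
  shows "dist (piecewise_constant \<tau> w s) (piecewise_constant \<tau> w t) \<le> integral {s..t} velocity + incr (idx t)"
proof (cases "s = t")
  case False
  then have t: "0 < t" using st by simp
  define j where "j = nat \<lceil>s / \<tau>\<rceil>"
  define k where "k = idx t"
  have kk: "nat \<lceil>t / \<tau>\<rceil> = Suc k" unfolding k_def by (rule idx_bounds[OF t])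
  have jk: "j \<le> Suc k" unfolding kk[symmetric] j_def using st \<tau>
    by (intro nat_mono ceiling_mono divide_right_mono) auto
  have vi: "velocity integrable_on {s..t}"
  proof (rule integrable_subinterval_real)
    show "velocity integrable_on {real 0 * \<tau>..real (Suc k) * \<tau>}"
      using velocity_integral[of 0 "Suc k"] by (auto simp: integrable_on_def)
  qed (use st idx_bounds[OF t] in \<open>auto simp: k_def\<close>)
  have dist_sum: "dist (w j) (w m) \<le> (\<Sum>i=j..<m. incr i)" if "j \<le> m" for m
    using that
  proof (induction m rule: dec_induct)
    case (step m)
    then show ?case using dist_triangle[of "w j" "w (Suc m)" "w m"] by (simp add: dist_commute)
  qed simp
  show ?thesis
  proof (cases "j = Suc k")
    case True
    then show ?thesis using integral_nonneg[OF vi] velocity_nonneg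
      by (simp add: piecewise_constant_def kk j_def[symmetric])
  next
    case False
    then have jk: "j \<le> k" using jk by simp
    have js: "s \<le> real j * \<tau>"
    proof -
      have "s / \<tau> \<le> real j" unfolding j_def by (rule real_nat_ceiling_ge)
      then show ?thesis using \<tau> by (simp add: field_simps)
    qed
    have "integral {real j * \<tau>..real k * \<tau>} velocity \<le> integral {s..t} velocity"
    proof (rule integral_subset_le)
      show "{real j * \<tau>..real k * \<tau>} \<subseteq> {s..t}" using js idx_bounds[OF t] by (auto simp: k_def)
      show "velocity integrable_on {real j * \<tau>..real k * \<tau>}"
        using velocity_integral[OF jk] by (auto simp: integrable_on_def)
    qed (use vi velocity_nonneg in auto)
    moreover have "integral {real j * \<tau>..real k * \<tau>} velocity = (\<Sum>i=j..<k. incr i)"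
      using velocity_integral[OF jk] by (rule integral_unique)
    moreover have "dist (w j) (w (Suc k)) \<le> (\<Sum>i=j..<k. incr i) + incr k"
      using dist_sum[of "Suc k"] jk by simp
    ultimately show ?thesis by (simp add: piecewise_constant_def kk j_def[symmetric] k_def[symmetric])
  qed
qed simp

text \<open>The sum of squared jumps is controlled by the energy drop, and that drop by the squared
  distance itself through the lower bound. Young's inequality turns this circular estimate into the
  hypothesis of \<open>discrete_Gronwall\<close>.\<close>

lemma dist_bound:
  fixes z :: 'a
  assumes lower: "\<And>v. ereal C \<le> f v + ereal ((dist v z)\<^sup>2 / (2 * \<rho>))" and \<rho>: "0 < \<rho>" "8 * \<tau> \<le> \<rho>"
    and S: "F (w 0) \<le> S" "(dist (w 0) z)\<^sup>2 \<le> S'"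
  shows "(dist (w k) z)\<^sup>2 \<le> 4 * (S' + \<rho> * (S - C)) * exp (8 * (real k * \<tau>) / \<rho>)"
proof -
  define y where "y k = (dist (w k) z)\<^sup>2" for k
  \<comment> \<open>Chosen so that \<open>\<Lambda> * (2 * \<tau>) = \<rho>\<close>: the lower bound
    then returns exactly \<open>y k / 2\<close>, which can be absorbed on the left.\<close>
  define \<Lambda> where "\<Lambda> = \<rho> / (2 * \<tau>)"
  have \<Lambda>: "0 < \<Lambda>" unfolding \<Lambda>_def using \<rho> \<tau> by simp
  have low: "C \<le> F (w k) + y k / (2 * \<rho>)" for k
    using lower[of "w k"] finite_values[of k] unfolding y_def by (cases "f (w k)") auto
  have inc: "y (Suc i) - y i \<le> \<Lambda> * (incr i)\<^sup>2 + y (Suc i) / \<Lambda>" for i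
  proof -
    define p q r where "p = dist (w (Suc i)) z" and "q = dist (w i) z" and "r = incr i"
    have nn: "0 \<le> p" "0 \<le> q" "0 \<le> r" unfolding p_def q_def r_def by simp_all
    have "p \<le> r + q" unfolding p_def q_def r_def by (rule dist_triangle)
    have "p\<^sup>2 - q\<^sup>2 \<le> 2 * r * p"
    proof (cases "p \<le> q")
      case True
      then have "p\<^sup>2 \<le> q\<^sup>2" using nn by (simp add: power_mono)
      moreover have "0 \<le> 2 * r * p" using nn by simp
      ultimately show ?thesis by linarith
    next
      case False
      have "p\<^sup>2 - q\<^sup>2 = (p - q) * (p + q)" by (simp add: power2_eq_square algebra_simps)
      also have "\<dots> \<le> r * (2 * p)" using False nn \<open>p \<le> r + q\<close> by (intro mult_mono) auto
      finally show ?thesis by simp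
    qed
    also have "2 * r * p \<le> \<Lambda> * r\<^sup>2 + p\<^sup>2 / \<Lambda>"
    proof -
      have "0 \<le> (\<Lambda> * r - p)\<^sup>2 / \<Lambda>" using \<Lambda> by simp
      also have "\<dots> = \<Lambda> * r\<^sup>2 + p\<^sup>2 / \<Lambda> - 2 * r * p"
        using \<Lambda> by (simp add: power2_eq_square field_simps)
      finally show ?thesis by simp
    qed
    finally show ?thesis unfolding y_def p_def q_def r_def .
  qed
  have sum: "y k - y 0 \<le> \<Lambda> * (\<Sum>i<k. (incr i)\<^sup>2) + (\<Sum>i<k. y (Suc i)) / \<Lambda>" for k
  proof (induction k)
    case (Suc k)
    then show ?case using inc[of k] by (simp add: algebra_simps add_divide_distrib)
  qed simp
  have main: "y k \<le> 2 * (S' + \<rho> * (S - C)) + 2 / \<Lambda> * (\<Sum>i<k. y (Suc i))" for k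
  proof -
    have "\<Lambda> * (\<Sum>i<k. (incr i)\<^sup>2) \<le> \<Lambda> * (2 * \<tau> * (F (w 0) - F (w k)))"
      using \<Lambda> by (intro mult_left_mono sum_incr_le) simp
    also have "\<dots> = \<rho> * (F (w 0) - F (w k))" unfolding \<Lambda>_def using \<tau> by simp
    also have "\<dots> \<le> \<rho> * (S - C + y k / (2 * \<rho>))"
      using low[of k] S \<rho> by (intro mult_left_mono) auto
    also have "\<dots> = \<rho> * (S - C) + y k / 2" using \<rho> by (simp add: algebra_simps)
    finally have "y k \<le> S' + \<rho> * (S - C) + y k / 2 + (\<Sum>i<k. y (Suc i)) / \<Lambda>"
      using sum[of k] S(2) unfolding y_def by linarith
    then have "y k \<le> 2 * (S' + \<rho> * (S - C)) + 2 * ((\<Sum>i<k. y (Suc i)) / \<Lambda>)" by argo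
    then show ?thesis by simp
  qed
  have P: "0 \<le> 2 * (S' + \<rho> * (S - C))"
  proof -
    have "0 \<le> y 0" unfolding y_def by simp
    then show ?thesis using main[of 0] by simp
  qed
  have "y k \<le> 2 * (2 * (S' + \<rho> * (S - C))) * exp (2 * (2 / \<Lambda>) * real k)"
  proof (rule discrete_Gronwall[OF _ P])
    show "0 \<le> 2 / \<Lambda>" using \<Lambda> by simp
    \<comment> \<open>Since \<open>2 / \<Lambda> = 4 * \<tau> / \<rho>\<close>, this is the
      condition \<open>8 * \<tau> \<le> \<rho>\<close>.\<close>
    show "2 / \<Lambda> \<le> 1 / 2" unfolding \<Lambda>_def using \<rho> \<tau> by (simp add: field_simps)
  qed (use main in \<open>auto simp: y_def\<close>)
  also have "2 * (2 / \<Lambda>) * real k = 8 * (real k * \<tau>) / \<rho>"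
    unfolding \<Lambda>_def using \<tau> \<rho> by (simp add: field_simps)
  finally show ?thesis unfolding y_def by (simp add: algebra_simps)
qed

end

section \<open>Limits of discrete solutions\<close>

lemma ennreal_liminf_add_le:
  fixes x y :: "nat \<Rightarrow> ennreal"
  shows "liminf x + liminf y \<le> liminf (\<lambda>n. x n + y n)"
proof -
  have "liminf x + liminf y = (SUP n. (INF k\<in>{n..}. x k) + (INF k\<in>{n..}. y k))"
    unfolding liminf_SUP_INF
    by (rule ennreal_SUP_add[symmetric]) (auto simp: incseq_def intro!: INF_superset_mono)
  also have "\<dots> \<le> liminf (\<lambda>n. x n + y n)"
    unfolding liminf_SUP_INF by (intro SUP_mono bexI INF_greatest add_mono INF_lower) auto
  finally show ?thesis .
qed

text \<open>Only the dominating sequence \<open>Y\<close> is known to converge. If \<open>z\<close>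
  exceeded the root of its limit, a number in between would eventually lie below \<open>X n\<close>,
  and its square below \<open>Y n\<close>.\<close>

lemma power2_le_of_liminf:
  fixes X Y :: "nat \<Rightarrow> ennreal"
  assumes z: "z \<le> liminf X" and XY: "\<And>n. (X n)\<^sup>2 \<le> Y n" and Y: "Y \<longlonglongrightarrow> l"
  shows "z\<^sup>2 \<le> l"
proof (cases l)
  case (real l')
  have "z \<le> ennreal (sqrt l')"
  proof (rule ccontr)
    assume "\<not> z \<le> ennreal (sqrt l')"
    then obtain x where x: "ennreal (sqrt l') < x" "x < z" using dense by (auto simp: not_le)
    then have "x < liminf X" using z by simp
    then have "\<forall>\<^sub>F n in sequentially. x < X n" by (rule less_LiminfD)
    then have "\<forall>\<^sub>F n in sequentially. x\<^sup>2 \<le> Y n"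
      by eventually_elim (use XY in \<open>meson less_imp_le order_trans power_mono zero_le\<close>)
    with Y have "x\<^sup>2 \<le> l" by (intro tendsto_lowerbound[OF Y]) auto
    obtain x' where x': "x = ennreal x'" "0 \<le> x'" using x(2) by (cases x) auto
    have "x'\<^sup>2 \<le> l'" using \<open>x\<^sup>2 \<le> l\<close> real x' by (simp add: ennreal_power)
    then have "x' \<le> sqrt l'" using x' by (simp add: real_le_rsqrt)
    then have "x \<le> ennreal (sqrt l')" unfolding x'(1) by (rule ennreal_leI)
    then show False using x(1) by simp
  qed
  then have "z\<^sup>2 \<le> (ennreal (sqrt l'))\<^sup>2" by (rule power_mono) simp
  then show ?thesis using real by (simp add: ennreal_power)
qed simp

lemma ennreal_le_one_plus_power2: "x \<le> 1 + x\<^sup>2" for x :: ennreal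
proof (cases x)
  case (real r)
  have "r \<le> 1 + r\<^sup>2"
  proof -
    have "0 \<le> (r - 1)\<^sup>2" by simp
    then have "2 * r \<le> 1 + r\<^sup>2" by (simp add: power2_eq_square algebra_simps)
    then show ?thesis using real by linarith
  qed
  then have "ennreal r \<le> ennreal (1 + r\<^sup>2)" by (rule ennreal_leI)
  then show ?thesis using real by (simp add: ennreal_power)
qed simp

lemma two_times_half_ennreal: "2 * (y / 2) = (y :: ennreal)"
  by (simp add: ennreal_divide_times mult.commute[of 2] ennreal_divide_self)

lemma lebesgue_on_integral_indicator:
  fixes A :: "real \<Rightarrow> real"
  assumes "{s..t} \<subseteq> {a..b}"
  shows "(\<integral>x. indicator {s..t} x * A x \<partial>lebesgue_on {a..b}) = integral\<^sup>L (lebesgue_on {s..t}) A"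
proof -
  have "(\<integral>x. indicator {s..t} x * A x \<partial>lebesgue_on {a..b})
      = (\<integral>x. indicator {a..b} x *\<^sub>R (indicator {s..t} x * A x) \<partial>lebesgue)"
    by (rule integral_restrict_space) simp
  also have "\<dots> = (\<integral>x. indicator {s..t} x *\<^sub>R A x \<partial>lebesgue)"
    by (rule Bochner_Integration.integral_cong) (use assms in \<open>auto simp: indicator_def\<close>)
  also have "\<dots> = integral\<^sup>L (lebesgue_on {s..t}) A"
    by (rule integral_restrict_space[symmetric]) simp
  finally show ?thesis .
qed

lemma AE_lebesgue_onI:
  assumes "AE x in lebesgue. P x" shows "AE x in lebesgue_on {a..b::real}. P x"
  using assms by (subst AE_restrict_space_iff) (auto elim!: eventually_mono)

text \<open>The energies converge at rational times only, so the dissipation bound is first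
  available between rational end points; exhausting the interval from inside and Fatou's lemma
  remove this restriction.\<close>

lemma nn_integral_lebesgue_on_le_of_rationals:
  fixes h :: "real \<Rightarrow> ennreal"
  assumes h: "h \<in> borel_measurable (lebesgue_on {s..t})"
    and le: "\<And>p q. p \<in> \<rat> \<Longrightarrow> q \<in> \<rat> \<Longrightarrow> s < p \<Longrightarrow> p < q \<Longrightarrow> q < t \<Longrightarrow> (\<integral>\<^sup>+r. h r \<partial>lebesgue_on {p..q}) \<le> c"
  shows "(\<integral>\<^sup>+r. h r \<partial>lebesgue_on {s..t}) \<le> c"
proof (cases "s < t")
  case False
  then have "{s..t} = {} \<or> {s..t} = {s}" by auto
  then have null: "{s..t} \<in> null_sets lebesgue" by (auto simp: negligible_iff_null_sets[symmetric])
  have "(\<integral>\<^sup>+r. h r \<partial>lebesgue_on {s..t}) = (\<integral>\<^sup>+r. h r * indicator {s..t} r \<partial>lebesgue)"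
    by (rule nn_integral_restrict_space) simp
  also have "\<dots> = 0"
    using nn_integral_null_set[OF null, of h] by simp
  finally show ?thesis by simp
next
  case True
  \<comment> \<open>The midpoint separates the two rational sequences, so that
    \<open>p n < q n\<close> for every \<open>n\<close>.\<close>
  define m where "m = (s + t) / 2"
  have m: "s < m" "m < t" using True unfolding m_def by auto
  have "\<exists>p. p \<in> \<rat> \<and> s < p \<and> p < min m (s + 1 / real (Suc n))" for n
    using Rats_dense_in_real[of s "min m (s + 1 / real (Suc n))"] m by auto
  then obtain p where p: "\<And>n. p n \<in> \<rat> \<and> s < p n \<and> p n < min m (s + 1 / real (Suc n))" by metis
  have "\<exists>q. q \<in> \<rat> \<and> max m (t - 1 / real (Suc n)) < q \<and> q < t" for n
    using Rats_dense_in_real[of "max m (t - 1 / real (Suc n))" t] m by auto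
  then obtain q where q: "\<And>n. q n \<in> \<rat> \<and> max m (t - 1 / real (Suc n)) < q n \<and> q n < t" by metis
  define g where "g n r = h r * indicator {p n..q n} r" for n r
  have gm: "g n \<in> borel_measurable (lebesgue_on {s..t})" for n
  proof -
    have "{p n..q n} \<in> sets (lebesgue_on {s..t})"
      using p[of n] q[of n] by (auto simp: sets_restrict_space_iff)
    then show ?thesis unfolding g_def using h by measurable
  qed
  have g_int: "(\<integral>\<^sup>+r. g n r \<partial>lebesgue_on {s..t}) \<le> c" for n
  proof -
    have "(\<integral>\<^sup>+r. g n r \<partial>lebesgue_on {s..t}) = (\<integral>\<^sup>+r. g n r * indicator {s..t} r \<partial>lebesgue)"
      by (rule nn_integral_restrict_space) simp
    also have "\<dots> = (\<integral>\<^sup>+r. h r * indicator {p n..q n} r \<partial>lebesgue)"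
      using p[of n] q[of n] by (intro nn_integral_cong) (auto simp: g_def indicator_def)
    also have "\<dots> = (\<integral>\<^sup>+r. h r \<partial>lebesgue_on {p n..q n})"
      by (rule nn_integral_restrict_space[symmetric]) simp
    also have "\<dots> \<le> c" using le[of "p n" "q n"] p[of n] q[of n] by auto
    finally show ?thesis .
  qed
  have "AE r in lebesgue. r \<notin> {s, t}"
    by (rule AE_not_in) (simp add: negligible_iff_null_sets[symmetric])
  then have "AE r in lebesgue_on {s..t}. r \<notin> {s, t}"
    by (rule AE_lebesgue_onI)
  moreover have "AE r in lebesgue_on {s..t}. r \<in> {s..t}"
    using AE_space[of "lebesgue_on {s..t}"] by simp
  ultimately have "AE r in lebesgue_on {s..t}. h r \<le> liminf (\<lambda>n. g n r)"
  proof eventually_elim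
    case (elim r)
    then have r: "s < r" "r < t" by auto
    have h0: "(\<lambda>n. 1 / real (Suc n)) \<longlonglongrightarrow> 0" by (intro LIMSEQ_Suc lim_1_over_n)
    have "\<forall>\<^sub>F n in sequentially. 1 / real (Suc n) < min (r - s) (t - r)"
      using order_tendstoD(2)[OF h0, of "min (r - s) (t - r)"] r by simp
    then have "\<forall>\<^sub>F n in sequentially. h r \<le> g n r"
    proof eventually_elim
      case (elim n)
      then have "r \<in> {p n..q n}" using p[of n] q[of n] by auto
      then show ?case unfolding g_def by simp
    qed
    then show ?case by (rule Liminf_bounded)
  qed
  then have "(\<integral>\<^sup>+r. h r \<partial>lebesgue_on {s..t}) \<le> (\<integral>\<^sup>+r. liminf (\<lambda>n. g n r) \<partial>lebesgue_on {s..t})"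
    by (rule nn_integral_mono_AE)
  also have "\<dots> \<le> liminf (\<lambda>n. \<integral>\<^sup>+r. g n r \<partial>lebesgue_on {s..t})"
    by (rule nn_integral_liminf[OF gm])
  also have "\<dots> \<le> liminf (\<lambda>n. c)" by (intro Liminf_mono always_eventually allI g_int)
  finally show ?thesis by (simp add: Liminf_const)
qed

text \<open>\<open>closure\<close> is stated along arbitrary subsequences because the indices with
  bounded slopes vary with the time. \<open>\<tau>_le\<close> ensures that the step containing
  \<open>t\<close> ends before \<open>t + 1\<close>, within reach of \<open>bounds\<close>.\<close>

locale discrete_limit =
  fixes \<phi> :: "nat \<Rightarrow> 'a::metric_space \<Rightarrow> ereal" and \<tau> :: "nat \<Rightarrow> real" and w :: "nat \<Rightarrow> nat \<Rightarrow> 'a"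
    and \<phi>0 :: "'a \<Rightarrow> ereal" and u :: "real \<Rightarrow> 'a"
  assumes scheme: "\<And>n. discrete_scheme (\<phi> n) (\<tau> n) (w n)"
    and \<tau>_le: "\<And>n. \<tau> n \<le> 1" and \<tau>_lim: "\<tau> \<longlonglongrightarrow> 0"
    and bounds: "\<And>L. \<exists>M. \<forall>n k. real k * \<tau> n \<le> L \<longrightarrow> \<bar>real_of_ereal (\<phi> n (w n k))\<bar> \<le> M"
    and conv: "\<And>t. 0 \<le> t \<Longrightarrow> (\<lambda>n. piecewise_constant (\<tau> n) (w n) t) \<longlonglongrightarrow> u t"
    and closure: "\<And>r v x M. strict_mono (r :: nat \<Rightarrow> nat) \<Longrightarrow> v \<longlonglongrightarrow> x \<Longrightarrow>
      (\<And>n. \<bar>\<phi> (r n) (v n)\<bar> \<le> ereal M) \<Longrightarrow> (\<And>n. descending_slope (\<phi> (r n)) (v n) \<le> ennreal M) \<Longrightarrow>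
      (\<lambda>n. \<phi> (r n) (v n)) \<longlonglongrightarrow> \<phi>0 x \<and>
      descending_slope \<phi>0 x \<le> liminf (\<lambda>n. descending_slope (\<phi> (r n)) (v n))"
    and lsc: "lower_semicontinuous \<phi>0" and not_MInf0: "\<And>x. \<phi>0 x \<noteq> -\<infinity>"
begin

sublocale S: discrete_scheme "\<phi> n" "\<tau> n" "w n" for n by (rule scheme)

abbreviation E :: "nat \<Rightarrow> real \<Rightarrow> real" where "E n \<equiv> S.energy n"
abbreviation vel :: "nat \<Rightarrow> real \<Rightarrow> real" where "vel n \<equiv> S.velocity n"
abbreviation idx :: "nat \<Rightarrow> real \<Rightarrow> nat" where "idx n \<equiv> S.idx n"

definition Q :: "nat \<Rightarrow> real \<Rightarrow> ennreal" where
  "Q n t = liminf (\<lambda>k. ennreal (real (Suc k) * (E n t - E n (t + 1 / real (Suc k)))))"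

text \<open>\<open>H n\<close> is what remains of the dissipation after the velocity; it bounds the squared slope at the
  interpolating points.\<close>

definition H :: "nat \<Rightarrow> real \<Rightarrow> ennreal" where
  "H n t = 2 * Q n t - ennreal ((vel n t)\<^sup>2)"

text \<open>The grids of all \<open>n\<close> together are still countable, so a single null set of
  times serves the whole sequence.\<close>

definition grid :: "real set" where
  "grid = (\<Union>n. range (\<lambda>i. real i * \<tau> n))"

lemma idx_step_le: "0 < t \<Longrightarrow> real (Suc (idx n t)) * \<tau> n \<le> t + 1"
  using S.idx_bounds(1)[of t n] \<tau>_le[of n] by (simp add: algebra_simps)

lemma energy_bounded: "\<exists>M. \<forall>n t. 0 \<le> t \<and> t \<le> L \<longrightarrow> \<bar>E n t\<bar> \<le> M"
proof -
  obtain M where M: "\<And>n k. real k * \<tau> n \<le> L + 1 \<Longrightarrow> \<bar>real_of_ereal (\<phi> n (w n k))\<bar> \<le> M"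
    using bounds[of "L + 1"] by blast
  have "\<bar>E n t\<bar> \<le> M" if t: "0 \<le> t" "t \<le> L" for n t
  proof (cases "t = 0")
    case True
    then show ?thesis using M[of 0 n] t by (simp add: S.energy_def)
  next
    case False
    then have t0: "0 < t" using t by simp
    have "real (idx n t) * \<tau> n \<le> L + 1" "real (Suc (idx n t)) * \<tau> n \<le> L + 1"
      using S.idx_bounds(1)[OF t0, of n] idx_step_le[OF t0, of n] t by linarith+
    then show ?thesis using M[of "idx n t" n] M[of "Suc (idx n t)" n] S.energy_bounds[OF t0, of n] by linarith
  qed
  then show ?thesis by blast
qed

text \<open>The energy drop in one step is bounded, so the jump is of order
  \<open>sqrt (\<tau> n)\<close>. Hence interpolating points and grid values near \<open>t\<close>
  share the limit \<open>u t\<close>.\<close>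

lemma incr_tendsto:
  assumes t: "0 < t" shows "(\<lambda>n. S.incr n (idx n t)) \<longlonglongrightarrow> 0"
proof -
  obtain M where M: "\<And>n k. real k * \<tau> n \<le> t + 1 \<Longrightarrow> \<bar>real_of_ereal (\<phi> n (w n k))\<bar> \<le> M"
    using bounds[of "t + 1"] by blast
  have b: "S.incr n (idx n t) \<le> sqrt (4 * M * \<tau> n)" for n
  proof -
    have "real (idx n t) * \<tau> n \<le> t + 1" "real (Suc (idx n t)) * \<tau> n \<le> t + 1"
      using S.idx_bounds(1)[OF t, of n] idx_step_le[OF t, of n] by linarith+
    then have d: "S.F n (w n (idx n t)) - S.F n (w n (Suc (idx n t))) \<le> 2 * M"
      using M[of "idx n t" n] M[of "Suc (idx n t)" n] by linarith
    have \<tau>0: "0 \<le> 2 * \<tau> n" using S.\<tau>[of n] by simp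
    have "(S.incr n (idx n t))\<^sup>2 \<le> 2 * \<tau> n * (S.F n (w n (idx n t)) - S.F n (w n (Suc (idx n t))))"
      using S.step_le[of n "idx n t"] S.\<tau>[of n] by (simp add: field_simps)
    also have "\<dots> \<le> 2 * \<tau> n * (2 * M)" by (rule mult_left_mono[OF d \<tau>0])
    finally have "(S.incr n (idx n t))\<^sup>2 \<le> 4 * M * \<tau> n" by (simp only: ac_simps)
    then show ?thesis by (rule real_le_rsqrt)
  qed
  have "(\<lambda>n. sqrt (4 * M * \<tau> n)) \<longlonglongrightarrow> sqrt (4 * M * 0)"
    by (intro tendsto_intros \<tau>_lim)
  then have l: "(\<lambda>n. sqrt (4 * M * \<tau> n)) \<longlonglongrightarrow> 0" by simp
  show ?thesis
    by (rule tendsto_sandwich[OF _ _ tendsto_const l]) (rule always_eventually, rule allI, rule zero_le_dist b)+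
qed

lemma grid_null: "AE t in lebesgue. t \<notin> grid"
proof (rule AE_not_in)
  have "countable grid" unfolding grid_def by auto
  then show "grid \<in> null_sets lebesgue"
    by (intro null_sets_completionI countable_imp_null_set_lborel)
qed

lemma interp_obtain:
  assumes t: "0 < t" "t \<notin> grid"
  obtains v where "dist v (w n (Suc (idx n t))) \<le> 2 * S.incr n (idx n t)" "\<bar>\<phi> n v\<bar> \<noteq> \<infinity>"
    "S.F n (w n (Suc (idx n t))) \<le> S.F n v" "S.F n v \<le> S.F n (w n (idx n t))"
    "ennreal ((vel n t)\<^sup>2) + (descending_slope (\<phi> n) v)\<^sup>2 \<le> 2 * Q n t"
proof -
  have "t \<noteq> real (Suc (idx n t)) * \<tau> n" using t(2) unfolding grid_def by blast
  then show thesis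
  proof (rule S.energy_quotient[OF t(1)])
    fix v assume v: "dist v (w n (Suc (idx n t))) \<le> 2 * S.incr n (idx n t)" "\<bar>\<phi> n v\<bar> \<noteq> \<infinity>"
      "S.F n (w n (Suc (idx n t))) \<le> S.F n v" "S.F n v \<le> S.F n (w n (idx n t))"
      "ennreal ((vel n t)\<^sup>2 / 2) + (descending_slope (\<phi> n) v)\<^sup>2 / 2
        \<le> liminf (\<lambda>k. ennreal (real (Suc k) * (E n t - E n (t + 1 / real (Suc k)))))"
    have "2 * (ennreal ((vel n t)\<^sup>2 / 2) + (descending_slope (\<phi> n) v)\<^sup>2 / 2) \<le> 2 * Q n t"
      unfolding Q_def using v(5) by (rule mult_left_mono) simp
    moreover have "2 * ennreal ((vel n t)\<^sup>2 / 2) = ennreal ((vel n t)\<^sup>2)"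
      using ennreal_mult[of 2 "(vel n t)\<^sup>2 / 2"] by simp
    ultimately have "ennreal ((vel n t)\<^sup>2) + (descending_slope (\<phi> n) v)\<^sup>2 \<le> 2 * Q n t"
      by (simp only: distrib_left two_times_half_ennreal)
    with v(1-4) show thesis by (rule that)
  qed
qed

lemma Q_measurable: "Q n \<in> borel_measurable (lebesgue_on X)"
proof -
  have "(\<lambda>x. - E n x) \<in> borel_measurable borel"
    using antimonoD[OF S.energy_antimono] by (intro borel_measurable_mono monoI) auto
  from borel_measurable_uminus[OF this] have [measurable]: "E n \<in> borel_measurable borel" by simp
  have "Q n \<in> borel_measurable borel" unfolding Q_def[abs_def] by measurable
  then show ?thesis by (intro measurable_restrict_space1 measurable_completion) auto
qed

lemma vel_measurable: "vel n \<in> borel_measurable (lebesgue_on X)"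
  using S.velocity_measurable[of n] by (intro measurable_restrict_space1 measurable_completion) auto

lemma H_measurable: "H n \<in> borel_measurable (lebesgue_on X)"
proof -
  note [measurable] = Q_measurable[of n X] vel_measurable[of n X]
  show ?thesis unfolding H_def[abs_def] by measurable
qed

lemma dissipation_le:
  assumes "0 \<le> a" "a \<le> b"
  shows "(\<integral>\<^sup>+t. ennreal ((vel n t)\<^sup>2) \<partial>lebesgue_on {a..b}) + (\<integral>\<^sup>+t. H n t \<partial>lebesgue_on {a..b})
    \<le> 2 * ennreal (E n a - E n b)"
proof -
  have "AE t in lebesgue_on {a..b}. t \<notin> grid"
    by (rule AE_lebesgue_onI[OF grid_null])
  moreover have "AE t in lebesgue_on {a..b}. t \<in> {a..b}"
    using AE_space[of "lebesgue_on {a..b}"] by simp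
  moreover have "0 \<in> grid" unfolding grid_def by (auto intro!: image_eqI[of _ _ 0])
  \<comment> \<open>Off the grid the squared velocity is at most \<open>2 * Q n t\<close>, so the
    truncated subtraction in \<open>H\<close> is exact.\<close>
  ultimately have eq: "AE t in lebesgue_on {a..b}. ennreal ((vel n t)\<^sup>2) + H n t = 2 * Q n t"
  proof (elim AE_mp, intro AE_I2 impI)
    fix t assume t: "t \<notin> grid" "t \<in> {a..b}" "0 \<in> grid"
    then have "0 < t" using assms by (cases "t = 0") auto
    then have "ennreal ((vel n t)\<^sup>2) \<le> 2 * Q n t"
    proof (rule interp_obtain[OF _ t(1), of n])
      fix v assume "ennreal ((vel n t)\<^sup>2) + (descending_slope (\<phi> n) v)\<^sup>2 \<le> 2 * Q n t"
      then show ?thesis by (rule order_trans[rotated]) simp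
    qed
    then show "ennreal ((vel n t)\<^sup>2) + H n t = 2 * Q n t"
      unfolding H_def by (rule add_diff_inverse_ennreal)
  qed
  note [measurable] = Q_measurable vel_measurable H_measurable
  have "(\<integral>\<^sup>+t. ennreal ((vel n t)\<^sup>2) \<partial>lebesgue_on {a..b}) + (\<integral>\<^sup>+t. H n t \<partial>lebesgue_on {a..b})
      = (\<integral>\<^sup>+t. ennreal ((vel n t)\<^sup>2) + H n t \<partial>lebesgue_on {a..b})"
    by (rule nn_integral_add[symmetric]) measurable
  also have "\<dots> = (\<integral>\<^sup>+t. 2 * Q n t \<partial>lebesgue_on {a..b})"
    by (rule nn_integral_cong_AE[OF eq])
  also have "\<dots> = 2 * (\<integral>\<^sup>+t. Q n t \<partial>lebesgue_on {a..b})"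
    by (rule nn_integral_cmult) measurable
  also have "\<dots> \<le> 2 * ennreal (E n a - E n b)"
    by (intro mult_left_mono nn_integral_difference_quotient_le assms)
      (use antimonoD[OF S.energy_antimono] in \<open>auto simp: Q_def monotone_on_def\<close>)
  finally show ?thesis .
qed

text \<open>The distance estimate is a lower bound for the integral of \<open>vel n\<close> over
  \<open>{s..t}\<close>, up to a jump that vanishes; this is the kind of bound that
  \<open>L2_bounded_weak_limit\<close> preserves.\<close>

lemma velocity_weak_limit:
  assumes ab: "0 \<le> a" "a \<le> b"
  obtains A where "A \<in> borel_measurable (lebesgue_on {a..b})" "\<And>x. 0 \<le> A x"
    "integrable (lebesgue_on {a..b}) (\<lambda>x. (A x)\<^sup>2)" "integrable (lebesgue_on {a..b}) A"
    "(\<integral>\<^sup>+x. ennreal ((A x)\<^sup>2) \<partial>lebesgue_on {a..b}) \<le> liminf (\<lambda>n. \<integral>\<^sup>+x. ennreal ((vel n x)\<^sup>2) \<partial>lebesgue_on {a..b})"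
    "\<forall>s t. a \<le> s \<and> s \<le> t \<and> t \<le> b \<longrightarrow> dist (u s) (u t) \<le> integral\<^sup>L (lebesgue_on {s..t}) A"
proof -
  interpret finite_measure "lebesgue_on {a..b}"
    by (rule finite_measure_lebesgue_on) (auto simp: lmeasurable_interval)
  obtain M where M: "\<And>n t. 0 \<le> t \<Longrightarrow> t \<le> b \<Longrightarrow> \<bar>E n t\<bar> \<le> M"
    using energy_bounded[of b] by blast
  have M0: "0 \<le> M" by (rule order_trans[OF abs_ge_zero M[of b 0]]) (use ab in auto)
  have nn: "(\<integral>\<^sup>+x. ennreal ((vel n x)\<^sup>2) \<partial>lebesgue_on {a..b}) \<le> ennreal (4 * M)" for n
  proof -
    have "(\<integral>\<^sup>+x. ennreal ((vel n x)\<^sup>2) \<partial>lebesgue_on {a..b}) \<le> 2 * ennreal (E n a - E n b)"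
      by (rule order_trans[OF _ dissipation_le[OF ab, of n]]) simp
    also have "\<dots> \<le> 2 * ennreal (2 * M)"
      using M[of a n] M[of b n] ab by (intro mult_left_mono ennreal_leI) auto
    also have "\<dots> = ennreal (4 * M)" using ennreal_mult[of 2 "2 * M"] M0 by simp
    finally show ?thesis .
  qed
  have v2: "integrable (lebesgue_on {a..b}) (\<lambda>x. (vel n x)\<^sup>2)" for n
  proof (rule integrableI_nonneg)
    show "(\<lambda>x. (vel n x)\<^sup>2) \<in> borel_measurable (lebesgue_on {a..b})"
      using vel_measurable[of n "{a..b}"] by measurable
    show "(\<integral>\<^sup>+x. ennreal ((vel n x)\<^sup>2) \<partial>lebesgue_on {a..b}) < \<infinity>"
      using nn[of n] by (rule le_less_trans) simp
  qed simp
  have v1: "integrable (lebesgue_on {a..b}) (vel n)" for n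
    by (rule square_integrable_imp_integrable[OF vel_measurable v2])
  have v3: "(\<integral>x. (vel n x)\<^sup>2 \<partial>lebesgue_on {a..b}) \<le> 4 * M" for n
  proof -
    have "ennreal (\<integral>x. (vel n x)\<^sup>2 \<partial>lebesgue_on {a..b}) \<le> ennreal (4 * M)"
      using nn[of n] nn_integral_eq_integral[OF v2[of n]] by simp
    then show ?thesis using M0 by (simp add: ennreal_le_iff)
  qed
  obtain A where A: "A \<in> borel_measurable (lebesgue_on {a..b})" "\<And>x. 0 \<le> A x"
    "integrable (lebesgue_on {a..b}) (\<lambda>x. (A x)\<^sup>2)"
    "(\<integral>\<^sup>+x. ennreal ((A x)\<^sup>2) \<partial>lebesgue_on {a..b}) \<le> liminf (\<lambda>n. \<integral>\<^sup>+x. ennreal ((vel n x)\<^sup>2) \<partial>lebesgue_on {a..b})"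
    and Alow: "\<And>X c. X \<in> sets (lebesgue_on {a..b}) \<Longrightarrow>
      (\<forall>\<^sub>F n in sequentially. c \<le> (\<integral>x. indicator X x * vel n x \<partial>lebesgue_on {a..b})) \<Longrightarrow>
       c \<le> (\<integral>x. indicator X x * A x \<partial>lebesgue_on {a..b})"
    by (rule L2_bounded_weak_limit[of vel "4 * M", OF vel_measurable S.velocity_nonneg v2 v3]) (rule that)
  have "dist (u s) (u t) \<le> integral\<^sup>L (lebesgue_on {s..t}) A" if st: "a \<le> s" "s \<le> t" "t \<le> b" for s t
  proof (cases "t = 0")
    case True
    then have "s = t" using st ab by simp
    then show ?thesis using A(2) by (simp add: Bochner_Integration.integral_nonneg)
  next
    case False
    then have t: "0 < t" using st ab by simp
    have sub: "{s..t} \<subseteq> {a..b}" using st by auto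
    show ?thesis
    proof (rule field_le_epsilon)
      fix e :: real assume e: "0 < e"
      have "(\<lambda>n. dist (piecewise_constant (\<tau> n) (w n) s) (piecewise_constant (\<tau> n) (w n) t)) \<longlonglongrightarrow> dist (u s) (u t)"
        by (intro tendsto_dist conv) (use st ab in auto)
      then have "\<forall>\<^sub>F n in sequentially. dist (u s) (u t) - e / 2
          < dist (piecewise_constant (\<tau> n) (w n) s) (piecewise_constant (\<tau> n) (w n) t)"
        by (rule order_tendstoD) (use e in simp)
      moreover have "\<forall>\<^sub>F n in sequentially. S.incr n (idx n t) < e / 2"
        by (rule order_tendstoD(2)[OF incr_tendsto[OF t]]) (use e in simp)
      ultimately have "\<forall>\<^sub>F n in sequentially.
          dist (u s) (u t) - e \<le> (\<integral>x. indicator {s..t} x * vel n x \<partial>lebesgue_on {a..b})"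
      proof eventually_elim
        case (elim n)
        have "integrable (lebesgue_on {s..t}) (vel n)"
          by (rule integrable_lebesgue_on_subinterval[OF v1 sub])
        then have "(\<integral>x. indicator {s..t} x * vel n x \<partial>lebesgue_on {a..b}) = integral {s..t} (vel n)"
          unfolding lebesgue_on_integral_indicator[OF sub] by (simp add: lebesgue_integral_eq_integral)
        moreover have "dist (piecewise_constant (\<tau> n) (w n) s) (piecewise_constant (\<tau> n) (w n) t)
            \<le> integral {s..t} (vel n) + S.incr n (idx n t)"
          by (rule S.dist_le_velocity_integral) (use st ab in auto)
        ultimately show ?case using elim by argo
      qed
      then have "dist (u s) (u t) - e \<le> (\<integral>x. indicator {s..t} x * A x \<partial>lebesgue_on {a..b})"
        using sub by (intro Alow) (auto simp: sets_restrict_space_iff)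
      then show "dist (u s) (u t) \<le> integral\<^sup>L (lebesgue_on {s..t}) A + e"
        unfolding lebesgue_on_integral_indicator[OF sub] by simp
    qed
  qed
  moreover have "integrable (lebesgue_on {a..b}) A"
    by (rule square_integrable_imp_integrable[OF A(1,3)])
  ultimately show thesis using that[OF A(1,2,3) _ A(4)] by blast
qed

section \<open>Regularity of the limit curve\<close>

lemma limit_AC2: obtains A where "AC2_bound T u A"
proof (cases "0 \<le> T")
  case True
  show thesis
  proof (rule velocity_weak_limit[OF order_refl True])
    fix A assume "A \<in> borel_measurable (lebesgue_on {0..T})"
      "integrable (lebesgue_on {0..T}) (\<lambda>x. (A x)\<^sup>2)"
      "\<forall>s t. 0 \<le> s \<and> s \<le> t \<and> t \<le> T \<longrightarrow> dist (u s) (u t) \<le> integral\<^sup>L (lebesgue_on {s..t}) A"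
    then show thesis by (intro that[of A]) (simp add: AC2_bound_def)
  qed
next
  case False
  then have "AC2_bound T u (\<lambda>_. 0)" unfolding AC2_bound_def by auto
  then show thesis by (rule that)
qed

lemma limit_continuous: "continuous_on {0..T} u"
proof -
  obtain A where A: "AC2_bound T u A" by (rule limit_AC2)
  show ?thesis
    by (rule continuous_on_of_dist_le_integral[OF AC2_bound_integrable[OF A]]) (use A in \<open>simp add: AC2_bound_def\<close>)
qed

lemma slope_measurable: "(\<lambda>r. descending_slope \<phi>0 (u r)) \<in> borel_measurable (lebesgue_on {0..T})"
proof -
  have "u \<in> borel_measurable (lebesgue_on {0..T})"
    by (rule continuous_imp_measurable_on_sets_lebesgue[OF limit_continuous]) simp
  then show ?thesis
    by (rule measurable_compose) (rule descending_slope_measurable[OF lsc not_MInf0])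
qed

text \<open>Where the lower limit is finite, a subsequence realizing it has bounded slopes at its
  interpolating points; their energies are bounded by \<open>bounds\<close> and they converge to
  \<open>u t\<close>, so \<open>closure\<close> applies. Where it is infinite, the slope bound is
  trivial.\<close>

lemma pointwise_limit:
  assumes t: "0 < t" "t \<notin> grid"
  shows "(descending_slope \<phi>0 (u t))\<^sup>2 \<le> liminf (\<lambda>n. H n t)"
    and "liminf (\<lambda>n. H n t) < \<infinity> \<Longrightarrow> \<exists>r v. strict_mono r \<and>
      (\<forall>n. S.F (r n) (w (r n) (Suc (idx (r n) t))) \<le> S.F (r n) (v n) \<and>
        S.F (r n) (v n) \<le> S.F (r n) (w (r n) (idx (r n) t)) \<and> \<bar>\<phi> (r n) (v n)\<bar> \<noteq> \<infinity>) \<and>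
      (\<lambda>n. \<phi> (r n) (v n)) \<longlonglongrightarrow> \<phi>0 (u t)"
proof -
  have main: "(descending_slope \<phi>0 (u t))\<^sup>2 \<le> liminf (\<lambda>n. H n t) \<and> (\<exists>r v. strict_mono r \<and>
      (\<forall>n. S.F (r n) (w (r n) (Suc (idx (r n) t))) \<le> S.F (r n) (v n) \<and>
        S.F (r n) (v n) \<le> S.F (r n) (w (r n) (idx (r n) t)) \<and> \<bar>\<phi> (r n) (v n)\<bar> \<noteq> \<infinity>) \<and>
      (\<lambda>n. \<phi> (r n) (v n)) \<longlonglongrightarrow> \<phi>0 (u t))" if fin: "liminf (\<lambda>n. H n t) < \<infinity>"
  proof -
    define l where "l = liminf (\<lambda>n. H n t)"
    obtain r0 where r0: "strict_mono r0" "(\<lambda>n. H (r0 n) t) \<longlonglongrightarrow> l"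
      using liminf_subseq_lim[of "\<lambda>n. H n t"] unfolding l_def comp_def by blast
    obtain l' where l': "l = ennreal l'" "0 \<le> l'" using fin unfolding l_def[symmetric] by (cases l) auto
    have "\<forall>\<^sub>F n in sequentially. H (r0 n) t < ennreal (l' + 1)"
      using r0(2) by (rule order_tendstoD) (simp add: l' ennreal_less_iff)
    then obtain N where N: "\<And>n. n \<ge> N \<Longrightarrow> H (r0 n) t < ennreal (l' + 1)"
      by (auto simp: eventually_sequentially)
    \<comment> \<open>Dropping finitely many terms makes the bound on \<open>H\<close> hold for
      every index, as \<open>closure\<close> demands.\<close>
    define r where "r n = r0 (n + N)" for n
    have r: "strict_mono r" using r0(1) unfolding r_def strict_mono_def by simp
    have Hr: "(\<lambda>n. H (r n) t) \<longlonglongrightarrow> l" unfolding r_def using LIMSEQ_ignore_initial_segment[OF r0(2)] .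
    have Hb: "H (r n) t \<le> ennreal (l' + 1)" for n using N[of "n + N"] unfolding r_def by simp
    define P where "P n v \<longleftrightarrow> dist v (w (r n) (Suc (idx (r n) t))) \<le> 2 * S.incr (r n) (idx (r n) t) \<and>
      \<bar>\<phi> (r n) v\<bar> \<noteq> \<infinity> \<and> S.F (r n) (w (r n) (Suc (idx (r n) t))) \<le> S.F (r n) v \<and>
      S.F (r n) v \<le> S.F (r n) (w (r n) (idx (r n) t)) \<and>
      ennreal ((vel (r n) t)\<^sup>2) + (descending_slope (\<phi> (r n)) v)\<^sup>2 \<le> 2 * Q (r n) t" for n v
    have "\<exists>v. P n v" for n
    proof (rule interp_obtain[OF t, of "r n"])
      fix v assume v: "dist v (w (r n) (Suc (idx (r n) t))) \<le> 2 * S.incr (r n) (idx (r n) t)"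
        "\<bar>\<phi> (r n) v\<bar> \<noteq> \<infinity>" "S.F (r n) (w (r n) (Suc (idx (r n) t))) \<le> S.F (r n) v"
        "S.F (r n) v \<le> S.F (r n) (w (r n) (idx (r n) t))"
        "ennreal ((vel (r n) t)\<^sup>2) + (descending_slope (\<phi> (r n)) v)\<^sup>2 \<le> 2 * Q (r n) t"
      show "\<exists>v. P n v" unfolding P_def by (intro exI[of _ v] conjI v)
    qed
    then have "\<exists>v. \<forall>n. P n (v n)" by (intro choice allI)
    then obtain v where Pv: "\<forall>n. P n (v n)" by (rule exE)
    have v: "dist (v n) (w (r n) (Suc (idx (r n) t))) \<le> 2 * S.incr (r n) (idx (r n) t)"
      "\<bar>\<phi> (r n) (v n)\<bar> \<noteq> \<infinity>"
      "S.F (r n) (w (r n) (Suc (idx (r n) t))) \<le> S.F (r n) (v n)"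
      "S.F (r n) (v n) \<le> S.F (r n) (w (r n) (idx (r n) t))"
      "ennreal ((vel (r n) t)\<^sup>2) + (descending_slope (\<phi> (r n)) (v n))\<^sup>2 \<le> 2 * Q (r n) t" for n
      using spec[OF Pv, of n] unfolding P_def by simp_all
    have sl: "(descending_slope (\<phi> (r n)) (v n))\<^sup>2 \<le> H (r n) t" for n
    proof -
      have "(descending_slope (\<phi> (r n)) (v n))\<^sup>2
          = ennreal ((vel (r n) t)\<^sup>2) + (descending_slope (\<phi> (r n)) (v n))\<^sup>2 - ennreal ((vel (r n) t)\<^sup>2)"
        by simp
      also have "\<dots> \<le> H (r n) t" unfolding H_def by (rule ennreal_minus_mono[OF v(5) order_refl])
      finally show ?thesis .
    qed
    obtain M where M: "\<And>n k. real k * \<tau> n \<le> t + 1 \<Longrightarrow> \<bar>real_of_ereal (\<phi> n (w n k))\<bar> \<le> M"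
      using bounds[of "t + 1"] by blast
    have Fb: "\<bar>S.F (r n) (v n)\<bar> \<le> M" for n
    proof -
      have "real (idx (r n) t) * \<tau> (r n) \<le> t + 1" "real (Suc (idx (r n) t)) * \<tau> (r n) \<le> t + 1"
        using S.idx_bounds(1)[OF t(1), of "r n"] idx_step_le[OF t(1), of "r n"] by linarith+
      then show ?thesis using M[of "idx (r n) t" "r n"] M[of "Suc (idx (r n) t)" "r n"] v(3)[of n] v(4)[of n] by linarith
    qed
    \<comment> \<open>The squared slopes are at most \<open>l' + 1\<close> and
      \<open>x \<le> 1 + x\<^sup>2\<close>, whence \<open>l' + 2\<close>.\<close>
    define B where "B = max M (l' + 2)"
    have b1: "\<bar>\<phi> (r n) (v n)\<bar> \<le> ereal B" for n
    proof -
      have "\<bar>S.F (r n) (v n)\<bar> \<le> B" using Fb[of n] unfolding B_def by simp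
      then show ?thesis using v(2)[of n] by (cases "\<phi> (r n) (v n)") auto
    qed
    have b2: "descending_slope (\<phi> (r n)) (v n) \<le> ennreal B" for n
    proof -
      have "descending_slope (\<phi> (r n)) (v n) \<le> 1 + (descending_slope (\<phi> (r n)) (v n))\<^sup>2"
        by (rule ennreal_le_one_plus_power2)
      also have "\<dots> \<le> 1 + ennreal (l' + 1)"
        by (intro add_left_mono order_trans[OF sl Hb])
      also have "\<dots> = ennreal (1 + (l' + 1))" using l' by (subst (2) ennreal_plus) auto
      also have "\<dots> \<le> ennreal B" unfolding B_def by (rule ennreal_leI) simp
      finally show ?thesis .
    qed
    have wlim: "(\<lambda>n. w (r n) (Suc (idx (r n) t))) \<longlonglongrightarrow> u t"
    proof -
      have "(\<lambda>n. w n (Suc (idx n t))) \<longlonglongrightarrow> u t"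
        using conv[of t] t(1) S.idx_bounds(3)[OF t(1)] unfolding piecewise_constant_def by simp
      from LIMSEQ_subseq_LIMSEQ[OF this r] show ?thesis by (simp add: comp_def)
    qed
    have vlim: "v \<longlonglongrightarrow> u t"
    proof -
      have "(\<lambda>n. S.incr (r n) (idx (r n) t)) \<longlonglongrightarrow> 0"
        using LIMSEQ_subseq_LIMSEQ[OF incr_tendsto[OF t(1)] r] by (simp add: comp_def)
      from tendsto_mult_left[OF this, of 2]
      have z0: "(\<lambda>n. 2 * S.incr (r n) (idx (r n) t)) \<longlonglongrightarrow> 0" by simp
      have "(\<lambda>n. dist (v n) (w (r n) (Suc (idx (r n) t)))) \<longlonglongrightarrow> 0"
        by (rule tendsto_sandwich[OF always_eventually[OF allI[OF zero_le_dist]]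
          always_eventually[OF allI[OF v(1)]] tendsto_const z0])
      from tendsto_add[OF this tendsto_dist_iff[THEN iffD1, OF wlim]]
      have z: "(\<lambda>n. dist (v n) (w (r n) (Suc (idx (r n) t))) + dist (w (r n) (Suc (idx (r n) t))) (u t)) \<longlonglongrightarrow> 0"
        by simp
      have "\<And>n. dist (v n) (u t) \<le> dist (v n) (w (r n) (Suc (idx (r n) t))) + dist (w (r n) (Suc (idx (r n) t))) (u t)"
        by (rule dist_triangle)
      then have "(\<lambda>n. dist (v n) (u t)) \<longlonglongrightarrow> 0"
        by (intro tendsto_sandwich[OF _ _ tendsto_const z] always_eventually allI zero_le_dist)
      then show ?thesis by (rule tendsto_dist_iff[THEN iffD2])
    qed
    have cl: "(\<lambda>n. \<phi> (r n) (v n)) \<longlonglongrightarrow> \<phi>0 (u t)"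
      "descending_slope \<phi>0 (u t) \<le> liminf (\<lambda>n. descending_slope (\<phi> (r n)) (v n))"
      using closure[OF r vlim b1 b2] by simp_all
    have "(descending_slope \<phi>0 (u t))\<^sup>2 \<le> l"
      by (rule power2_le_of_liminf[OF cl(2) sl Hr])
    then show ?thesis unfolding l_def
      by (intro conjI exI[of _ r] exI[of _ v] allI r v cl)
  qed
  show "(descending_slope \<phi>0 (u t))\<^sup>2 \<le> liminf (\<lambda>n. H n t)"
    using main by (cases "liminf (\<lambda>n. H n t) < \<infinity>") (auto simp: top.not_eq_extremum[symmetric])
  show "\<exists>r v. strict_mono r \<and>
      (\<forall>n. S.F (r n) (w (r n) (Suc (idx (r n) t))) \<le> S.F (r n) (v n) \<and>
        S.F (r n) (v n) \<le> S.F (r n) (w (r n) (idx (r n) t)) \<and> \<bar>\<phi> (r n) (v n)\<bar> \<noteq> \<infinity>) \<and>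
      (\<lambda>n. \<phi> (r n) (v n)) \<longlonglongrightarrow> \<phi>0 (u t)" if "liminf (\<lambda>n. H n t) < \<infinity>"
    using main[OF that] by blast
qed


lemma idx_gap:
  assumes "0 < p" "p + \<tau> n \<le> t" shows "Suc (idx n p) \<le> idx n t"
proof -
  have t: "0 < t" using assms S.\<tau>[of n] by linarith
  have "real (idx n p) * \<tau> n < p" by (rule S.idx_bounds(1)[OF assms(1)])
  then have "real (Suc (idx n p)) * \<tau> n < t" using assms(2) by (simp add: algebra_simps)
  also have "t \<le> real (Suc (idx n t)) * \<tau> n" by (rule S.idx_bounds(2)[OF t])
  finally have "real (Suc (idx n p)) < real (Suc (idx n t))"
    using S.\<tau>[of n] by (simp only: mult_less_cancel_right_pos)
  then show ?thesis by simp
qed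

text \<open>Times at least one step apart lie in different steps, so a grid value separates them.
  This compares the energy at an interpolating point with \<open>E n\<close> at earlier and later
  times.\<close>

lemma energy_sandwich:
  assumes t: "0 < t" and a: "S.F n (w n (Suc (idx n t))) \<le> a" "a \<le> S.F n (w n (idx n t))"
  shows "0 < p \<Longrightarrow> p + \<tau> n \<le> t \<Longrightarrow> a \<le> E n p" and "t + \<tau> n \<le> q \<Longrightarrow> E n q \<le> a"
proof -
  show "a \<le> E n p" if p: "0 < p" "p + \<tau> n \<le> t"
  proof -
    have "S.F n (w n (idx n t)) \<le> S.F n (w n (Suc (idx n p)))" by (rule S.F_antimono[OF idx_gap[OF p]])
    then show ?thesis using S.energy_bounds(1)[OF p(1), of n] a(2) by linarith
  qed
  show "E n q \<le> a" if q: "t + \<tau> n \<le> q"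
  proof -
    have "0 < q" using q t S.\<tau>[of n] by linarith
    moreover have "S.F n (w n (idx n q)) \<le> S.F n (w n (Suc (idx n t)))" by (rule S.F_antimono[OF idx_gap[OF t q]])
    ultimately show ?thesis using S.energy_bounds(2)[of q n] a(1) by linarith
  qed
qed

text \<open>Both dissipation terms are lower semicontinuous, by the weak limit and by Fatou's lemma;
  superadditivity of the lower limit lets them pass together, and the right-hand side
  converges.\<close>

lemma dissipation_limit:
  assumes pq: "0 < p" "p \<le> q" and lim: "(\<lambda>n. E n p) \<longlonglongrightarrow> a" "(\<lambda>n. E n q) \<longlonglongrightarrow> b"
  shows "(\<integral>\<^sup>+t. ennreal ((speed u t)\<^sup>2) \<partial>lebesgue_on {p..q})
    + (\<integral>\<^sup>+t. liminf (\<lambda>n. H n t) \<partial>lebesgue_on {p..q}) \<le> 2 * ennreal (a - b)"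
proof (rule velocity_weak_limit[OF less_imp_le[OF pq(1)] pq(2)])
  fix A assume A: "A \<in> borel_measurable (lebesgue_on {p..q})" "\<And>x. 0 \<le> A x"
    "integrable (lebesgue_on {p..q}) A"
    "(\<integral>\<^sup>+x. ennreal ((A x)\<^sup>2) \<partial>lebesgue_on {p..q}) \<le> liminf (\<lambda>n. \<integral>\<^sup>+x. ennreal ((vel n x)\<^sup>2) \<partial>lebesgue_on {p..q})"
    "\<forall>s t. p \<le> s \<and> s \<le> t \<and> t \<le> q \<longrightarrow> dist (u s) (u t) \<le> integral\<^sup>L (lebesgue_on {s..t}) A"
  have "(\<integral>\<^sup>+t. ennreal ((speed u t)\<^sup>2) \<partial>lebesgue_on {p..q}) \<le> (\<integral>\<^sup>+x. ennreal ((A x)\<^sup>2) \<partial>lebesgue_on {p..q})"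
  proof (rule nn_integral_mono_AE)
    show "AE t in lebesgue_on {p..q}. ennreal ((speed u t)\<^sup>2) \<le> ennreal ((A t)\<^sup>2)"
      using AE_speed_le[OF A(3,5)] by eventually_elim (simp add: ennreal_leI power_mono speed_nonneg)
  qed
  also note A(4)
  finally have 1: "(\<integral>\<^sup>+t. ennreal ((speed u t)\<^sup>2) \<partial>lebesgue_on {p..q})
    \<le> liminf (\<lambda>n. \<integral>\<^sup>+x. ennreal ((vel n x)\<^sup>2) \<partial>lebesgue_on {p..q})" .
  have 2: "(\<integral>\<^sup>+t. liminf (\<lambda>n. H n t) \<partial>lebesgue_on {p..q}) \<le> liminf (\<lambda>n. \<integral>\<^sup>+t. H n t \<partial>lebesgue_on {p..q})"
    by (rule nn_integral_liminf[OF H_measurable])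
  have "(\<integral>\<^sup>+t. ennreal ((speed u t)\<^sup>2) \<partial>lebesgue_on {p..q}) + (\<integral>\<^sup>+t. liminf (\<lambda>n. H n t) \<partial>lebesgue_on {p..q})
    \<le> liminf (\<lambda>n. (\<integral>\<^sup>+x. ennreal ((vel n x)\<^sup>2) \<partial>lebesgue_on {p..q}) + (\<integral>\<^sup>+t. H n t \<partial>lebesgue_on {p..q}))"
    by (rule order_trans[OF add_mono[OF 1 2] ennreal_liminf_add_le])
  also have "\<dots> \<le> liminf (\<lambda>n. ennreal (2 * (E n p - E n q)))"
  proof (intro Liminf_mono always_eventually allI)
    fix n
    show "(\<integral>\<^sup>+x. ennreal ((vel n x)\<^sup>2) \<partial>lebesgue_on {p..q}) + (\<integral>\<^sup>+t. H n t \<partial>lebesgue_on {p..q})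
        \<le> ennreal (2 * (E n p - E n q))"
      using dissipation_le[of p q n] pq ennreal_mult'[of 2 "E n p - E n q"] by simp
  qed
  also have "\<dots> = ennreal (2 * (a - b))"
    by (intro lim_imp_Liminf tendsto_ennrealI tendsto_intros lim) simp
  also have "\<dots> = 2 * ennreal (a - b)" using ennreal_mult'[of 2 "a - b"] by simp
  finally show ?thesis .
qed

text \<open>The subsequence provided by \<open>pointwise_limit\<close> depends on \<open>t\<close>,
  but the energies at rational times converge along the whole sequence, hence along it too. Rational
  times on both sides of \<open>t\<close> squeeze the energies of the interpolating points, and
  continuity of \<open>\<psi>\<close> closes the gap.\<close>

lemma limit_energy_eq:
  assumes \<psi>: "isCont \<psi> t" and t: "0 < t" "t < T" "t \<notin> grid" and fin: "liminf (\<lambda>n. H n t) < \<infinity>"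
    and lim: "\<And>q. q \<in> \<rat> \<Longrightarrow> 0 < q \<Longrightarrow> q < T \<Longrightarrow> (\<lambda>n. E n q) \<longlonglongrightarrow> \<psi> q"
  shows "\<phi>0 (u t) = ereal (\<psi> t)"
proof -
  obtain r v where r: "strict_mono r" and rv: "\<forall>n. S.F (r n) (w (r n) (Suc (idx (r n) t))) \<le> S.F (r n) (v n) \<and>
        S.F (r n) (v n) \<le> S.F (r n) (w (r n) (idx (r n) t)) \<and> \<bar>\<phi> (r n) (v n)\<bar> \<noteq> \<infinity>"
      and lim_v: "(\<lambda>n. \<phi> (r n) (v n)) \<longlonglongrightarrow> \<phi>0 (u t)"
    using pointwise_limit(2)[OF t(1,3) fin] by (elim exE conjE)
  have F: "S.F (r n) (w (r n) (Suc (idx (r n) t))) \<le> S.F (r n) (v n)"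
    "S.F (r n) (v n) \<le> S.F (r n) (w (r n) (idx (r n) t))" "\<bar>\<phi> (r n) (v n)\<bar> \<noteq> \<infinity>" for n
    using spec[OF rv, of n] by simp_all
  have \<tau>r: "(\<lambda>n. \<tau> (r n)) \<longlonglongrightarrow> 0"
    using LIMSEQ_subseq_LIMSEQ[OF \<tau>_lim r] by (simp add: comp_def)
  have Er: "(\<lambda>n. E (r n) q) \<longlonglongrightarrow> \<psi> q" if "q \<in> \<rat>" "0 < q" "q < T" for q
    using LIMSEQ_subseq_LIMSEQ[OF lim[OF that] r] by (simp add: comp_def)
  have "(\<lambda>n. S.F (r n) (v n)) \<longlonglongrightarrow> \<psi> t"
  proof (rule order_tendstoI)
    fix y assume y: "\<psi> t < y"
    then have "\<forall>\<^sub>F s in at t. \<psi> s < y" using \<psi> unfolding isCont_def by (rule order_tendstoD(2)[rotated])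
    then obtain d where d: "0 < d" "\<And>s. s \<noteq> t \<Longrightarrow> dist s t < d \<Longrightarrow> \<psi> s < y"
      unfolding eventually_at by auto
    obtain p where p: "p \<in> \<rat>" "max 0 (t - d) < p" "p < t"
      using Rats_dense_in_real[of "max 0 (t - d)" t] d(1) t by auto
    have "\<psi> p < y" using p by (intro d(2)) (auto simp: dist_real_def)
    then have "\<forall>\<^sub>F n in sequentially. E (r n) p < y"
      using p t by (intro order_tendstoD(2)[OF Er]) auto
    moreover have "\<forall>\<^sub>F n in sequentially. \<tau> (r n) < t - p"
      using p by (intro order_tendstoD(2)[OF \<tau>r]) simp
    ultimately show "\<forall>\<^sub>F n in sequentially. S.F (r n) (v n) < y"
    proof eventually_elim
      case (elim n)
      have "S.F (r n) (v n) \<le> E (r n) p"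
        by (rule energy_sandwich(1)[OF t(1) F(1,2)]) (use p elim in auto)
      with elim show ?case by simp
    qed
  next
    fix y assume y: "y < \<psi> t"
    then have "\<forall>\<^sub>F s in at t. y < \<psi> s" using \<psi> unfolding isCont_def by (rule order_tendstoD(1)[rotated])
    then obtain d where d: "0 < d" "\<And>s. s \<noteq> t \<Longrightarrow> dist s t < d \<Longrightarrow> y < \<psi> s"
      unfolding eventually_at by auto
    obtain q where q: "q \<in> \<rat>" "t < q" "q < min T (t + d)"
      using Rats_dense_in_real[of t "min T (t + d)"] d(1) t by auto
    have "y < \<psi> q" using q by (intro d(2)) (auto simp: dist_real_def)
    then have "\<forall>\<^sub>F n in sequentially. y < E (r n) q"
      using q t by (intro order_tendstoD(1)[OF Er]) auto
    moreover have "\<forall>\<^sub>F n in sequentially. \<tau> (r n) < q - t"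
      using q by (intro order_tendstoD(2)[OF \<tau>r]) simp
    ultimately show "\<forall>\<^sub>F n in sequentially. y < S.F (r n) (v n)"
    proof eventually_elim
      case (elim n)
      have "E (r n) q \<le> S.F (r n) (v n)"
        by (rule energy_sandwich(2)[OF t(1) F(1,2)]) (use q elim in auto)
      with elim show ?case by simp
    qed
  qed
  then have "(\<lambda>n. ereal (S.F (r n) (v n))) \<longlonglongrightarrow> ereal (\<psi> t)" by (rule tendsto_ereal)
  moreover have "(\<lambda>n. ereal (S.F (r n) (v n))) = (\<lambda>n. \<phi> (r n) (v n))"
    by (rule ext) (rule ereal_real'[OF F(3)])
  ultimately have "(\<lambda>n. \<phi> (r n) (v n)) \<longlonglongrightarrow> ereal (\<psi> t)" by (simp only:)
  with lim_v show ?thesis by (rule LIMSEQ_unique)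
qed

lemma maximal_slope_of_energy_limit:
  assumes T: "0 < T" and \<psi>: "antimono \<psi>"
    and lim: "\<And>q. q \<in> \<rat> \<Longrightarrow> 0 < q \<Longrightarrow> q < T + 1 \<Longrightarrow> (\<lambda>n. E n q) \<longlonglongrightarrow> \<psi> q"
  shows "curve_of_maximal_slope \<phi>0 T u"
proof -
  have AEgrid: "AE t in lebesgue. t \<notin> grid" by (rule grid_null)
  have zero_grid: "0 \<in> grid" unfolding grid_def by (auto intro!: image_eqI[of _ _ 0])
  \<comment> \<open>A rational end point beyond \<open>T\<close>, where the energies are known to
    converge.\<close>
  obtain T' where T': "T' \<in> \<rat>" "T < T'" "T' < T + 1" using Rats_dense_in_real[of T "T + 1"] by auto
  have finite_H: "AE t in lebesgue. 0 < t \<and> t < T \<longrightarrow> liminf (\<lambda>n. H n t) < \<infinity>"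
  proof -
    \<comment> \<open>The energies converge at positive rational times, so \<open>(0, T)\<close> is
      covered by countably many intervals with rational end points away from 0; on each the integral
      of the lower limit is finite.\<close>
    have "AE t in lebesgue. t \<in> {1 / real (Suc k)..T'} \<longrightarrow> liminf (\<lambda>n. H n t) \<noteq> \<infinity>" for k
    proof (cases "1 / real (Suc k) \<le> T'")
      case True
      have "1 / real (Suc k) \<in> \<rat>" by (intro Rats_divide) auto
      moreover have "1 / real (Suc k) < T + 1" using True T' by linarith
      ultimately have "(\<integral>\<^sup>+t. ennreal ((speed u t)\<^sup>2) \<partial>lebesgue_on {1 / real (Suc k)..T'})
          + (\<integral>\<^sup>+t. liminf (\<lambda>n. H n t) \<partial>lebesgue_on {1 / real (Suc k)..T'})
          \<le> 2 * ennreal (\<psi> (1 / real (Suc k)) - \<psi> T')"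
        using T T' True by (intro dissipation_limit lim) auto
      also have "\<dots> < \<infinity>" by (simp add: ennreal_mult_less_top)
      finally have "(\<integral>\<^sup>+t. liminf (\<lambda>n. H n t) \<partial>lebesgue_on {1 / real (Suc k)..T'}) \<noteq> \<infinity>" by auto
      moreover have "(\<lambda>t. liminf (\<lambda>n. H n t)) \<in> borel_measurable (lebesgue_on {1 / real (Suc k)..T'})"
        using H_measurable by measurable
      ultimately have "AE t in lebesgue_on {1 / real (Suc k)..T'}. liminf (\<lambda>n. H n t) \<noteq> \<infinity>"
        by (intro nn_integral_PInf_AE)
      then show ?thesis by (subst (asm) AE_restrict_space_iff) auto
    qed auto
    then have "AE t in lebesgue. \<forall>k. t \<in> {1 / real (Suc k)..T'} \<longrightarrow> liminf (\<lambda>n. H n t) \<noteq> \<infinity>"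
      by (intro AE_all_countable[THEN iffD2] allI)
    then show ?thesis
    proof eventually_elim
      case (elim t)
      show ?case
      proof (intro impI)
        assume t: "0 < t \<and> t < T"
        then obtain k where "1 / real (Suc k) < t" using nat_approx_posE by auto
        then have "liminf (\<lambda>n. H n t) \<noteq> \<infinity>" using elim[rule_format, of k] t T' by auto
        then show "liminf (\<lambda>n. H n t) < \<infinity>" by (simp add: top.not_eq_extremum)
      qed
    qed
  qed
  have cont: "AE t in lebesgue. isCont \<psi> t"
  proof -
    have "mono (\<lambda>t. - \<psi> t)" using antimonoD[OF \<psi>] by (intro monoI) simp
    then have "countable {t. \<not> isCont (\<lambda>t. - \<psi> t) t}" by (rule mono_ctble_discont)
    then have null: "{t. \<not> isCont (\<lambda>t. - \<psi> t) t} \<in> null_sets lebesgue"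
      by (intro null_sets_completionI countable_imp_null_set_lborel)
    from AE_not_in[OF null] show ?thesis
    proof eventually_elim
      case (elim t)
      then have "isCont (\<lambda>t. - \<psi> t) t" by simp
      then have "isCont (\<lambda>t. - (- \<psi> t)) t" by (rule isCont_minus)
      then show ?case by simp
    qed
  qed
  have "AE t in lebesgue. t \<notin> {0, T}"
    by (rule AE_not_in) (simp add: negligible_iff_null_sets[symmetric])
  with AEgrid finite_H cont have "AE t in lebesgue. t \<in> {0..T} \<longrightarrow> \<phi>0 (u t) = ereal (\<psi> t)"
  proof eventually_elim
    case (elim t)
    show ?case
    proof
      assume "t \<in> {0..T}"
      with elim have t: "0 < t" "t < T" by auto
      show "\<phi>0 (u t) = ereal (\<psi> t)"
        by (rule limit_energy_eq[where \<psi> = \<psi> and T = T]) (use elim t lim in auto)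
    qed
  qed
  then obtain N where N: "N \<in> null_sets lebesgue" "{t \<in> space lebesgue. \<not> (t \<in> {0..T} \<longrightarrow> \<phi>0 (u t) = ereal (\<psi> t))} \<subseteq> N"
    unfolding eventually_ae_filter by blast
  have neg: "negligible N" using N(1) by (simp add: negligible_iff_null_sets)
  have eq: "\<forall>t\<in>{0..T} - N. \<phi>0 (u t) = ereal (\<psi> t)" using N(2) by auto
  have cont_u: "continuous_on {0..T + 1} u" by (rule limit_continuous)
  obtain A where A: "AC2_bound T u A" by (rule limit_AC2)
  have speed: "is_metric_derivative T u (speed u)" by (rule speed_is_metric_derivative[OF cont_u A])
  have sm: "speed u \<in> borel_measurable (lebesgue_on {0..T})" by (rule speed_measurable[OF cont_u])
  have ineq: "(\<integral>\<^sup>+r. ennreal ((speed u r)\<^sup>2) \<partial>lebesgue_on {s..t}) / 2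
      + (\<integral>\<^sup>+r. (descending_slope \<phi>0 (u r))\<^sup>2 \<partial>lebesgue_on {s..t}) / 2 \<le> ennreal (\<psi> s - \<psi> t)"
    if st: "0 \<le> s" "s \<le> t" "t \<le> T" for s t
  proof -
    define h where "h r = ennreal ((speed u r)\<^sup>2) + (descending_slope \<phi>0 (u r))\<^sup>2" for r
    have sub: "f \<in> borel_measurable (lebesgue_on {p..q})"
      if "f \<in> borel_measurable (lebesgue_on {0..T})" "0 \<le> p" "q \<le> T"
      for f :: "real \<Rightarrow> ennreal" and p q
      by (rule measurable_restrict_mono[OF that(1)]) (use that in auto)
    have m1: "(\<lambda>r. ennreal ((speed u r)\<^sup>2)) \<in> borel_measurable (lebesgue_on {0..T})"
      using sm by measurable
    have m2: "(\<lambda>r. (descending_slope \<phi>0 (u r))\<^sup>2) \<in> borel_measurable (lebesgue_on {0..T})"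
      using slope_measurable[of T] by measurable
    have split: "(\<integral>\<^sup>+r. h r \<partial>lebesgue_on {p..q}) = (\<integral>\<^sup>+r. ennreal ((speed u r)\<^sup>2) \<partial>lebesgue_on {p..q})
        + (\<integral>\<^sup>+r. (descending_slope \<phi>0 (u r))\<^sup>2 \<partial>lebesgue_on {p..q})" if "0 \<le> p" "q \<le> T" for p q
      unfolding h_def by (rule nn_integral_add[OF sub[OF m1 that] sub[OF m2 that]])
    have "(\<integral>\<^sup>+r. h r \<partial>lebesgue_on {s..t}) \<le> 2 * ennreal (\<psi> s - \<psi> t)"
    proof (rule nn_integral_lebesgue_on_le_of_rationals)
      show "h \<in> borel_measurable (lebesgue_on {s..t})"
        unfolding h_def[abs_def] by (intro borel_measurable_add sub[OF m1] sub[OF m2] st)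
      fix p q assume pq: "p \<in> \<rat>" "q \<in> \<rat>" "s < p" "p < q" "q < t"
      have "(\<integral>\<^sup>+r. (descending_slope \<phi>0 (u r))\<^sup>2 \<partial>lebesgue_on {p..q})
          \<le> (\<integral>\<^sup>+r. liminf (\<lambda>n. H n r) \<partial>lebesgue_on {p..q})"
      proof (rule nn_integral_mono_AE)
        have "AE r in lebesgue_on {p..q}. r \<in> {p..q}"
          using AE_space[of "lebesgue_on {p..q}"] by simp
        with AE_lebesgue_onI[OF AEgrid]
        show "AE r in lebesgue_on {p..q}. (descending_slope \<phi>0 (u r))\<^sup>2 \<le> liminf (\<lambda>n. H n r)"
        proof eventually_elim
          case (elim r)
          then show ?case using pq st by (intro pointwise_limit(1)) auto
        qed
      qed
      then have "(\<integral>\<^sup>+r. h r \<partial>lebesgue_on {p..q}) \<le> (\<integral>\<^sup>+r. ennreal ((speed u r)\<^sup>2) \<partial>lebesgue_on {p..q})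
          + (\<integral>\<^sup>+r. liminf (\<lambda>n. H n r) \<partial>lebesgue_on {p..q})"
        using pq st by (subst split) (auto intro: add_left_mono)
      also have "\<dots> \<le> 2 * ennreal (\<psi> p - \<psi> q)"
        using pq st by (intro dissipation_limit lim) auto
      also have "\<dots> \<le> 2 * ennreal (\<psi> s - \<psi> t)"
        using antimonoD[OF \<psi>, of s p] antimonoD[OF \<psi>, of q t] pq
        by (intro mult_left_mono ennreal_leI) auto
      finally show "(\<integral>\<^sup>+r. h r \<partial>lebesgue_on {p..q}) \<le> 2 * ennreal (\<psi> s - \<psi> t)" .
    qed
    then have "(\<integral>\<^sup>+r. h r \<partial>lebesgue_on {s..t}) / 2 \<le> (ennreal (\<psi> s - \<psi> t) * 2) / 2"
      by (intro divide_right_mono_ennreal) (simp add: mult.commute)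
    also have "\<dots> = ennreal (\<psi> s - \<psi> t)" by (rule ennreal_mult_divide_eq) auto
    finally show ?thesis using split[OF st(1,3)] by (simp add: add_divide_distrib_ennreal)
  qed
  have "AC2 T u" unfolding AC2_def using A by blast
  moreover have "antimono_on {0..T} \<psi>" using antimonoD[OF \<psi>] by (auto simp: monotone_on_def)
  moreover have "\<forall>s t. 0 \<le> s \<and> s \<le> t \<and> t \<le> T \<longrightarrow> ennreal (\<psi> s - \<psi> t) \<ge>
      (\<integral>\<^sup>+r. ennreal ((speed u r)\<^sup>2) \<partial>lebesgue_on {s..t}) / 2
      + (\<integral>\<^sup>+r. (descending_slope \<phi>0 (u r))\<^sup>2 \<partial>lebesgue_on {s..t}) / 2"
    using ineq by (intro allI impI) simp
  ultimately show ?thesis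
    unfolding curve_of_maximal_slope_def
    by (intro conjI exI[of _ "speed u"] exI[of _ \<psi>] exI[of _ N] slope_measurable speed neg eq)
qed

text \<open>The limit curve stays the same along a subsequence, so every result of the locale is
  available for the one on which the energies converge.\<close>

lemma subsequence:
  assumes s: "strict_mono s"
  shows "discrete_limit (\<lambda>n. \<phi> (s n)) (\<lambda>n. \<tau> (s n)) (\<lambda>n. w (s n)) \<phi>0 u"
proof (rule discrete_limit.intro)
  show "\<And>n. discrete_scheme (\<phi> (s n)) (\<tau> (s n)) (w (s n))" by (rule scheme)
  show "\<And>n. \<tau> (s n) \<le> 1" by (rule \<tau>_le)
  show "(\<lambda>n. \<tau> (s n)) \<longlonglongrightarrow> 0" using LIMSEQ_subseq_LIMSEQ[OF \<tau>_lim s] by (simp add: comp_def)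
  show "\<exists>M. \<forall>n k. real k * \<tau> (s n) \<le> L \<longrightarrow> \<bar>real_of_ereal (\<phi> (s n) (w (s n) k))\<bar> \<le> M" for L
    using bounds[of L] by blast
  show "(\<lambda>n. piecewise_constant (\<tau> (s n)) (w (s n)) t) \<longlonglongrightarrow> u t" if "0 \<le> t" for t
    using LIMSEQ_subseq_LIMSEQ[OF conv[OF that] s] by (simp add: comp_def)
  show "lower_semicontinuous \<phi>0" by (rule lsc)
  show "\<phi>0 x \<noteq> -\<infinity>" for x by (rule not_MInf0)
  fix r :: "nat \<Rightarrow> nat" and v x M
  assume r: "strict_mono r" and v: "v \<longlonglongrightarrow> x" "\<And>n. \<bar>\<phi> (s (r n)) (v n)\<bar> \<le> ereal M"
    "\<And>n. descending_slope (\<phi> (s (r n))) (v n) \<le> ennreal M"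
  have "strict_mono (\<lambda>n. s (r n))" using strict_mono_o[OF s r] by (simp add: comp_def)
  then show "(\<lambda>n. \<phi> (s (r n)) (v n)) \<longlonglongrightarrow> \<phi>0 x \<and>
      descending_slope \<phi>0 x \<le> liminf (\<lambda>n. descending_slope (\<phi> (s (r n))) (v n))"
    by (rule closure[OF _ v])
qed

lemma limit_maximal_slope:
  assumes T: "0 < T"
  shows "curve_of_maximal_slope \<phi>0 T u"
proof -
  obtain M where M: "\<And>n t. 0 \<le> t \<Longrightarrow> t \<le> T + 1 \<Longrightarrow> \<bar>E n t\<bar> \<le> M"
    using energy_bounded[of "T + 1"] by blast
  \<comment> \<open>Freezing the energy outside \<open>[0, T + 1]\<close> gives the uniform bound on
    the whole line required by \<open>antimono_bounded_subsequence\<close>, while keeping rational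
    times beyond \<open>T\<close>.\<close>
  define f where "f n t = E n (max 0 (min (T + 1) t))" for n t
  have anti: "antimono (f n)" for n
    unfolding f_def by (intro antimonoI antimonoD[OF S.energy_antimono]) auto
  have bd: "\<bar>f n t\<bar> \<le> M" for n t
    unfolding f_def using T by (intro M) auto
  show ?thesis
  proof (rule antimono_bounded_subsequence[of f M, OF anti bd])
    fix s :: "nat \<Rightarrow> nat" and \<psi>
    assume s: "strict_mono s" and \<psi>: "antimono \<psi>" and lim: "\<And>q. q \<in> \<rat> \<Longrightarrow> (\<lambda>n. f (s n) q) \<longlonglongrightarrow> \<psi> q"
    interpret sub: discrete_limit "\<lambda>n. \<phi> (s n)" "\<lambda>n. \<tau> (s n)" "\<lambda>n. w (s n)" \<phi>0 u
      by (rule subsequence[OF s])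
    show ?thesis
    proof (rule sub.maximal_slope_of_energy_limit[OF T \<psi>])
      fix q :: real assume "q \<in> \<rat>" "0 < q" "q < T + 1"
      then show "(\<lambda>n. E (s n) q) \<longlonglongrightarrow> \<psi> q" using lim[of q] unfolding f_def by simp
    qed
  qed
qed

end

theorem theorem4:
  fixes ustar :: "'a::complete_space"
    and \<phi> :: "real \<Rightarrow> 'a \<Rightarrow> ereal" and \<phi>0 :: "'a \<Rightarrow> ereal"
    and Cstar \<tau>star Cstar0 \<tau>star0 :: real
    and u0 :: "real \<Rightarrow> real \<Rightarrow> 'a" and S S' :: real
    and \<tau> :: "real \<Rightarrow> real" and u :: "real \<Rightarrow> 'a"
  assumes "\<forall>\<epsilon>>0. \<forall>x. \<phi> \<epsilon> x \<noteq> -\<infinity>"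
    and "\<forall>x. \<phi>0 x \<noteq> -\<infinity>"
    and "\<forall>\<epsilon>>0. lower_semicontinuous (\<phi> \<epsilon>)"
    and "lower_semicontinuous \<phi>0"
    and "\<tau>star > 0"
    and "\<forall>\<epsilon>>0. (INF v. \<phi> \<epsilon> v + ereal ((dist v ustar)\<^sup>2 / (2 * \<tau>star))) \<ge> ereal Cstar"
    and "\<tau>star0 > 0"
    and "(INF v. \<phi>0 v + ereal ((dist v ustar)\<^sup>2 / (2 * \<tau>star0))) \<ge> ereal Cstar0"
    and "\<forall>C::real>0. \<exists>K. compact K \<and>
           (\<forall>\<epsilon>>0. {x. (dist x ustar)\<^sup>2 \<le> C \<and> \<bar>\<phi> \<epsilon> x\<bar> \<le> ereal C} \<subseteq> K)"
    and "\<forall>C::real>0. \<exists>K. compact K \<and>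
           {x. (dist x ustar)\<^sup>2 \<le> C \<and> \<bar>\<phi>0 x\<bar> \<le> ereal C} \<subseteq> K"
    and "\<forall>(\<delta> :: nat \<Rightarrow> real) (v :: nat \<Rightarrow> 'a) x.
           (\<forall>n. \<delta> n > 0) \<and> \<delta> \<longlonglongrightarrow> 0 \<and> v \<longlonglongrightarrow> x \<and>
           (SUP n. e2ennreal \<bar>\<phi> (\<delta> n) (v n)\<bar> + descending_slope (\<phi> (\<delta> n)) (v n)) < \<infinity>
           \<longrightarrow> (\<lambda>n. \<phi> (\<delta> n) (v n)) \<longlonglongrightarrow> \<phi>0 x \<and>
               liminf (\<lambda>n. descending_slope (\<phi> (\<delta> n)) (v n)) \<ge> descending_slope \<phi>0 x"
    and "\<forall>\<epsilon>>0. \<forall>\<sigma>. 0 < \<sigma> \<and> \<sigma> < \<tau>star \<longrightarrow>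
           (dist (u0 \<epsilon> \<sigma>) ustar)\<^sup>2 \<le> S' \<and> \<bar>\<phi> \<epsilon> (u0 \<epsilon> \<sigma>)\<bar> \<le> ereal S"
    and "\<forall>\<epsilon>>0. \<tau> \<epsilon> > 0"
    and "(\<tau> \<longlongrightarrow> 0) (at_right 0)"
    and "minimizing_movement \<tau>star \<phi> \<tau> (\<lambda>\<epsilon>. u0 \<epsilon> (\<tau> \<epsilon>)) u"
  shows "\<forall>T>0. curve_of_maximal_slope \<phi>0 T u"
proof -
  note not_MInf = assms(1)[rule_format] and lower = assms(6)[rule_format] and cpt = assms(9)[rule_format]
    and closure = assms(11)[rule_format] and init = assms(12)[rule_format] and \<tau>_pos = assms(13)[rule_format]
  obtain w \<delta> where w: "\<And>\<epsilon>. 0 < \<epsilon> \<Longrightarrow> \<tau> \<epsilon> < \<tau>star \<Longrightarrow> discrete_solution (\<phi> \<epsilon>) (\<tau> \<epsilon>) (u0 \<epsilon> (\<tau> \<epsilon>)) (w \<epsilon>)"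
    and \<delta>: "\<And>n::nat. 0 < \<delta> n" "\<delta> \<longlonglongrightarrow> 0"
    and conv: "\<And>t. 0 \<le> t \<Longrightarrow> (\<lambda>n. piecewise_constant (\<tau> (\<delta> n)) (w (\<delta> n)) t) \<longlonglongrightarrow> u t"
    using assms(15) unfolding minimizing_movement_def by auto
  have "filterlim \<delta> (at_right 0) sequentially"
    using \<delta> by (intro tendsto_imp_filterlim_at_right always_eventually allI)
  with assms(14) have \<tau>\<delta>: "(\<lambda>n. \<tau> (\<delta> n)) \<longlonglongrightarrow> 0" by (rule filterlim_compose)
  \<comment> \<open>The bound 1 is for \<open>\<tau>_le\<close>, and \<open>\<tau>star / 8\<close>
    is the smallness needed in \<open>dist_bound\<close>; it also gives the
    \<open>\<tau>star / 4\<close> of \<open>proximal_exists\<close>. Finitely many terms are then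
    dropped.\<close>
  have "\<forall>\<^sub>F n in sequentially. \<tau> (\<delta> n) < min 1 (\<tau>star / 8)"
    using \<tau>\<delta> by (rule order_tendstoD) (use assms(5) in simp)
  then obtain N where N: "\<And>n. n \<ge> N \<Longrightarrow> \<tau> (\<delta> n) < min 1 (\<tau>star / 8)"
    by (auto simp: eventually_sequentially)
  define e where "e n = \<delta> (n + N)" for n
  have e: "0 < e n" "\<tau> (e n) \<le> 1" "8 * \<tau> (e n) \<le> \<tau>star" "\<tau> (e n) < \<tau>star" "0 < \<tau> (e n)" for n
    using \<delta>(1)[of "n + N"] N[of "n + N"] \<tau>_pos[of "e n"] assms(5) unfolding e_def by auto
  have e0: "e \<longlonglongrightarrow> 0" unfolding e_def using LIMSEQ_ignore_initial_segment[OF \<delta>(2)] .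
  have w0: "w (e n) 0 = u0 (e n) (\<tau> (e n))" and prox: "proximal (\<phi> (e n)) (\<tau> (e n)) (w (e n) i) (w (e n) (Suc i))" for n i
    using w[OF e(1) e(4), of n] unfolding discrete_solution_iff_proximal by auto
  have low: "ereal Cstar \<le> \<phi> (e n) v + ereal ((dist v ustar)\<^sup>2 / (2 * \<tau>star))" for n v
    using lower[OF e(1)[of n]] by (rule order_trans) (rule INF_lower, simp)
  have init_n: "(dist (w (e n) 0) ustar)\<^sup>2 \<le> S'" "\<bar>\<phi> (e n) (w (e n) 0)\<bar> \<le> ereal S" for n
    using init[OF e(1), of "\<tau> (e n)" n] e(4,5)[of n] w0[of n] by auto
  have scheme: "discrete_scheme (\<phi> (e n)) (\<tau> (e n)) (w (e n))" for n
  proof (rule discrete_scheme.intro)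
    show "\<phi> (e n) x \<noteq> -\<infinity>" for x by (rule not_MInf[OF e(1)])
    show "0 < \<tau> (e n)" by (rule e(5))
    show "\<bar>\<phi> (e n) (w (e n) 0)\<bar> \<noteq> \<infinity>" using init_n(2)[of n] by auto
    show "proximal (\<phi> (e n)) (\<tau> (e n)) (w (e n) i) (w (e n) (Suc i))" for i by (rule prox)
    fix i \<sigma> assume \<sigma>: "0 < \<sigma>" "\<sigma> \<le> \<tau> (e n)" and fin: "\<bar>\<phi> (e n) (w (e n) i)\<bar> \<noteq> \<infinity>"
    show "\<exists>v. proximal (\<phi> (e n)) \<sigma> (w (e n) i) v"
    proof (rule proximal_exists[OF _ _ low assms(5) _ fin \<sigma>(1)])
      show "lower_semicontinuous (\<phi> (e n))" using assms(3) e(1) by blast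
      show "\<phi> (e n) y \<noteq> -\<infinity>" for y by (rule not_MInf[OF e(1)])
      show "\<sigma> \<le> \<tau>star / 4" using \<sigma> e(3,5)[of n] by simp
      show "\<exists>K. compact K \<and> {x. (dist x ustar)\<^sup>2 \<le> c \<and> \<bar>\<phi> (e n) x\<bar> \<le> ereal c} \<subseteq> K" if "0 < c" for c
        using cpt[OF that] e(1)[of n] by blast
    qed
  qed
  have bounds: "\<exists>M. \<forall>n k. real k * \<tau> (e n) \<le> L \<longrightarrow> \<bar>real_of_ereal (\<phi> (e n) (w (e n) k))\<bar> \<le> M" for L
  proof -
    \<comment> \<open>\<open>P\<close> is the constant of \<open>dist_bound\<close>, and
      \<open>R\<close> bounds the squared distances up to time \<open>L\<close>; the absolute value
      makes the product monotone in the exponential without discussing the sign of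
      \<open>P\<close>.\<close>
    define P where "P = 4 * (S' + \<tau>star * (S - Cstar))"
    define R where "R = \<bar>P\<bar> * exp (8 * L / \<tau>star)"
    \<comment> \<open>From above the energy is bounded by its initial value, hence by
      \<open>S\<close>; from below by \<open>Cstar\<close> minus the penalty
      \<open>R / (2 * \<tau>star)\<close>.\<close>
    define M where "M = \<bar>S\<bar> + \<bar>Cstar\<bar> + R / (2 * \<tau>star)"
    have R0: "0 \<le> R / (2 * \<tau>star)" unfolding R_def using assms(5) by simp
    have "\<bar>real_of_ereal (\<phi> (e n) (w (e n) k))\<bar> \<le> M" if k: "real k * \<tau> (e n) \<le> L" for n k
    proof -
      interpret scheme: discrete_scheme "\<phi> (e n)" "\<tau> (e n)" "w (e n)" by (rule scheme)
      have S0: "scheme.F (w (e n) 0) \<le> S" using init_n(2)[of n] by (cases "\<phi> (e n) (w (e n) 0)") auto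
      have "(dist (w (e n) k) ustar)\<^sup>2 \<le> P * exp (8 * (real k * \<tau> (e n)) / \<tau>star)"
        unfolding P_def by (rule scheme.dist_bound[OF low assms(5) e(3) S0 init_n(1)])
      also have "\<dots> \<le> \<bar>P\<bar> * exp (8 * L / \<tau>star)"
        using k assms(5) by (intro mult_mono) (auto intro!: divide_right_mono)
      finally have "(dist (w (e n) k) ustar)\<^sup>2 / (2 * \<tau>star) \<le> R / (2 * \<tau>star)"
        unfolding R_def using assms(5) by (intro divide_right_mono) auto
      moreover have "Cstar \<le> scheme.F (w (e n) k) + (dist (w (e n) k) ustar)\<^sup>2 / (2 * \<tau>star)"
        using low[of n "w (e n) k"] scheme.finite_values[of k] by (cases "\<phi> (e n) (w (e n) k)") auto
      moreover have "scheme.F (w (e n) k) \<le> scheme.F (w (e n) 0)" by (rule scheme.F_antimono) simp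
      ultimately have "scheme.F (w (e n) k) \<le> M" "- M \<le> scheme.F (w (e n) k)"
        using S0 R0 unfolding M_def by linarith+
      then show ?thesis by linarith
    qed
    then show ?thesis by blast
  qed
  interpret discrete_limit "\<lambda>n. \<phi> (e n)" "\<lambda>n. \<tau> (e n)" "\<lambda>n. w (e n)" \<phi>0 u
  proof (rule discrete_limit.intro)
    show "\<And>n. discrete_scheme (\<phi> (e n)) (\<tau> (e n)) (w (e n))" by (rule scheme)
    show "\<And>n. \<tau> (e n) \<le> 1" by (rule e(2))
    show "(\<lambda>n. \<tau> (e n)) \<longlonglongrightarrow> 0" unfolding e_def using LIMSEQ_ignore_initial_segment[OF \<tau>\<delta>] .
    show "\<exists>M. \<forall>n k. real k * \<tau> (e n) \<le> L \<longrightarrow> \<bar>real_of_ereal (\<phi> (e n) (w (e n) k))\<bar> \<le> M" for L by (rule bounds)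
    show "(\<lambda>n. piecewise_constant (\<tau> (e n)) (w (e n)) t) \<longlonglongrightarrow> u t" if "0 \<le> t" for t
      unfolding e_def using LIMSEQ_ignore_initial_segment[OF conv[OF that]] .
    show "lower_semicontinuous \<phi>0" by (rule assms(4))
    show "\<phi>0 x \<noteq> -\<infinity>" for x using assms(2) by blast
    fix r :: "nat \<Rightarrow> nat" and v x M
    assume r: "strict_mono r" and v: "v \<longlonglongrightarrow> x"
      and b1: "\<And>n. \<bar>\<phi> (e (r n)) (v n)\<bar> \<le> ereal M" and b2: "\<And>n. descending_slope (\<phi> (e (r n))) (v n) \<le> ennreal M"
    have "(SUP n. e2ennreal \<bar>\<phi> (e (r n)) (v n)\<bar> + descending_slope (\<phi> (e (r n))) (v n)) \<le> ennreal M + ennreal M"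
    proof (intro SUP_least add_mono b2)
      fix n
      have "e2ennreal \<bar>\<phi> (e (r n)) (v n)\<bar> \<le> e2ennreal (ereal M)" by (rule e2ennreal_mono[OF b1])
      then show "e2ennreal \<bar>\<phi> (e (r n)) (v n)\<bar> \<le> ennreal M" by simp
    qed
    also have "\<dots> < \<infinity>" by simp
    finally have fin: "(SUP n. e2ennreal \<bar>\<phi> (e (r n)) (v n)\<bar> + descending_slope (\<phi> (e (r n))) (v n)) < \<infinity>" .
    have "(\<lambda>n. e (r n)) \<longlonglongrightarrow> 0" using LIMSEQ_subseq_LIMSEQ[OF e0 r] by (simp add: comp_def)
    then show "(\<lambda>n. \<phi> (e (r n)) (v n)) \<longlonglongrightarrow> \<phi>0 x \<and>
        descending_slope \<phi>0 x \<le> liminf (\<lambda>n. descending_slope (\<phi> (e (r n))) (v n))"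
      by (intro closure[of "\<lambda>n. e (r n)" v x] conjI allI e(1) v fin)
  qed
  show ?thesis using limit_maximal_slope by blast
qed

end
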